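(* Let $Y$ be a random compact subset of $\mathbb{R}^2$ such that $D(a_1)\subset Y\subset D(a_2)$ almost surely for some constants $0<a_1<a_2$, and $\nu(\partial Y)=0$ almost surely. Let $\tilde I$ denote a measurable modification of the colored dead leaves model $I(r_0,r_1)$ (with constant uniform colors), considered on $[0,1]^2$. For all $p\in[1,\infty)$ and all $s\in(0,1)$ the following hold. (a) Let $1<\alpha\le3$ and $0<r_0<r_1<\infty$, or $\alpha>3$ and $0<r_0<r_1\le\infty$. If $Y$ satisfies (A-2), then $$E\left[|\tilde I|_{B_p^{s,p}}^p\right]<\infty\iff s<\frac1p .$$ (b) Let $2<\alpha<3$ and $0=r_0<r_1<\infty$. If $Y$ satisfies (A-3), then $$E\left[|\tilde I|_{B_p^{s,p}}^p\right]<\infty\iff s<\frac{3-\alpha}{p}.$$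
   Context: $\nu$ is Lebesgue measure on $\mathbb{R}^2$; $D(a)$ is the disk of radius $a$ centered at the origin; $|\cdot|$ on $\mathbb{R}^2$ is the Euclidean norm; $\mathring A$, $\partial A$ denote interior and topological boundary. A random closed (compact) set is a random element of the space of closed sets of $\mathbb{R}^2$ with the Borel $\sigma$-field of the Fell topology (a.s. compact). Let $\tilde\gamma(\mathbf{y})=E\,\nu(\mathring Y\cap(\mathbf{y}+\mathring Y))$, $\mathbf{y}\in\mathbb{R}^2$. (A-2): for every unit vector $\mathbf{u}$, the function $x\mapsto\tilde\gamma(x\mathbf{u})$ is differentiable to the right at $x=0$, and the (absolute value of the) derivative is bounded away from zero and infinity independently of $\mathbf{u}$. (A-3): for any $\delta>0$, $\tilde\gamma(\mathbf{x})=\tilde\gamma(0)+o(|\mathbf{x}|^{1-\delta})$ as $\mathbf{x}\to0$. Dead leaves model associated with a random closed set $X$: let $\{(x_i,t_i)\}$ be a homogeneous Poisson point process of intensity one on $\mathbb{R}^2\times\mathbb{R}$ and $(X_i)$ i.i.d. copies of $X$, independent of it. Using only points with $t_i\le 0$, the visible parts are $V_i=(x_i+X_i)\setminus\bigcup_{t_j\in(t_i,0)}(x_j+\mathring X_j)$, $t_i\le 0$; $M=\{V_i\}$, $\partial M=\bigcup_i\partial V_i$. For $r_0>0$, $M(r_0,r_1)$ is the dead leaves model associated with $X=RY$, where $R$ is independent of $Y$ with density proportional to $r^{-\alpha}\mathbf{1}(r_0\le r\le r_1)$. For $r_0>0$, $I(r_0,r_1)$ is the random field on $\mathbb{R}^2$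 equal to $U_i$ on $\mathring V_i\setminus\partial M(r_0,r_1)$ for each $i$, and to $0$ on $\partial M(r_0,r_1)$, where $\{V_i\}$ are the visible parts of $M(r_0,r_1)$ and $(U_i)$ are i.i.d. uniform on $(0,1)$, independent of $M(r_0,r_1)$. For $r_0=0$, $I(0,r_1)$ is a random field whose finite-dimensional distributions are the limits of those of $I(r_0,r_1)$ as $r_0\to0$ (these limits exist). In all the cases of the claim there is a measurable modification $\tilde I$: a jointly measurable (in $\omega$ and $\mathbf{x}$) field, on the same probability space, equal at each fixed $\mathbf{x}$ to $I(r_0,r_1)$ almost surely. Besov norm for $s\in(0,1)$, $p,q\in[1,\infty)$: $|f|_{B_p^{s,q}}=|f|_p+\left(\int_0^\infty(\omega(f,u)_p\,u^{-s})^q\,\frac{du}{u}\right)^{1/q}$, where $|\cdot|_p$ is the $L^p([0,1]^2)$ norm, $\omega(f,u)_p=\sup_{|\mathbf{y}|<u}|\Delta(f,\mathbf{y})|_p$, and $\Delta(f,\mathbf{y})(\mathbf{x})=(f(\mathbf{x}+\mathbf{y})-f(\mathbf{x}))\mathbf{1}(\mathbf{x}\in[0,1]^2,\ \mathbf{x}+\mathbf{y}\in[0,1]^2)$. *)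

theory Defs
  imports "HOL-Probability.Probability" "HOL-Library.Landau_Symbols"
begin

type_synonym plane = "real ^ 2"

text \<open>
  \<^const>\<open>prob_space.indep_var\<close> needs both random variables to take values in the same type; this is
  the same notion without that restriction.
\<close>

definition indep_rv ::
    "'w measure \<Rightarrow> 'b measure \<Rightarrow> ('w \<Rightarrow> 'b) \<Rightarrow> 'c measure \<Rightarrow> ('w \<Rightarrow> 'c) \<Rightarrow> bool" where
  "indep_rv \<Omega> S X T Y \<longleftrightarrow>
     X \<in> measurable \<Omega> S \<and> Y \<in> measurable \<Omega> T \<and>
     prob_space.indep_set \<Omega> {X -` A \<inter> space \<Omega> |A. A \<in> sets S} {Y -` B \<inter> space \<Omega> |B. B \<in> sets T}"


section \<open>Random closed sets\<close>

definition fell_topology :: "'a::topological_space set topology" where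
  "fell_topology = topology_generated_by
     ({{F. closed F \<and> F \<inter> K = {}} |K. compact K} \<union>
      {{F. closed F \<and> F \<inter> G \<noteq> {}} |G. open G})"

lemma topspace_fell_topology: "topspace fell_topology = Collect closed"
proof -
  have "Collect closed = {F. closed F \<and> F \<inter> {} = {}}"
    by simp
  then have "Collect closed \<in> {{F. closed F \<and> F \<inter> K = {}} |K. compact K}"
    using compact_empty by blast
  then show ?thesis
    unfolding fell_topology_def topology_generated_by_topspace
    by (intro subset_antisym Union_least) auto
qed

definition fell_borel :: "'a::topological_space set measure" where
  "fell_borel = sigma (topspace fell_topology) {U. openin fell_topology U}"

definition random_closed_set :: "'w measure \<Rightarrow> ('w \<Rightarrow> plane set) \<Rightarrow> bool" where
  "random_closed_set \<Omega> X \<longleftrightarrow> X \<in> measurable \<Omega> fell_borel"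

definition random_compact_set :: "'w measure \<Rightarrow> ('w \<Rightarrow> plane set) \<Rightarrow> bool" where
  "random_compact_set \<Omega> X \<longleftrightarrow> random_closed_set \<Omega> X \<and> (AE \<omega> in \<Omega>. compact (X \<omega>))"


section \<open>The geometric covariogram of the interior and its regularity\<close>

definition covariogram :: "'w measure \<Rightarrow> ('w \<Rightarrow> plane set) \<Rightarrow> plane \<Rightarrow> real" where
  "covariogram \<Omega> Y y =
     (LINT \<omega>|\<Omega>. measure lborel (interior (Y \<omega>) \<inter> (\<lambda>x. y + x) ` interior (Y \<omega>)))"

definition cond_A2 :: "'w measure \<Rightarrow> ('w \<Rightarrow> plane set) \<Rightarrow> bool" where
  "cond_A2 \<Omega> Y \<longleftrightarrow>
     (\<exists>c C. 0 < c \<and> (\<forall>u. norm u = 1 \<longrightarrow>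
        (\<exists>D. ((\<lambda>x. covariogram \<Omega> Y (x *\<^sub>R u)) has_real_derivative D) (at_right 0)
             \<and> c \<le> \<bar>D\<bar> \<and> \<bar>D\<bar> \<le> C)))"

definition cond_A3 :: "'w measure \<Rightarrow> ('w \<Rightarrow> plane set) \<Rightarrow> bool" where
  "cond_A3 \<Omega> Y \<longleftrightarrow>
     (\<forall>\<delta>>0. (\<lambda>x. covariogram \<Omega> Y x - covariogram \<Omega> Y 0) \<in> o[at 0](\<lambda>x. norm x powr (1 - \<delta>)))"


section \<open>Dead leaves model\<close>

text \<open>
  A homogeneous Poisson point process on \<^term>\<open>UNIV :: (plane \<times> real) set\<close> has almost surely
  infinitely many points, no two of which coincide. It is given here by a measurable enumeration
  \<open>Z 0, Z 1, \<dots>\<close> of its points; \<open>point_count\<close> is the induced counting measure.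
\<close>

definition point_count :: "(nat \<Rightarrow> 'w \<Rightarrow> 'b) \<Rightarrow> 'b set \<Rightarrow> 'w \<Rightarrow> ennreal" where
  "point_count Z A \<omega> = emeasure (count_space UNIV) {i. Z i \<omega> \<in> A}"

definition unit_poisson_process :: "'w measure \<Rightarrow> (nat \<Rightarrow> 'w \<Rightarrow> 'b::euclidean_space) \<Rightarrow> bool" where
  "unit_poisson_process \<Omega> Z \<longleftrightarrow>
     (\<forall>i. Z i \<in> borel_measurable \<Omega>) \<and>
     (\<forall>A\<in>sets borel. emeasure lborel A < \<infinity> \<longrightarrow>
        (\<forall>k::nat. measure \<Omega> {\<omega> \<in> space \<Omega>. point_count Z A \<omega> = of_nat k} =
                measure lborel A ^ k / fact k * exp (- measure lborel A))) \<and>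
     (\<forall>(n::nat) A. (\<forall>i<n. A i \<in> sets borel) \<and> disjoint_family_on A {..<n} \<longrightarrow>
        prob_space.indep_vars \<Omega> (\<lambda>_. borel) (\<lambda>i. point_count Z (A i)) {..<n})"

text \<open>
  In the next two definitions, \<open>z i\<close> is the pair \<open>(x\<^sub>i, t\<^sub>i)\<close> and \<open>X i\<close> the leaf attached to it,
  for one outcome. The visible part is meaningful only when \<open>snd (z i) \<le> 0\<close>.
\<close>

definition visible_part :: "(nat \<Rightarrow> plane \<times> real) \<Rightarrow> (nat \<Rightarrow> plane set) \<Rightarrow> nat \<Rightarrow> plane set" where
  "visible_part z X i =
     (\<lambda>x. fst (z i) + x) ` X i -
     (\<Union>j\<in>{j. snd (z j) \<in> {snd (z i)<..<0}}. (\<lambda>x. fst (z j) + x) ` interior (X j))"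

definition leaves_boundary :: "(nat \<Rightarrow> plane \<times> real) \<Rightarrow> (nat \<Rightarrow> plane set) \<Rightarrow> plane set" where
  "leaves_boundary z X = (\<Union>i\<in>{i. snd (z i) \<le> 0}. frontier (visible_part z X i))"

text \<open>\<open>L\<close> is the law of the random closed set the model is associated with.\<close>

locale dead_leaves = prob_space \<Omega> for \<Omega> :: "'w measure" +
  fixes L :: "plane set measure"
    and Z :: "nat \<Rightarrow> 'w \<Rightarrow> plane \<times> real"
    and X :: "nat \<Rightarrow> 'w \<Rightarrow> plane set"
  assumes poisson: "unit_poisson_process \<Omega> Z"
    and leaves_indep: "indep_vars (\<lambda>_. fell_borel) X UNIV"
    and leaves_law: "\<And>i. distr \<Omega> fell_borel (X i) = L"
    and leaves_indep_points:
      "indep_rv \<Omega> (PiM UNIV (\<lambda>_. borel)) (\<lambda>\<omega> i. Z i \<omega>) (PiM UNIV (\<lambda>_. fell_borel)) (\<lambda>\<omega> i. X i \<omega>)"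

text \<open>
  \<open>L\<close> is the law of \<open>R Y\<close>, for \<open>R\<close> independent of \<open>Y\<close> with density proportional to
  \<open>r powr (-\<alpha>)\<close> on \<open>r0 \<le> r \<le> r1\<close>; \<open>r1\<close> may be \<open>\<infinity>\<close>.
\<close>

definition radius_weight :: "real \<Rightarrow> real \<Rightarrow> ereal \<Rightarrow> real \<Rightarrow> real" where
  "radius_weight \<alpha> r0 r1 r = r powr (- \<alpha>) * indicator {r. r0 \<le> r \<and> ereal r \<le> r1} r"

definition radius_law :: "real \<Rightarrow> real \<Rightarrow> ereal \<Rightarrow> real measure" where
  "radius_law \<alpha> r0 r1 =
     density lborel (\<lambda>r. ennreal (radius_weight \<alpha> r0 r1 r / (LINT x|lborel. radius_weight \<alpha> r0 r1 x)))"

definition scaled_law ::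
    "'y measure \<Rightarrow> ('y \<Rightarrow> plane set) \<Rightarrow> real \<Rightarrow> real \<Rightarrow> ereal \<Rightarrow> plane set measure" where
  "scaled_law P Y \<alpha> r0 r1 =
     distr (radius_law \<alpha> r0 r1 \<Otimes>\<^sub>M distr P fell_borel Y) fell_borel (\<lambda>(r, F). (\<lambda>x. r *\<^sub>R x) ` F)"


section \<open>Colored dead leaves model\<close>

definition random_field :: "'w measure \<Rightarrow> ('w \<Rightarrow> plane \<Rightarrow> real) \<Rightarrow> bool" where
  "random_field \<Omega> I \<longleftrightarrow> (\<forall>x. (\<lambda>\<omega>. I \<omega> x) \<in> borel_measurable \<Omega>)"

text \<open>
  The two conditions on the values of \<open>I\<close> are required almost surely only, since they can be
  contradictory on the null event that two of the times \<open>t\<^sub>i\<close> agree. Almost surely the sets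
  mentioned in them are disjoint and cover the plane.
\<close>

locale colored_dead_leaves = dead_leaves \<Omega> L Z X
  for \<Omega> :: "'w measure" and L Z X +
  fixes U :: "nat \<Rightarrow> 'w \<Rightarrow> real"
    and I :: "'w \<Rightarrow> plane \<Rightarrow> real"
  assumes colors_indep: "indep_vars (\<lambda>_. borel) U UNIV"
    and colors_uniform: "\<And>i. distr \<Omega> borel (U i) = uniform_measure lborel {0<..<1}"
    and colors_indep_leaves:
      "indep_rv \<Omega> (PiM UNIV (\<lambda>_. borel \<Otimes>\<^sub>M fell_borel)) (\<lambda>\<omega> i. (Z i \<omega>, X i \<omega>))
         (PiM UNIV (\<lambda>_. borel)) (\<lambda>\<omega> i. U i \<omega>)"
    and field: "random_field \<Omega> I"
    and field_interior:
      "AE \<omega> in \<Omega>. \<forall>i. snd (Z i \<omega>) \<le> 0 \<longrightarrow>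
         (\<forall>x \<in> interior (visible_part (\<lambda>i. Z i \<omega>) (\<lambda>i. X i \<omega>) i)
                 - leaves_boundary (\<lambda>i. Z i \<omega>) (\<lambda>i. X i \<omega>). I \<omega> x = U i \<omega>)"
    and field_boundary:
      "AE \<omega> in \<Omega>. \<forall>x \<in> leaves_boundary (\<lambda>i. Z i \<omega>) (\<lambda>i. X i \<omega>). I \<omega> x = 0"

text \<open>
  Weak convergence, along the filter \<open>G\<close>, of the finite-dimensional distributions of the fields
  \<open>J r\<close> to those of \<open>I\<close>; the fields may live on different probability spaces.
\<close>

definition fdd_limit ::
    "('r \<Rightarrow> 'v measure) \<Rightarrow> ('r \<Rightarrow> 'v \<Rightarrow> plane \<Rightarrow> real) \<Rightarrow> 'r filter
      \<Rightarrow> 'w measure \<Rightarrow> ('w \<Rightarrow> plane \<Rightarrow> real) \<Rightarrow> bool" where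
  "fdd_limit \<Omega>' J G \<Omega> I \<longleftrightarrow>
     (\<forall>S (g :: (plane \<Rightarrow> real) \<Rightarrow> real). finite S \<and>
        continuous_map (product_topology (\<lambda>_. euclideanreal) S) euclideanreal g \<and>
        bounded (g ` (S \<rightarrow>\<^sub>E UNIV)) \<longrightarrow>
        ((\<lambda>r. LINT \<omega>|\<Omega>' r. g (restrict (J r \<omega>) S)) \<longlongrightarrow> (LINT \<omega>|\<Omega>. g (restrict (I \<omega>) S))) G)"

definition measurable_modification ::
    "'w measure \<Rightarrow> ('w \<Rightarrow> plane \<Rightarrow> real) \<Rightarrow> ('w \<Rightarrow> plane \<Rightarrow> real) \<Rightarrow> bool" where
  "measurable_modification \<Omega> I I' \<longleftrightarrow>
     (\<lambda>(\<omega>, x). I' \<omega> x) \<in> borel_measurable (\<Omega> \<Otimes>\<^sub>M borel) \<and>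
     (\<forall>x. AE \<omega> in \<Omega>. I' \<omega> x = I \<omega> x)"


section \<open>Besov norm on the unit square\<close>

text \<open>Real powers of extended nonnegative reals, meant for exponents \<open>a > 0\<close>.\<close>

definition epowr :: "ennreal \<Rightarrow> real \<Rightarrow> ennreal" where
  "epowr x a = (if x = \<infinity> then \<infinity> else ennreal (enn2real x powr a))"

definition unit_square :: "plane set" where
  "unit_square = cbox 0 1"

definition Lp_norm :: "real \<Rightarrow> (plane \<Rightarrow> real) \<Rightarrow> ennreal" where
  "Lp_norm p f = epowr (\<integral>\<^sup>+x\<in>unit_square. ennreal (\<bar>f x\<bar> powr p) \<partial>lborel) (1 / p)"

definition increment :: "(plane \<Rightarrow> real) \<Rightarrow> plane \<Rightarrow> plane \<Rightarrow> real" where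
  "increment f y x = (f (x + y) - f x) * indicator {x. x \<in> unit_square \<and> x + y \<in> unit_square} x"

definition modulus :: "real \<Rightarrow> (plane \<Rightarrow> real) \<Rightarrow> real \<Rightarrow> ennreal" where
  "modulus p f u = (SUP y\<in>{y. norm y < u}. Lp_norm p (increment f y))"

definition besov_norm :: "real \<Rightarrow> real \<Rightarrow> real \<Rightarrow> (plane \<Rightarrow> real) \<Rightarrow> ennreal" where
  "besov_norm s p q f =
     Lp_norm p f +
     epowr (\<integral>\<^sup>+u\<in>{0<..}. epowr (modulus p f u * ennreal (u powr (- s))) q * ennreal (1 / u) \<partial>lborel) (1 / q)"

end

theory Submission
  imports Defs
begin

text \<open>
  The field is constant on the visible parts of the leaves, so the \<open>p\<close>-th moment of an
  increment is, up to constants, the probability that different leaves are seen at the two points. The Besov norm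
  only integrates such increments. The exponent \<open>s\<close> is admissible as long as \<open>s * p\<close> is smaller than
  the order at which this probability vanishes with the distance of the points: order 1 if the radii are
  bounded below, order \<open>3 - \<alpha>\<close> if they are not.

  The probability of seeing different leaves at \<open>x\<close> and \<open>y\<close> is comparable with the ratio \<open>D / M\<close>, where
  \<open>M\<close> is the mean area of a leaf and \<open>D\<close> the mean area that a leaf loses under the translation by
  \<open>x - y\<close> (\<open>pair_areas\<close>). Indeed the topmost leaf covering \<open>x\<close> or \<open>y\<close> is seen at both points unless it
  covers only one of them. To avoid conditioning on its time, time is cut into slots of length \<open>1 / M\<close>,
  and only the probability that a set contains no marked point of the Poisson process is used
  (\<open>prob_no_marked_point\<close>). Independent colors turn this into the two bounds \<open>increment_moment_le\<close> and
  \<open>increment_moment_ge\<close> on the increments of the field.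

  For the rescaled shape \<open>D\<close> and \<open>M\<close> are integrals over the radius of \<open>r\<^sup>2 * mean_loss (h /\<^sub>R r)\<close> and
  of \<open>r\<^sup>2 * area\<close>. The expected loss \<open>mean_loss\<close> of the unscaled shape is the difference of the covariogram
  at \<open>0\<close> and at the translation. It is subadditive and equals the area for long translations, which
  gives a linear lower bound (\<open>mean_loss_ge\<close>); the regularity conditions give upper bounds, the one for
  a directional derivative becoming uniform by subadditivity again (\<open>cond_A2_mean_loss_le\<close>).
  Integration over the radius yields the two orders (\<open>relative_loss_large_radii\<close>,
  \<open>relative_loss_small_radii\<close>). When the smallest radius tends to 0 the constants stay bounded and
  bounded away from 0, so the bounds pass to the limit field.

  The supremum in the Besov norm is harmless: an increment over a vector of length less than \<open>u\<close> splits
  at a third point of the square, and averaging over this point bounds all these increments by a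
  single double integral (\<open>increment_integral_le\<close>). All comparisons are between integrands, so that the
  expected norm is governed by two-point moments through Tonelli's theorem
  (\<open>besov_moment_finite\<close>, \<open>besov_moment_infinite\<close>).
\<close>

section \<open>Measurability for the Fell topology\<close>

lemma space_fell_borel: "space (fell_borel :: 'a::topological_space set measure) = Collect closed"
proof -
  have "U \<subseteq> topspace fell_topology" if "openin fell_topology U" for U :: "'a set set"
    using that by (rule openin_subset)
  then show ?thesis
    unfolding fell_borel_def by (simp add: space_measure_of_conv topspace_fell_topology)
qed

lemma hit_sets_fell_borel:
  assumes "open G"
  shows "{F. closed F \<and> F \<inter> G \<noteq> {}} \<in> sets fell_borel"
proof -
  have "openin fell_topology {F. closed F \<and> F \<inter> G \<noteq> {}}"
    unfolding fell_topology_def using assms by (intro topology_generated_by_Basis) auto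
  then show ?thesis
    unfolding fell_borel_def
    by (subst sets_measure_of) (auto intro!: sigma_sets.Basic dest: openin_subset)
qed

definition hit_and_miss :: "'a::topological_space set set \<times> 'a set set \<Rightarrow> 'a set set" where
  "hit_and_miss d = {F. closed F \<and> F \<inter> \<Union>(fst d) = {} \<and> (\<forall>b\<in>snd d. F \<inter> b \<noteq> {})}"

text \<open>
  A compact set that misses a closed set is covered by finitely many basic open sets that miss it
  as well. So finitely many basic open sets to be missed and to be hit describe a base of
  neighbourhoods of a set in the Fell topology, except that missing an open set is not an open
  condition; for measurability only the countability of these descriptions matters.
\<close>

lemma openin_fell_hit_and_miss:
  fixes B :: "'a::topological_space set set"
  assumes B: "topological_basis B" and U: "openin fell_topology U" and F: "F \<in> U"
  shows "\<exists>d\<in>Fpow B \<times> Fpow B. F \<in> hit_and_miss d \<and> hit_and_miss d \<subseteq> U"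
proof -
  let ?S = "{{F :: 'a set. closed F \<and> F \<inter> K = {}} |K. compact K} \<union>
      {{F. closed F \<and> F \<inter> G \<noteq> {}} |G. open G}"
  define N where "N F U \<longleftrightarrow> (\<exists>d\<in>Fpow B \<times> Fpow B. F \<in> hit_and_miss d \<and> hit_and_miss d \<subseteq> U)" for F U
  have NI: "N F U" if "W \<in> Fpow B" "H \<in> Fpow B" "F \<in> hit_and_miss (W, H)" "hit_and_miss (W, H) \<subseteq> U" for F U W H
    unfolding N_def using that by (intro bexI[of _ "(W, H)"]) auto
  have "generate_topology_on ?S U"
    using U unfolding fell_topology_def by (simp add: openin_topology_generated_by_iff)
  then have "\<forall>F\<in>U. N F U"
  proof (induction rule: generate_topology_on.induct)
    case Empty
    then show ?case by simp
  next
    case (Int a b)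
    show ?case
    proof
      fix F assume "F \<in> a \<inter> b"
      then have "N F a" "N F b" using Int.IH by simp_all
      then obtain W1 H1 W2 H2 where d: "W1 \<in> Fpow B" "H1 \<in> Fpow B" "W2 \<in> Fpow B" "H2 \<in> Fpow B"
        "F \<in> hit_and_miss (W1, H1)" "hit_and_miss (W1, H1) \<subseteq> a"
        "F \<in> hit_and_miss (W2, H2)" "hit_and_miss (W2, H2) \<subseteq> b"
        unfolding N_def by (elim bexE conjE) (metis mem_Sigma_iff surj_pair)
      have "hit_and_miss (W1 \<union> W2, H1 \<union> H2) = hit_and_miss (W1, H1) \<inter> hit_and_miss (W2, H2)"
        unfolding hit_and_miss_def by auto
      moreover have "W1 \<union> W2 \<in> Fpow B" "H1 \<union> H2 \<in> Fpow B" using d by (auto simp: Fpow_def)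
      ultimately show "N F (a \<inter> b)"
        using d by (intro NI[of "W1 \<union> W2" "H1 \<union> H2"]) auto
    qed
  next
    case (UN K)
    show ?case
    proof
      fix F assume "F \<in> \<Union>K"
      then obtain k where k: "k \<in> K" "F \<in> k" by blast
      then have "N F k" using UN.IH by simp
      with k show "N F (\<Union>K)" unfolding N_def by (meson Union_upper subset_trans)
    qed
  next
    case (Basis s)
    show ?case
    proof
      fix F assume F: "F \<in> s"
      from Basis consider K where "compact K" "s = {F. closed F \<and> F \<inter> K = {}}"
        | G where "open G" "s = {F. closed F \<and> F \<inter> G \<noteq> {}}" by blast
      then show "N F s"
      proof cases
        case 1
        have op: "\<And>c. c \<in> {b\<in>B. b \<inter> F = {}} \<Longrightarrow> open c"
          using B topological_basis_open by auto
        have "K \<subseteq> \<Union>{b\<in>B. b \<inter> F = {}}"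
        proof
          fix x assume "x \<in> K"
          then have "x \<in> - F" "open (- F)" using F 1 by auto
          then obtain b where "b \<in> B" "x \<in> b" "b \<subseteq> - F"
            using topological_basisE[OF B] by metis
          then show "x \<in> \<Union>{b\<in>B. b \<inter> F = {}}" by blast
        qed
        from compactE[OF \<open>compact K\<close> this op]
        obtain W where W: "W \<subseteq> {b\<in>B. b \<inter> F = {}}" "finite W" "K \<subseteq> \<Union>W" by blast
        then have "F \<in> hit_and_miss (W, {})" "hit_and_miss (W, {}) \<subseteq> s"
          using F 1 unfolding hit_and_miss_def by auto
        with W show ?thesis by (intro NI[of W "{}"]) (auto simp: Fpow_def)
      next
        case 2
        then obtain x where "x \<in> F" "x \<in> G" using F by auto
        then obtain b where "b \<in> B" "x \<in> b" "b \<subseteq> G"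
          using topological_basisE[OF B \<open>open G\<close>] by metis
        then have "F \<in> hit_and_miss ({}, {b})" "hit_and_miss ({}, {b}) \<subseteq> s"
          using F 2 \<open>x \<in> F\<close> unfolding hit_and_miss_def by auto
        with \<open>b \<in> B\<close> show ?thesis by (intro NI[of "{}" "{b}"]) (auto simp: Fpow_def)
      qed
    qed
  qed
  with F show ?thesis unfolding N_def by blast
qed

lemma measurable_fell_borelI:
  fixes f :: "'b \<Rightarrow> 'a::second_countable_topology set"
  assumes cl: "\<And>x. x \<in> space M \<Longrightarrow> closed (f x)"
    and hit: "\<And>G. open G \<Longrightarrow> {x \<in> space M. f x \<inter> G \<noteq> {}} \<in> sets M"
  shows "f \<in> measurable M fell_borel"
proof -
  obtain B :: "'a set set" where B: "countable B" "topological_basis B"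
    using ex_countable_basis by blast
  have cC: "countable (Fpow B \<times> Fpow B)"
    using B by (simp add: Fpow_def countable_Collect_finite_subset conj_commute)
  have opB: "open b" if "b \<in> B" for b using B that topological_basis_open by auto
  have meas: "f -` hit_and_miss d \<inter> space M \<in> sets M" if d: "d \<in> Fpow B \<times> Fpow B" for d
  proof -
    have "f -` hit_and_miss d \<inter> space M =
      (space M - {x \<in> space M. f x \<inter> \<Union>(fst d) \<noteq> {}}) \<inter> (space M - (\<Union>b\<in>snd d. space M - {x \<in> space M. f x \<inter> b \<noteq> {}}))"
      using cl unfolding hit_and_miss_def by auto
    moreover have "{x \<in> space M. f x \<inter> \<Union>(fst d) \<noteq> {}} \<in> sets M"
      using d opB by (intro hit open_Union) (auto simp: Fpow_def)
    moreover have "(\<Union>b\<in>snd d. space M - {x \<in> space M. f x \<inter> b \<noteq> {}}) \<in> sets M"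
      using d opB by (intro sets.finite_UN sets.Diff sets.top hit) (auto simp: Fpow_def)
    ultimately show ?thesis by auto
  qed
  show ?thesis unfolding fell_borel_def
  proof (rule measurable_measure_of)
    show "{U. openin fell_topology U} \<subseteq> Pow (topspace fell_topology)"
      by (auto dest: openin_subset)
    show "f \<in> space M \<rightarrow> topspace fell_topology" using cl by (auto simp: topspace_fell_topology)
    fix U :: "'a set set" assume "U \<in> {U. openin fell_topology U}"
    then have U: "openin fell_topology U" by simp
    let ?D = "{d \<in> Fpow B \<times> Fpow B. hit_and_miss d \<subseteq> U}"
    have "U \<subseteq> (\<Union>d\<in>?D. hit_and_miss d)"
      using openin_fell_hit_and_miss[OF B(2) U] by blast
    then have "f -` U \<inter> space M = (\<Union>d\<in>?D. f -` hit_and_miss d \<inter> space M)"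
      by blast
    also have "\<dots> \<in> sets M"
    proof (rule sets.countable_UN'')
      show "countable ?D" by (rule countable_subset[OF _ cC]) auto
    qed (use meas in auto)
    finally show "f -` U \<inter> space M \<in> sets M" .
  qed
qed

text \<open>
  An open relation \<open>G\<close> is a countable union of open rectangles, so that meeting a random set inside
  \<open>G\<close> is a countable union of separate conditions on the point and on the set. Membership,
  neighbourhoods and dilations all reduce to this.
\<close>

lemma pred_open_hit:
  fixes G :: "('v::second_countable_topology \<times> 'a::second_countable_topology) set"
  assumes G: "open G" and f: "f \<in> borel_measurable M" and g: "g \<in> measurable M fell_borel"
  shows "Measurable.pred M (\<lambda>\<omega>. \<exists>x\<in>g \<omega>. (f \<omega>, x) \<in> G)"
proof -
  obtain B :: "'v set set" where B: "countable B" "topological_basis B"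
    using ex_countable_basis by blast
  obtain C :: "'a set set" where C: "countable C" "topological_basis C"
    using ex_countable_basis by blast
  let ?D = "{(b, c) \<in> B \<times> C. b \<times> c \<subseteq> G}"
  have cD: "countable ?D"
    by (rule countable_subset[of _ "B \<times> C"]) (use B C in auto)
  have *: "\<exists>b c. b \<in> B \<and> c \<in> C \<and> v \<in> b \<and> x \<in> c \<and> b \<times> c \<subseteq> G" if "(v, x) \<in> G" for v x
  proof -
    obtain V W where VW: "open V" "open W" "v \<in> V" "x \<in> W" "V \<times> W \<subseteq> G"
      using open_prod_elim[OF G \<open>(v, x) \<in> G\<close>] by (metis mem_Sigma_iff)
    obtain b where "b \<in> B" "v \<in> b" "b \<subseteq> V" using topological_basisE[OF B(2)] VW by metis
    moreover obtain c where "c \<in> C" "x \<in> c" "c \<subseteq> W" using topological_basisE[OF C(2)] VW by metis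
    ultimately show ?thesis using VW by blast
  qed
  have "{\<omega> \<in> space M. \<exists>x\<in>g \<omega>. (f \<omega>, x) \<in> G} =
    (\<Union>(b, c)\<in>?D. (f -` b \<inter> space M) \<inter> (g -` {F. closed F \<and> F \<inter> c \<noteq> {}} \<inter> space M))" (is "?L = ?R")
  proof
    show "?L \<subseteq> ?R"
    proof
      fix \<omega> assume "\<omega> \<in> ?L"
      then obtain x where x: "\<omega> \<in> space M" "x \<in> g \<omega>" "(f \<omega>, x) \<in> G" by auto
      have "closed (g \<omega>)" using measurable_space[OF g x(1)] by (simp add: space_fell_borel)
      with x *[OF x(3)] show "\<omega> \<in> ?R" by blast
    qed
    show "?R \<subseteq> ?L" by blast
  qed
  also have "\<dots> \<in> sets M"
  proof (rule sets.countable_UN''[OF cD])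
    fix d assume "d \<in> ?D"
    then obtain b c where d: "d = (b, c)" "b \<in> B" "c \<in> C" by auto
    then have "open b" "open c" using B C topological_basis_open by auto
    then show "(case d of (b, c) \<Rightarrow> (f -` b \<inter> space M) \<inter> (g -` {F. closed F \<and> F \<inter> c \<noteq> {}} \<inter> space M)) \<in> sets M"
      using d measurable_sets[OF f, of b] measurable_sets[OF g hit_sets_fell_borel[of c]] by auto
  qed
  finally show ?thesis by (simp add: pred_def)
qed

lemma pred_mem_fell [measurable (raw)]:
  fixes f :: "'b \<Rightarrow> 'a::euclidean_space"
  assumes f: "f \<in> borel_measurable M" and g: "g \<in> measurable M fell_borel"
  shows "Measurable.pred M (\<lambda>\<omega>. f \<omega> \<in> g \<omega>)"
proof -
  let ?G = "\<lambda>n. {(v, x :: 'a). dist v x < inverse (real (Suc n))}"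
  have "open (?G n)" for n
    unfolding case_prod_beta by (intro open_Collect_less continuous_intros)
  then have m: "Measurable.pred M (\<lambda>\<omega>. \<forall>n. \<exists>x\<in>g \<omega>. (f \<omega>, x) \<in> ?G n)"
    using pred_open_hit[OF _ f g] by measurable
  have "(f \<omega> \<in> g \<omega>) = (\<forall>n. \<exists>x\<in>g \<omega>. (f \<omega>, x) \<in> ?G n)" if "\<omega> \<in> space M" for \<omega>
  proof -
    have "closed (g \<omega>)" using measurable_space[OF g that] by (simp add: space_fell_borel)
    then have "f \<omega> \<in> g \<omega> \<longleftrightarrow> f \<omega> \<in> closure (g \<omega>)" by simp
    also have "\<dots> \<longleftrightarrow> (\<forall>n. \<exists>x\<in>g \<omega>. (f \<omega>, x) \<in> ?G n)"
      unfolding closure_approachable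
      by (auto simp: dist_commute) (metis order_less_trans reals_Archimedean of_nat_Suc)
    finally show ?thesis .
  qed
  then show ?thesis using m by (simp cong: measurable_cong)
qed

text \<open>
  A closed set contains a basic open set as soon as it contains its points from a countable dense
  set, so countably many membership conditions decide whether a point is interior.
\<close>

lemma pred_interior_fell [measurable (raw)]:
  fixes f :: "'b \<Rightarrow> 'a::euclidean_space"
  assumes f: "f \<in> borel_measurable M" and g: "g \<in> measurable M fell_borel"
  shows "Measurable.pred M (\<lambda>\<omega>. f \<omega> \<in> interior (g \<omega>))"
proof -
  obtain B :: "'a set set" where B: "countable B" "topological_basis B"
    using ex_countable_basis by blast
  obtain D :: "'a set" where D: "countable D" "\<And>X. open X \<Longrightarrow> X \<noteq> {} \<Longrightarrow> \<exists>d\<in>D. d \<in> X"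
    using countable_dense_setE by blast
  have opB: "open b" if "b \<in> B" for b using B that topological_basis_open by auto
  have m: "Measurable.pred M (\<lambda>\<omega>. \<exists>b\<in>B. f \<omega> \<in> b \<and> (\<forall>q\<in>D\<inter>b. q \<in> g \<omega>))"
    unfolding pred_def
  proof (intro sets.sets_Collect_countable_Ex' B sets.sets_Collect_conj sets.sets_Collect_countable_All')
    show "{\<omega> \<in> space M. f \<omega> \<in> b} \<in> sets M" if "b \<in> B" for b
      using measurable_sets[OF f, of b] opB[OF that] by (simp add: vimage_def Int_def conj_commute)
    show "countable (D \<inter> b)" for b using D by auto
    show "{\<omega> \<in> space M. q \<in> g \<omega>} \<in> sets M" for q
      using pred_mem_fell[OF measurable_const g] by (simp add: pred_def)
  qed
  have "(f \<omega> \<in> interior (g \<omega>)) = (\<exists>b\<in>B. f \<omega> \<in> b \<and> (\<forall>q\<in>D\<inter>b. q \<in> g \<omega>))" if "\<omega> \<in> space M" for \<omega>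
  proof -
    have cl: "closed (g \<omega>)" using measurable_space[OF g that] by (simp add: space_fell_borel)
    show ?thesis
    proof
      assume "f \<omega> \<in> interior (g \<omega>)"
      then obtain b where "b \<in> B" "f \<omega> \<in> b" "b \<subseteq> interior (g \<omega>)"
        using topological_basisE[OF B(2)] open_interior by metis
      then show "\<exists>b\<in>B. f \<omega> \<in> b \<and> (\<forall>q\<in>D\<inter>b. q \<in> g \<omega>)" using interior_subset by blast
    next
      assume "\<exists>b\<in>B. f \<omega> \<in> b \<and> (\<forall>q\<in>D\<inter>b. q \<in> g \<omega>)"
      then obtain b where b: "b \<in> B" "f \<omega> \<in> b" "D \<inter> b \<subseteq> g \<omega>" by blast
      have "b - g \<omega> = {}"
        using D(2)[of "b - g \<omega>"] open_Diff[OF opB[OF b(1)] cl] b(3) by blast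
      then show "f \<omega> \<in> interior (g \<omega>)"
        using b opB by (meson Diff_eq_empty_iff interiorI)
    qed
  qed
  then show ?thesis using m by (simp cong: measurable_cong)
qed

section \<open>Poisson processes\<close>

lemma Poisson_weights_sums:
  fixes l w :: real
  shows "(\<lambda>k. w ^ k * (l ^ k / fact k * exp (- l))) sums exp (- (l * (1 - w)))"
proof -
  have "(\<lambda>k. (w * l) ^ k /\<^sub>R fact k * exp (- l)) sums (exp (w * l) * exp (- l))"
    by (intro sums_mult2 exp_converges)
  moreover have "(w * l) ^ k /\<^sub>R fact k * exp (- l) = w ^ k * (l ^ k / fact k * exp (- l))" for k
    by (simp add: power_mult_distrib scaleR_conv_of_real divide_inverse)
  moreover have "exp (w * l) * exp (- l) = exp (- (l * (1 - w)))"
    by (simp add: exp_add[symmetric] algebra_simps)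
  ultimately show ?thesis by simp
qed

lemma Poisson_mean_sums:
  fixes l :: real
  shows "(\<lambda>k. real k * (l ^ k / fact k * exp (- l))) sums l"
proof -
  have "(\<lambda>k. l ^ k /\<^sub>R fact k * (l * exp (- l))) sums (exp l * (l * exp (- l)))"
    by (intro sums_mult2 exp_converges)
  moreover have "l ^ k /\<^sub>R fact k * (l * exp (- l)) = real (Suc k) * (l ^ Suc k / fact (Suc k) * exp (- l))" for k
    by (simp add: scaleR_conv_of_real divide_simps del: of_nat_Suc)
  moreover have "exp l * (l * exp (- l)) = l"
    by (simp add: exp_minus)
  ultimately have "(\<lambda>k. real (Suc k) * (l ^ Suc k / fact (Suc k) * exp (- l))) sums l"
    by (simp only:)
  then show ?thesis by (subst (asm) sums_Suc_iff) simp
qed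

context prob_space begin

context
  fixes Z :: "nat \<Rightarrow> 'a \<Rightarrow> 'b::euclidean_space"
  assumes Z: "unit_poisson_process M Z"
begin

lemma poisson_points_measurable [measurable]: "Z i \<in> borel_measurable M"
  using Z by (simp add: unit_poisson_process_def)

lemma point_count_eq_suminf: "point_count Z A \<omega> = (\<Sum>i. indicator A (Z i \<omega>))"
proof -
  have "point_count Z A \<omega> = (\<integral>\<^sup>+i. indicator {i. Z i \<omega> \<in> A} i \<partial>count_space UNIV)"
    unfolding point_count_def by simp
  also have "\<dots> = (\<Sum>i. indicator {i. Z i \<omega> \<in> A} i)"
    by (rule nn_integral_count_space_nat)
  finally show ?thesis by (simp add: indicator_def)
qed

lemma point_count_measurable [measurable]:
  assumes [measurable]: "A \<in> sets borel"
  shows "point_count Z A \<in> borel_measurable M"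
  unfolding point_count_eq_suminf[abs_def] by measurable

lemma point_count_eq_card:
  "finite {i. Z i \<omega> \<in> A} \<Longrightarrow> point_count Z A \<omega> = of_nat (card {i. Z i \<omega> \<in> A})"
  unfolding point_count_def by (subst emeasure_count_space_finite) auto

context
  fixes A :: "'b set"
  assumes A [measurable]: "A \<in> sets borel" and fin: "emeasure lborel A < \<infinity>"
begin

lemma prob_point_count:
  "prob {\<omega> \<in> space M. point_count Z A \<omega> = of_nat k} =
    measure lborel A ^ k / fact k * exp (- measure lborel A)"
  using Z A fin by (simp add: unit_poisson_process_def)

lemma AE_finitely_many_points: "AE \<omega> in M. finite {i. Z i \<omega> \<in> A}"
proof -
  let ?E = "\<lambda>k::nat. {\<omega> \<in> space M. point_count Z A \<omega> = of_nat k}"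
  have "(\<lambda>k. prob (?E k)) sums prob (\<Union>k. ?E k)"
    by (rule finite_measure_UNION) (auto simp: disjoint_family_on_def)
  moreover have "(\<lambda>k. prob (?E k)) sums 1"
    using Poisson_weights_sums[of 1 "measure lborel A"] by (simp add: prob_point_count)
  ultimately have "prob (\<Union>k. ?E k) = 1"
    using sums_unique2 by blast
  then have "AE \<omega> in M. \<omega> \<in> (\<Union>k. ?E k)"
    by (intro AE_prob_1) auto
  then show ?thesis
  proof eventually_elim
    case (elim \<omega>)
    then have "point_count Z A \<omega> < \<infinity>" by (auto simp: of_nat_less_top)
    then show ?case
      unfolding point_count_def by (cases "finite {i. Z i \<omega> \<in> A}") auto
  qed
qed

lemma nn_integral_point_count:
  fixes f :: "nat \<Rightarrow> ennreal"
  shows "(\<integral>\<^sup>+\<omega>. f (card {i. Z i \<omega> \<in> A}) \<partial>M) =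
    (\<Sum>k. f k * ennreal (measure lborel A ^ k / fact k * exp (- measure lborel A)))"
proof -
  let ?E = "\<lambda>k::nat. {\<omega> \<in> space M. point_count Z A \<omega> = of_nat k}"
  have "(\<integral>\<^sup>+\<omega>. f (card {i. Z i \<omega> \<in> A}) \<partial>M) = (\<integral>\<^sup>+\<omega>. (\<Sum>k. f k * indicator (?E k) \<omega>) \<partial>M)"
  proof (rule nn_integral_cong_AE)
    show "AE \<omega> in M. f (card {i. Z i \<omega> \<in> A}) = (\<Sum>k. f k * indicator (?E k) \<omega>)"
      using AE_finitely_many_points AE_space
    proof eventually_elim
      case (elim \<omega>)
      have "(\<Sum>k. f k * indicator (?E k) \<omega>) = (\<Sum>k\<in>{card {i. Z i \<omega> \<in> A}}. f k * indicator (?E k) \<omega>)"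
        using elim by (intro suminf_finite) (auto simp: point_count_eq_card indicator_def)
      then show ?case using elim by (simp add: point_count_eq_card)
    qed
  qed
  also have "\<dots> = (\<Sum>k. \<integral>\<^sup>+\<omega>. f k * indicator (?E k) \<omega> \<partial>M)"
    by (rule nn_integral_suminf) measurable
  also have "\<dots> = (\<Sum>k. f k * ennreal (prob (?E k)))"
    by (intro suminf_cong) (simp add: nn_integral_cmult emeasure_eq_measure)
  finally show ?thesis by (simp only: prob_point_count)
qed

lemma suminf_emeasure_points: "(\<Sum>i. emeasure M {\<omega> \<in> space M. Z i \<omega> \<in> A}) = emeasure lborel A"
proof -
  have "(\<Sum>i. emeasure M {\<omega> \<in> space M. Z i \<omega> \<in> A}) = (\<Sum>i. \<integral>\<^sup>+\<omega>. indicator A (Z i \<omega>) \<partial>M)"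
  proof (rule suminf_cong)
    fix i
    have "emeasure M {\<omega> \<in> space M. Z i \<omega> \<in> A} = (\<integral>\<^sup>+\<omega>. indicator {\<omega> \<in> space M. Z i \<omega> \<in> A} \<omega> \<partial>M)"
      by (intro nn_integral_indicator[symmetric]) measurable
    also have "\<dots> = (\<integral>\<^sup>+\<omega>. indicator A (Z i \<omega>) \<partial>M)"
      by (intro nn_integral_cong) (auto simp: indicator_def)
    finally show "emeasure M {\<omega> \<in> space M. Z i \<omega> \<in> A} = (\<integral>\<^sup>+\<omega>. indicator A (Z i \<omega>) \<partial>M)" .
  qed
  also have "\<dots> = (\<integral>\<^sup>+\<omega>. (\<Sum>i. indicator A (Z i \<omega>)) \<partial>M)"
    by (rule nn_integral_suminf[symmetric]) measurable
  also have "\<dots> = (\<integral>\<^sup>+\<omega>. of_nat (card {i. Z i \<omega> \<in> A}) \<partial>M)"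
    using AE_finitely_many_points
    by (intro nn_integral_cong_AE) (auto simp: point_count_eq_suminf[symmetric] point_count_eq_card)
  also have "\<dots> = (\<Sum>k. of_nat k * ennreal (measure lborel A ^ k / fact k * exp (- measure lborel A)))"
    by (rule nn_integral_point_count)
  also have "\<dots> = (\<Sum>k. ennreal (real k * (measure lborel A ^ k / fact k * exp (- measure lborel A))))"
    by (intro suminf_cong) (simp add: ennreal_mult[symmetric] ennreal_of_nat_eq_real_of_nat)
  also have "\<dots> = ennreal (measure lborel A)"
    by (intro suminf_ennreal_eq Poisson_mean_sums) auto
  also have "\<dots> = emeasure lborel A"
    using fin by (simp add: emeasure_eq_ennreal_measure)
  finally show ?thesis .
qed

lemma nn_integral_weight_power_count:
  assumes "0 \<le> w"
  shows "(\<integral>\<^sup>+\<omega>. ennreal (w ^ card {i. Z i \<omega> \<in> A}) \<partial>M) = ennreal (exp (- (measure lborel A * (1 - w))))"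
proof -
  have "(\<integral>\<^sup>+\<omega>. ennreal (w ^ card {i. Z i \<omega> \<in> A}) \<partial>M) =
      (\<Sum>k. ennreal (w ^ k) * ennreal (measure lborel A ^ k / fact k * exp (- measure lborel A)))"
    by (rule nn_integral_point_count)
  also have "\<dots> = (\<Sum>k. ennreal (w ^ k * (measure lborel A ^ k / fact k * exp (- measure lborel A))))"
    using assms by (intro suminf_cong) (simp add: ennreal_mult[symmetric])
  also have "\<dots> = ennreal (exp (- (measure lborel A * (1 - w))))"
    using assms by (intro suminf_ennreal_eq Poisson_weights_sums) auto
  finally show ?thesis .
qed

end

text \<open>
  As a functional of \<open>f\<close> the left-hand side is integration against a measure. On boxes this measure is
  the mean of a Poisson variable, that is the volume, and boxes determine it.
\<close>

lemma Campbell: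
  assumes [measurable]: "f \<in> borel_measurable borel"
  shows "(\<Sum>i. \<integral>\<^sup>+\<omega>. f (Z i \<omega>) \<partial>M) = (\<integral>\<^sup>+z. f z \<partial>lborel)"
proof -
  have m [measurable]: "(\<lambda>(i, \<omega>). Z i \<omega>) \<in> measurable (count_space UNIV \<Otimes>\<^sub>M M) borel"
    by (rule measurable_pair_measure_countable1) auto
  let ?D = "distr (count_space UNIV \<Otimes>\<^sub>M M) borel (\<lambda>(i, \<omega>). Z i \<omega>)"
  have D: "(\<integral>\<^sup>+z. g z \<partial>?D) = (\<Sum>i. \<integral>\<^sup>+\<omega>. g (Z i \<omega>) \<partial>M)" if [measurable]: "g \<in> borel_measurable borel" for g :: "'b \<Rightarrow> ennreal"
  proof -
    have "(\<integral>\<^sup>+z. g z \<partial>?D) = (\<integral>\<^sup>+x. g (case x of (i, \<omega>) \<Rightarrow> Z i \<omega>) \<partial>(count_space UNIV \<Otimes>\<^sub>M M))"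
      by (rule nn_integral_distr) auto
    also have "\<dots> = (\<integral>\<^sup>+i. \<integral>\<^sup>+\<omega>. g (case (i, \<omega>) of (i, \<omega>) \<Rightarrow> Z i \<omega>) \<partial>M \<partial>count_space UNIV)"
      by (intro nn_integral_fst[of "\<lambda>x. g (case x of (i, \<omega>) \<Rightarrow> Z i \<omega>)" "count_space UNIV", symmetric]) measurable
    finally show ?thesis by (simp add: nn_integral_count_space_nat)
  qed
  have "lborel = ?D"
  proof (rule lborel_eqI)
    fix l u :: 'b
    assume lu: "\<And>b. b \<in> Basis \<Longrightarrow> l \<bullet> b \<le> u \<bullet> b"
    have "emeasure ?D (box l u) = (\<integral>\<^sup>+z. indicator (box l u) z \<partial>?D)" by simp
    also have "\<dots> = (\<Sum>i. \<integral>\<^sup>+\<omega>. indicator (box l u) (Z i \<omega>) \<partial>M)" by (rule D) simp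
    also have "\<dots> = (\<Sum>i. emeasure M {\<omega> \<in> space M. Z i \<omega> \<in> box l u})"
    proof (rule suminf_cong)
      fix i
      have "(\<integral>\<^sup>+\<omega>. indicator (box l u) (Z i \<omega>) \<partial>M) = (\<integral>\<^sup>+\<omega>. indicator {\<omega> \<in> space M. Z i \<omega> \<in> box l u} \<omega> \<partial>M)"
        by (intro nn_integral_cong) (auto simp: indicator_def)
      then show "(\<integral>\<^sup>+\<omega>. indicator (box l u) (Z i \<omega>) \<partial>M) = emeasure M {\<omega> \<in> space M. Z i \<omega> \<in> box l u}"
        by simp
    qed
    also have "\<dots> = emeasure lborel (box l u)"
      using emeasure_lborel_box_finite[of l u] by (intro suminf_emeasure_points) (auto simp: less_top)
    finally show "emeasure ?D (box l u) = ennreal (\<Prod>b\<in>Basis. (u - l) \<bullet> b)"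
      using lu by (simp add: emeasure_lborel_box_eq inner_diff_left)
  qed simp
  then have "(\<integral>\<^sup>+z. f z \<partial>lborel) = (\<integral>\<^sup>+z. f z \<partial>?D)" by simp
  also have "\<dots> = (\<Sum>i. \<integral>\<^sup>+\<omega>. f (Z i \<omega>) \<partial>M)" by (rule D) simp
  finally show ?thesis by simp
qed

text \<open>
  On finitely many disjoint sets of finite measure the counts are independent, which gives the
  product of the generating functions of Poisson laws.
\<close>

lemma expectation_prod_step_weights:
  fixes A :: "nat \<Rightarrow> 'b set" and w :: "nat \<Rightarrow> real"
  assumes A: "\<And>k. k < n \<Longrightarrow> A k \<in> sets borel" "disjoint_family_on A {..<n}"
    and fin: "\<And>k. k < n \<Longrightarrow> emeasure lborel (A k) < \<infinity>"
    and w: "\<And>k. k < n \<Longrightarrow> 0 \<le> w k" "\<And>k. k < n \<Longrightarrow> w k \<le> 1"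
  shows "(\<lambda>N. expectation (\<lambda>\<omega>. \<Prod>i<N. \<Prod>k<n. if Z i \<omega> \<in> A k then w k else 1))
    \<longlonglongrightarrow> exp (- (\<Sum>k<n. measure lborel (A k) * (1 - w k)))"
proof -
  let ?c = "\<lambda>k \<omega>. card {i. Z i \<omega> \<in> A k}"
  have meas_if: "(\<lambda>\<omega>. if Z i \<omega> \<in> A k then w k else 1) \<in> borel_measurable M" if "k < n" for i k
    using A(1)[OF that] by measurable
  have AEfin: "AE \<omega> in M. \<forall>k\<in>{..<n}. finite {i. Z i \<omega> \<in> A k}"
    by (rule AE_finite_allI) (use A fin AE_finitely_many_points in auto)
  define g where "g k x = ennreal (w k ^ nat \<lfloor>enn2real x\<rfloor>)" for k and x :: ennreal
  have g: "AE \<omega> in M. \<forall>k\<in>{..<n}. g k (point_count Z (A k) \<omega>) = ennreal (w k ^ ?c k \<omega>)"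
    using AEfin by eventually_elim (simp add: g_def point_count_eq_card ennreal_of_nat_eq_real_of_nat)
  have [measurable]: "g k \<in> borel_measurable borel" for k
    unfolding g_def by measurable
  have pc: "point_count Z (A k) \<in> borel_measurable M" if "k < n" for k
    using A(1)[OF that] by measurable
  have indep: "indep_vars (\<lambda>_. borel) (\<lambda>k. point_count Z (A k)) {..<n}"
    using Z A unfolding unit_poisson_process_def by blast
  have pe: "ennreal (\<Prod>k<n. w k ^ c k) = (\<Prod>k<n. ennreal (w k ^ c k))" for c :: "nat \<Rightarrow> nat"
    by (rule prod_ennreal[symmetric]) (simp add: w)
  have "(\<integral>\<^sup>+\<omega>. ennreal (\<Prod>k<n. w k ^ ?c k \<omega>) \<partial>M) = (\<integral>\<^sup>+\<omega>. (\<Prod>k<n. g k (point_count Z (A k) \<omega>)) \<partial>M)"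
    using g by (intro nn_integral_cong_AE, eventually_elim) (simp add: pe)
  also have "\<dots> = (\<Prod>k<n. \<integral>\<^sup>+\<omega>. g k (point_count Z (A k) \<omega>) \<partial>M)"
  proof (rule indep_vars_nn_integral)
    show "indep_vars (\<lambda>_. borel) (\<lambda>k \<omega>. g k (point_count Z (A k) \<omega>)) {..<n}"
      using indep by (rule indep_vars_compose2) auto
  qed auto
  also have "\<dots> = (\<Prod>k<n. \<integral>\<^sup>+\<omega>. ennreal (w k ^ ?c k \<omega>) \<partial>M)"
    using g by (intro prod.cong nn_integral_cong_AE) auto
  also have "\<dots> = (\<Prod>k<n. ennreal (exp (- (measure lborel (A k) * (1 - w k)))))"
    using A fin w by (intro prod.cong nn_integral_weight_power_count) auto
  also have "\<dots> = ennreal (exp (- (\<Sum>k<n. measure lborel (A k) * (1 - w k))))"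
    by (simp add: prod_ennreal exp_sum[symmetric] sum_negf)
  finally have E: "(\<integral>\<^sup>+\<omega>. ennreal (\<Prod>k<n. w k ^ ?c k \<omega>) \<partial>M) =
      ennreal (exp (- (\<Sum>k<n. measure lborel (A k) * (1 - w k))))" .
  define G where "G \<omega> = (\<Prod>k<n. enn2real (g k (point_count Z (A k) \<omega>)))" for \<omega>
  have Gm: "G \<in> borel_measurable M"
    unfolding G_def using pc by (intro borel_measurable_prod) auto
  have GAE: "AE \<omega> in M. G \<omega> = (\<Prod>k<n. w k ^ ?c k \<omega>)"
    using g by eventually_elim (simp add: G_def w)
  have "expectation G = enn2real (\<integral>\<^sup>+\<omega>. ennreal (G \<omega>) \<partial>M)"
    using Gm by (intro integral_eq_nn_integral) (auto simp: G_def prod_nonneg)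
  also have "(\<integral>\<^sup>+\<omega>. ennreal (G \<omega>) \<partial>M) = (\<integral>\<^sup>+\<omega>. ennreal (\<Prod>k<n. w k ^ ?c k \<omega>) \<partial>M)"
    using GAE by (intro nn_integral_cong_AE) auto
  finally have EG: "expectation G = exp (- (\<Sum>k<n. measure lborel (A k) * (1 - w k)))"
    by (simp add: E)
  have bound: "0 \<le> (\<Prod>k<n. if z \<in> A k then w k else 1) \<and> (\<Prod>k<n. if z \<in> A k then w k else 1) \<le> 1" for z
    using w by (auto intro!: prod_nonneg prod_le_1)
  have bound2: "0 \<le> (\<Prod>i<N. \<Prod>k<n. if Z i \<omega> \<in> A k then w k else 1) \<and> (\<Prod>i<N. \<Prod>k<n. if Z i \<omega> \<in> A k then w k else 1) \<le> 1" for N \<omega>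
    using bound w by (intro conjI prod_nonneg prod_le_1 ballI) auto
  have "(\<lambda>N. expectation (\<lambda>\<omega>. \<Prod>i<N. \<Prod>k<n. if Z i \<omega> \<in> A k then w k else 1)) \<longlonglongrightarrow> expectation G"
  proof (rule integral_dominated_convergence[where w = "\<lambda>_. 1"])
    show "(\<lambda>\<omega>. \<Prod>i<N. \<Prod>k<n. if Z i \<omega> \<in> A k then w k else 1) \<in> borel_measurable M" for N
      using meas_if by (intro borel_measurable_prod) auto
    show "AE \<omega> in M. norm (\<Prod>i<N. \<Prod>k<n. if Z i \<omega> \<in> A k then w k else 1) \<le> 1" for N
      using bound2 by (simp add: abs_of_nonneg)
    show "AE \<omega> in M. (\<lambda>N. \<Prod>i<N. \<Prod>k<n. if Z i \<omega> \<in> A k then w k else 1) \<longlonglongrightarrow> G \<omega>"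
      using AEfin GAE
    proof eventually_elim
      case (elim \<omega>)
      have "(\<lambda>N. \<Prod>i<N. if Z i \<omega> \<in> A k then w k else 1) \<longlonglongrightarrow> w k ^ ?c k \<omega>" if "k < n" for k
      proof (rule tendsto_eventually)
        have f: "finite {i. Z i \<omega> \<in> A k}" using elim that by auto
        then obtain m where m: "\<And>i. Z i \<omega> \<in> A k \<Longrightarrow> i < m"
          using finite_nat_set_iff_bounded by auto
        show "\<forall>\<^sub>F N in sequentially. (\<Prod>i<N. if Z i \<omega> \<in> A k then w k else 1) = w k ^ ?c k \<omega>"
          using eventually_ge_at_top[of m]
        proof eventually_elim
          case (elim N)
          then have "{..<N} \<inter> {i. Z i \<omega> \<in> A k} = {i. Z i \<omega> \<in> A k}" using m by force
          then show ?case by (simp add: prod.If_cases)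
        qed
      qed
      then have "(\<lambda>N. \<Prod>k<n. \<Prod>i<N. if Z i \<omega> \<in> A k then w k else 1) \<longlonglongrightarrow> (\<Prod>k<n. w k ^ ?c k \<omega>)"
        by (intro tendsto_prod) auto
      then show ?case
        using elim by (subst prod.swap) simp
    qed
  qed (use Gm in auto)
  then show ?thesis by (simp add: EG)
qed

text \<open>
  The right-hand side is the probability that no point is retained when each point \<open>z\<close> is retained
  independently with probability \<open>p z\<close>. For step functions it comes from independent Poisson counts,
  and a product of numbers in the unit interval changes by at most the sum of the changes of its
  factors.
\<close>

lemma expectation_prod_thinning:
  fixes p :: "'b \<Rightarrow> real"
  assumes [measurable]: "p \<in> borel_measurable borel"
    and p: "\<And>z. 0 \<le> p z" "\<And>z. p z \<le> 1" and int: "integrable lborel p"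
  shows "(\<lambda>N. expectation (\<lambda>\<omega>. \<Prod>i<N. 1 - p (Z i \<omega>))) \<longlonglongrightarrow> exp (- (\<integral>z. p z \<partial>lborel))"
proof -
  \<comment> \<open>\<open>p\<close> rounded down to a multiple of \<open>1 / Suc n\<close>; its level sets for positive values have finite measure.\<close>
  define q where "q n z = real_of_int \<lfloor>real (Suc n) * p z\<rfloor> / real (Suc n)" for n z
  have [measurable]: "q n \<in> borel_measurable borel" for n
    unfolding q_def by measurable
  have q0: "0 \<le> q n z" for n z using p by (simp add: q_def)
  have qp: "q n z \<le> p z" for n z
    using of_int_floor_le[of "real (Suc n) * p z"] by (simp add: q_def divide_simps mult.commute del: of_nat_Suc)
  have pq: "p z - q n z \<le> 1 / real (Suc n)" for n z
  proof -
    have "real (Suc n) * p z - 1 \<le> real_of_int \<lfloor>real (Suc n) * p z\<rfloor>" by linarith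
    then have "(real (Suc n) * p z - 1) / real (Suc n) \<le> q n z"
      unfolding q_def by (intro divide_right_mono) auto
    then show ?thesis by (simp add: diff_divide_distrib)
  qed
  have qint: "integrable lborel (q n)" for n
    by (rule Bochner_Integration.integrable_bound[OF int]) (use q0 qp p in auto)
  have step: "(\<lambda>N. expectation (\<lambda>\<omega>. \<Prod>i<N. 1 - q n (Z i \<omega>))) \<longlonglongrightarrow> exp (- (\<integral>z. q n z \<partial>lborel))" for n
  proof -
    define A where "A k = {z. \<lfloor>real (Suc n) * p z\<rfloor> = int k + 1}" for k
    define w where "w k = 1 - real (Suc k) / real (Suc n)" for k
    have [measurable]: "A k \<in> sets borel" for k unfolding A_def by measurable
    have A: "(z \<in> A k) = (k = nat \<lfloor>real (Suc n) * p z\<rfloor> - 1 \<and> \<lfloor>real (Suc n) * p z\<rfloor> \<noteq> 0)" for z k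
    proof -
      have "0 \<le> \<lfloor>real (Suc n) * p z\<rfloor>" using p by simp
      then show ?thesis unfolding A_def mem_Collect_eq by arith
    qed
    have k0: "nat \<lfloor>real (Suc n) * p z\<rfloor> - 1 < Suc n" for z
    proof -
      have "real (Suc n) * p z \<le> real (Suc n)" using p mult_left_le[of "p z" "real (Suc n)"] by simp
      then show ?thesis by linarith
    qed
    have w0: "1 - w (nat \<lfloor>real (Suc n) * p z\<rfloor> - 1) = q n z" if "\<lfloor>real (Suc n) * p z\<rfloor> \<noteq> 0" for z
    proof -
      have "0 < \<lfloor>real (Suc n) * p z\<rfloor>" using p that by (simp add: order_less_le)
      then show ?thesis by (simp add: w_def q_def)
    qed
    have q1: "1 - q n z = (\<Prod>k<Suc n. if z \<in> A k then w k else 1)" for z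
    proof (cases "\<lfloor>real (Suc n) * p z\<rfloor> = 0")
      case True
      then show ?thesis by (simp add: A q_def)
    next
      case False
      then show ?thesis using k0[of z] w0[OF False] by (simp add: A prod.delta' del: prod.lessThan_Suc)
    qed
    have q2: "q n z = (\<Sum>k<Suc n. indicator (A k) z * (1 - w k))" for z
    proof (cases "\<lfloor>real (Suc n) * p z\<rfloor> = 0")
      case True
      then show ?thesis by (simp add: A q_def)
    next
      case False
      then have "(\<Sum>k<Suc n. indicator (A k) z * (1 - w k)) =
          (\<Sum>k<Suc n. if k = nat \<lfloor>real (Suc n) * p z\<rfloor> - 1 then 1 - w k else 0)"
        by (intro sum.cong) (auto simp: A indicator_def)
      then show ?thesis using k0[of z] w0[OF False] by (simp add: sum.delta' del: sum.lessThan_Suc)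
    qed
    have fin: "emeasure lborel (A k) < \<infinity>" for k
    proof -
      have "emeasure lborel (A k) = (\<integral>\<^sup>+z. indicator (A k) z \<partial>lborel)" by simp
      also have "\<dots> \<le> (\<integral>\<^sup>+z. ennreal (real (Suc n) * p z) \<partial>lborel)"
      proof (rule nn_integral_mono)
        fix z
        have "1 \<le> real (Suc n) * p z" if "z \<in> A k" using that unfolding A_def by auto linarith
        then show "indicator (A k) z \<le> ennreal (real (Suc n) * p z)"
          by (auto simp: indicator_def ennreal_1[symmetric] simp del: ennreal_1 of_nat_Suc intro!: ennreal_leI)
      qed
      also have "\<dots> < \<infinity>"
        using integrable_mult_right[OF int, of "real (Suc n)"] p
        by (subst (asm) integrable_iff_bounded) (simp add: abs_of_nonneg)
      finally show ?thesis .
    qed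
    have "(\<integral>z. q n z \<partial>lborel) = (\<Sum>k<Suc n. measure lborel (A k) * (1 - w k))"
      unfolding q2 using fin by (subst Bochner_Integration.integral_sum) (auto simp: less_top)
    moreover have "(\<lambda>N. expectation (\<lambda>\<omega>. \<Prod>i<N. \<Prod>k<Suc n. if Z i \<omega> \<in> A k then w k else 1))
        \<longlonglongrightarrow> exp (- (\<Sum>k<Suc n. measure lborel (A k) * (1 - w k)))"
    proof (rule expectation_prod_step_weights)
      show "disjoint_family_on A {..<Suc n}" unfolding disjoint_family_on_def A_def by auto
    qed (use fin in \<open>auto simp: w_def\<close>)
    ultimately show ?thesis by (simp only: q1)
  qed
  have qlim: "(\<lambda>n. \<integral>z. q n z \<partial>lborel) \<longlonglongrightarrow> (\<integral>z. p z \<partial>lborel)"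
  proof (rule integral_dominated_convergence[where w = p])
    show "AE z in lborel. (\<lambda>n. q n z) \<longlonglongrightarrow> p z"
    proof (rule AE_I2)
      fix z
      have "(\<lambda>n. p z - q n z) \<longlonglongrightarrow> 0"
        by (rule tendsto_sandwich[OF _ _ tendsto_const lim_1_over_n[THEN LIMSEQ_Suc]])
           (use qp pq in \<open>auto simp: field_simps\<close>)
      then show "(\<lambda>n. q n z) \<longlonglongrightarrow> p z"
        using tendsto_diff[OF tendsto_const[of "p z"]] by fastforce
    qed
  qed (use int q0 qp in auto)
  \<comment> \<open>By Campbell's formula the error of the rounding is small uniformly in the number \<open>N\<close> of factors.\<close>
  have close: "\<bar>expectation (\<lambda>\<omega>. \<Prod>i<N. 1 - p (Z i \<omega>)) - expectation (\<lambda>\<omega>. \<Prod>i<N. 1 - q n (Z i \<omega>))\<bar>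
      \<le> (\<integral>z. p z \<partial>lborel) - (\<integral>z. q n z \<partial>lborel)" for N n
  proof -
    let ?P = "\<lambda>\<omega>. \<Prod>i<N. 1 - p (Z i \<omega>)" and ?Q = "\<lambda>\<omega>. \<Prod>i<N. 1 - q n (Z i \<omega>)"
    have q1: "q n z \<le> 1" for z using qp[of n z] p(2)[of z] by linarith
    have bP: "0 \<le> ?P \<omega> \<and> ?P \<omega> \<le> 1" for \<omega>
      using p by (auto intro!: prod_nonneg prod_le_1)
    have bQ: "0 \<le> ?Q \<omega> \<and> ?Q \<omega> \<le> 1" for \<omega>
      using q0 q1 by (auto intro!: prod_nonneg prod_le_1)
    have iP: "integrable M ?P"
      by (rule integrable_const_bound[where B = 1]) (use bP in auto)
    have iQ: "integrable M ?Q"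
      by (rule integrable_const_bound[where B = 1]) (use bQ in auto)
    have iS: "integrable M (\<lambda>\<omega>. p (Z i \<omega>) - q n (Z i \<omega>))" for i
      by (rule integrable_const_bound[where B = 1])
         (use qp p q0 in \<open>auto intro!: AE_I2 simp: abs_of_nonneg, smt (verit)\<close>)
    have "\<bar>expectation ?P - expectation ?Q\<bar> = \<bar>expectation (\<lambda>\<omega>. ?P \<omega> - ?Q \<omega>)\<bar>"
      using iP iQ by simp
    also have "\<dots> \<le> expectation (\<lambda>\<omega>. \<bar>?P \<omega> - ?Q \<omega>\<bar>)"
      by (rule integral_abs_bound)
    also have "\<dots> \<le> expectation (\<lambda>\<omega>. \<Sum>i<N. p (Z i \<omega>) - q n (Z i \<omega>))"
    proof (rule integral_mono)
      fix \<omega>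
      have "norm (?P \<omega> - ?Q \<omega>) \<le> (\<Sum>i<N. norm ((1 - p (Z i \<omega>)) - (1 - q n (Z i \<omega>))))"
        by (rule norm_prod_diff) (use p q0 q1 in auto)
      also have "\<dots> = (\<Sum>i<N. p (Z i \<omega>) - q n (Z i \<omega>))"
        using qp by (intro sum.cong) (auto simp: abs_if not_less intro: antisym)
      finally show "\<bar>?P \<omega> - ?Q \<omega>\<bar> \<le> (\<Sum>i<N. p (Z i \<omega>) - q n (Z i \<omega>))" by simp
    qed (use iP iQ iS in auto)
    also have "\<dots> \<le> (\<integral>z. p z - q n z \<partial>lborel)"
    proof -
      have "ennreal (expectation (\<lambda>\<omega>. \<Sum>i<N. p (Z i \<omega>) - q n (Z i \<omega>))) =
          (\<integral>\<^sup>+\<omega>. ennreal (\<Sum>i<N. p (Z i \<omega>) - q n (Z i \<omega>)) \<partial>M)"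
        using iS qp by (intro nn_integral_eq_integral[symmetric]) (auto intro!: sum_nonneg)
      also have "\<dots> = (\<integral>\<^sup>+\<omega>. (\<Sum>i<N. ennreal (p (Z i \<omega>) - q n (Z i \<omega>))) \<partial>M)"
        using qp by (intro nn_integral_cong) (simp add: sum_ennreal)
      also have "\<dots> = (\<Sum>i<N. \<integral>\<^sup>+\<omega>. ennreal (p (Z i \<omega>) - q n (Z i \<omega>)) \<partial>M)"
        by (intro nn_integral_sum) measurable
      also have "\<dots> \<le> (\<Sum>i. \<integral>\<^sup>+\<omega>. ennreal (p (Z i \<omega>) - q n (Z i \<omega>)) \<partial>M)"
        by (rule sum_le_suminf) auto
      also have "\<dots> = (\<integral>\<^sup>+z. ennreal (p z - q n z) \<partial>lborel)"
        by (rule Campbell) measurable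
      also have "\<dots> = ennreal (\<integral>z. p z - q n z \<partial>lborel)"
        using int qint qp by (intro nn_integral_eq_integral) auto
      finally show ?thesis
        using qp by (subst (asm) ennreal_le_iff) (auto intro!: integral_nonneg_AE)
    qed
    finally show ?thesis using int qint by simp
  qed
  show ?thesis
  proof (rule LIMSEQ_I)
    fix e :: real assume "0 < e"
    then have "\<forall>\<^sub>F n in sequentially. \<bar>(\<integral>z. q n z \<partial>lborel) - (\<integral>z. p z \<partial>lborel)\<bar> < e / 3"
      using tendstoD[OF qlim, of "e / 3"] by (simp add: dist_real_def)
    moreover have "\<forall>\<^sub>F n in sequentially. \<bar>exp (- (\<integral>z. q n z \<partial>lborel)) - exp (- (\<integral>z. p z \<partial>lborel))\<bar> < e / 3"
      using \<open>0 < e\<close> tendstoD[OF tendsto_exp[OF tendsto_minus[OF qlim]], of "e / 3"] by (simp add: dist_real_def)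
    ultimately have "\<forall>\<^sub>F n in sequentially. \<bar>(\<integral>z. q n z \<partial>lborel) - (\<integral>z. p z \<partial>lborel)\<bar> < e / 3 \<and>
        \<bar>exp (- (\<integral>z. q n z \<partial>lborel)) - exp (- (\<integral>z. p z \<partial>lborel))\<bar> < e / 3"
      by (rule eventually_conj)
    then obtain n where n: "\<bar>(\<integral>z. q n z \<partial>lborel) - (\<integral>z. p z \<partial>lborel)\<bar> < e / 3"
      "\<bar>exp (- (\<integral>z. q n z \<partial>lborel)) - exp (- (\<integral>z. p z \<partial>lborel))\<bar> < e / 3"
      by (auto dest: eventually_happens)
    from LIMSEQ_D[OF step[of n], of "e / 3"] \<open>0 < e\<close>
    obtain N0 where N0: "\<And>N. N0 \<le> N \<Longrightarrow>
        norm (expectation (\<lambda>\<omega>. \<Prod>i<N. 1 - q n (Z i \<omega>)) - exp (- (\<integral>z. q n z \<partial>lborel))) < e / 3" by auto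
    show "\<exists>no. \<forall>N\<ge>no. norm (expectation (\<lambda>\<omega>. \<Prod>i<N. 1 - p (Z i \<omega>)) - exp (- (\<integral>z. p z \<partial>lborel))) < e"
    proof (intro exI allI impI)
      fix N assume N: "N0 \<le> N"
      show "norm (expectation (\<lambda>\<omega>. \<Prod>i<N. 1 - p (Z i \<omega>)) - exp (- (\<integral>z. p z \<partial>lborel))) < e"
        using N0[OF N] n close[of N n] by (simp only: real_norm_def)
    qed
  qed
qed

end

declare poisson_points_measurable [measurable del]
declare point_count_measurable [measurable del]

end

lemma (in prob_space) distr_indep_rv:
  assumes "indep_rv M S X T Y"
  shows "distr M (S \<Otimes>\<^sub>M T) (\<lambda>\<omega>. (X \<omega>, Y \<omega>)) = distr M S X \<Otimes>\<^sub>M distr M T Y"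
proof -
  have [measurable]: "X \<in> measurable M S" "Y \<in> measurable M T"
    and ind: "indep_set {X -` A \<inter> space M |A. A \<in> sets S} {Y -` B \<inter> space M |B. B \<in> sets T}"
    using assms by (auto simp: indep_rv_def)
  interpret X: prob_space "distr M S X" by (rule prob_space_distr) simp
  interpret Y: prob_space "distr M T Y" by (rule prob_space_distr) simp
  show ?thesis
  proof (rule pair_measure_eqI[symmetric])
    fix A B assume A: "A \<in> sets (distr M S X)" and B: "B \<in> sets (distr M T Y)"
    then have [measurable]: "A \<in> sets S" "B \<in> sets T" by auto
    have "prob ((X -` A \<inter> space M) \<inter> (Y -` B \<inter> space M)) = prob (X -` A \<inter> space M) * prob (Y -` B \<inter> space M)"
      by (rule indep_setD[OF ind]) (use A B in auto)
    moreover have "(\<lambda>\<omega>. (X \<omega>, Y \<omega>)) -` (A \<times> B) \<inter> space M = (X -` A \<inter> space M) \<inter> (Y -` B \<inter> space M)"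
      by auto
    ultimately show "emeasure (distr M S X) A * emeasure (distr M T Y) B =
        emeasure (distr M (S \<Otimes>\<^sub>M T) (\<lambda>\<omega>. (X \<omega>, Y \<omega>))) (A \<times> B)"
      by (simp add: emeasure_distr emeasure_eq_measure ennreal_mult)
  qed (auto intro: X.sigma_finite_measure_axioms Y.sigma_finite_measure_axioms)
qed

lemma (in prob_space) prob_indep_rv:
  assumes "indep_rv M S X T Y" and "A \<in> sets S" "B \<in> sets T"
  shows "prob {\<omega> \<in> space M. X \<omega> \<in> A \<and> Y \<omega> \<in> B} =
    prob {\<omega> \<in> space M. X \<omega> \<in> A} * prob {\<omega> \<in> space M. Y \<omega> \<in> B}"
proof -
  have "prob ((X -` A \<inter> space M) \<inter> (Y -` B \<inter> space M)) = prob (X -` A \<inter> space M) * prob (Y -` B \<inter> space M)"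
    using assms by (intro indep_setD) (auto simp: indep_rv_def)
  moreover have "(X -` A \<inter> space M) \<inter> (Y -` B \<inter> space M) = {\<omega> \<in> space M. X \<omega> \<in> A \<and> Y \<omega> \<in> B}"
    "X -` A \<inter> space M = {\<omega> \<in> space M. X \<omega> \<in> A}" "Y -` B \<inter> space M = {\<omega> \<in> space M. Y \<omega> \<in> B}"
    by auto
  ultimately show ?thesis by simp
qed

section \<open>Marked Poisson processes\<close>

context dead_leaves begin

lemma leaf_measurable [measurable]: "X i \<in> measurable \<Omega> fell_borel"
  using leaves_indep by (simp add: indep_vars_def2)

lemma points_measurable [measurable]: "Z i \<in> borel_measurable \<Omega>"
  using poisson by (rule poisson_points_measurable)

lemma sets_L [measurable_cong]: "sets L = sets fell_borel"
  by (simp add: leaves_law[of 0, symmetric])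

lemma prob_space_L: "prob_space L"
  unfolding leaves_law[of 0, symmetric] by (rule prob_space_distr[OF leaf_measurable])

lemma distr_leaves: "distr \<Omega> (PiM UNIV (\<lambda>_. fell_borel)) (\<lambda>\<omega> i. X i \<omega>) = PiM UNIV (\<lambda>_. L)"
  using leaves_indep indep_vars_iff_distr_eq_PiM[of UNIV X "\<lambda>_. fell_borel"] leaf_measurable
  by (simp only: leaves_law restrict_UNIV UNIV_not_empty not_False_eq_True simp_thms)

lemma closed_leaf: "\<omega> \<in> space \<Omega> \<Longrightarrow> closed (X i \<omega>)"
  using measurable_space[OF leaf_measurable] by (auto simp: space_fell_borel)

text \<open>Conditionally on the points, the leaves are independent with law \<open>L\<close>.\<close>

lemma emeasure_all_marked_points:
  assumes B [measurable]: "B \<in> sets (borel \<Otimes>\<^sub>M fell_borel)" and J: "finite J"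
  shows "emeasure \<Omega> {\<omega> \<in> space \<Omega>. \<forall>i\<in>J. (Z i \<omega>, X i \<omega>) \<in> B} =
    (\<integral>\<^sup>+\<omega>. (\<Prod>i\<in>J. emeasure L (Pair (Z i \<omega>) -` B)) \<partial>\<Omega>)"
proof -
  interpret L: prob_space L by (rule prob_space_L)
  interpret PL: product_prob_space "\<lambda>_. L" UNIV ..
  let ?S = "PiM UNIV (\<lambda>_. borel) :: (nat \<Rightarrow> plane \<times> real) measure"
  let ?T = "PiM UNIV (\<lambda>_. fell_borel) :: (nat \<Rightarrow> plane set) measure"
  have Zm [measurable]: "(\<lambda>\<omega> i. Z i \<omega>) \<in> measurable \<Omega> ?S"
    by (rule measurable_PiM_single') auto
  have Xm [measurable]: "(\<lambda>\<omega> i. X i \<omega>) \<in> measurable \<Omega> ?T"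
    by (rule measurable_PiM_single') (auto dest: measurable_space[OF leaf_measurable])
  have sT: "sets (PiM UNIV (\<lambda>_::nat. L)) = sets ?T"
    by (rule sets_PiM_cong) (auto simp: sets_L)
  define C where "C = {zF \<in> space (?S \<Otimes>\<^sub>M ?T). \<forall>i\<in>J. (fst zF i, snd zF i) \<in> B}"
  have C [measurable]: "C \<in> sets (?S \<Otimes>\<^sub>M ?T)"
    unfolding C_def by measurable
  have "{\<omega> \<in> space \<Omega>. \<forall>i\<in>J. (Z i \<omega>, X i \<omega>) \<in> B} = (\<lambda>\<omega>. (\<lambda>i. Z i \<omega>, \<lambda>i. X i \<omega>)) -` C \<inter> space \<Omega>"
    using measurable_space[OF Zm] measurable_space[OF Xm] by (auto simp: C_def space_pair_measure)
  then have "emeasure \<Omega> {\<omega> \<in> space \<Omega>. \<forall>i\<in>J. (Z i \<omega>, X i \<omega>) \<in> B} =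
      emeasure (distr \<Omega> (?S \<Otimes>\<^sub>M ?T) (\<lambda>\<omega>. (\<lambda>i. Z i \<omega>, \<lambda>i. X i \<omega>))) C"
    by (subst emeasure_distr) auto
  also have "distr \<Omega> (?S \<Otimes>\<^sub>M ?T) (\<lambda>\<omega>. (\<lambda>i. Z i \<omega>, \<lambda>i. X i \<omega>)) = distr \<Omega> ?S (\<lambda>\<omega> i. Z i \<omega>) \<Otimes>\<^sub>M PiM UNIV (\<lambda>_. L)"
    by (simp add: distr_indep_rv[OF leaves_indep_points] distr_leaves)
  also have "emeasure (distr \<Omega> ?S (\<lambda>\<omega> i. Z i \<omega>) \<Otimes>\<^sub>M PiM UNIV (\<lambda>_. L)) C =
      (\<integral>\<^sup>+z. emeasure (PiM UNIV (\<lambda>_. L)) (Pair z -` C) \<partial>distr \<Omega> ?S (\<lambda>\<omega> i. Z i \<omega>))"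
    using C by (intro PL.emeasure_pair_measure_alt) (simp add: sets_pair_measure_cong[OF refl sT])
  also have "\<dots> = (\<integral>\<^sup>+\<omega>. emeasure (PiM UNIV (\<lambda>_. L)) (Pair (\<lambda>i. Z i \<omega>) -` C) \<partial>\<Omega>)"
  proof (rule nn_integral_distr)
    have "C \<in> sets (?S \<Otimes>\<^sub>M PiM UNIV (\<lambda>_. L))" using C by (simp add: sets_pair_measure_cong[OF refl sT])
    then show "(\<lambda>z. emeasure (PiM UNIV (\<lambda>_. L)) (Pair z -` C)) \<in> borel_measurable (distr \<Omega> ?S (\<lambda>\<omega> i. Z i \<omega>))"
      by (simp add: PL.measurable_emeasure_Pair)
  qed simp
  also have "\<dots> = (\<integral>\<^sup>+\<omega>. (\<Prod>i\<in>J. emeasure L (Pair (Z i \<omega>) -` B)) \<partial>\<Omega>)"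
  proof (rule nn_integral_cong)
    fix \<omega>
    have B': "Pair z -` B \<in> sets L" for z
      using sets_Pair1[OF B] by (simp add: sets_L)
    have "Pair (\<lambda>i. Z i \<omega>) -` C = {F \<in> space (PiM UNIV (\<lambda>_. L)). \<forall>i\<in>J. F i \<in> Pair (Z i \<omega>) -` B}"
      using sets_eq_imp_space_eq[OF sT] by (auto simp: C_def space_pair_measure space_PiM)
    then show "emeasure (PiM UNIV (\<lambda>_. L)) (Pair (\<lambda>i. Z i \<omega>) -` C) = (\<Prod>i\<in>J. emeasure L (Pair (Z i \<omega>) -` B))"
      using PL.emeasure_PiM_Collect[of J "\<lambda>i. Pair (Z i \<omega>) -` B"] J B' by simp
  qed
  finally show ?thesis .
qed

text \<open>
  The expected number of marked points in a set.
\<close>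

definition intensity :: "((plane \<times> real) \<times> plane set) set \<Rightarrow> ennreal" where
  "intensity B = (\<integral>\<^sup>+z. emeasure L (Pair z -` B) \<partial>lborel)"

lemma mark_prob_measurable [measurable]:
  assumes [measurable]: "B \<in> sets (borel \<Otimes>\<^sub>M fell_borel)"
  shows "(\<lambda>z. emeasure L (Pair z -` B)) \<in> borel_measurable borel"
proof -
  interpret L: prob_space L by (rule prob_space_L)
  have "B \<in> sets (borel \<Otimes>\<^sub>M L)" using assms by (simp add: sets_pair_measure_cong[OF refl sets_L])
  then show ?thesis by (rule L.measurable_emeasure_Pair)
qed

lemma suminf_emeasure_marked_points:
  assumes [measurable]: "B \<in> sets (borel \<Otimes>\<^sub>M fell_borel)"
  shows "(\<Sum>i. emeasure \<Omega> {\<omega> \<in> space \<Omega>. (Z i \<omega>, X i \<omega>) \<in> B}) = intensity B"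
proof -
  have "(\<Sum>i. emeasure \<Omega> {\<omega> \<in> space \<Omega>. (Z i \<omega>, X i \<omega>) \<in> B}) =
      (\<Sum>i. \<integral>\<^sup>+\<omega>. emeasure L (Pair (Z i \<omega>) -` B) \<partial>\<Omega>)"
    by (rule suminf_cong) (use emeasure_all_marked_points[OF assms, of "{i}" for i] in simp)
  also have "\<dots> = intensity B"
    unfolding intensity_def by (rule Campbell[OF poisson]) measurable
  finally show ?thesis .
qed

lemma AE_no_marked_point:
  assumes B [measurable]: "B \<in> sets (borel \<Otimes>\<^sub>M fell_borel)" and "intensity B = 0"
  shows "AE \<omega> in \<Omega>. \<forall>i. (Z i \<omega>, X i \<omega>) \<notin> B"
proof -
  have "(\<Sum>i. emeasure \<Omega> {\<omega> \<in> space \<Omega>. (Z i \<omega>, X i \<omega>) \<in> B}) = 0"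
    using suminf_emeasure_marked_points[OF B] assms(2) by (rule trans)
  then have "emeasure \<Omega> {\<omega> \<in> space \<Omega>. (Z i \<omega>, X i \<omega>) \<in> B} = 0" for i
    by (simp add: suminf_eq_zero_iff)
  then have "AE \<omega> in \<Omega>. (Z i \<omega>, X i \<omega>) \<notin> B" for i
    by (intro AE_I[where N = "{\<omega> \<in> space \<Omega>. (Z i \<omega>, X i \<omega>) \<in> B}"]) auto
  then show ?thesis by (simp add: AE_all_countable)
qed

lemma AE_finitely_many_marked_points:
  assumes B [measurable]: "B \<in> sets (borel \<Otimes>\<^sub>M fell_borel)" and "intensity B < \<infinity>"
  shows "AE \<omega> in \<Omega>. finite {i. (Z i \<omega>, X i \<omega>) \<in> B}"
proof -
  let ?N = "\<lambda>\<omega>. (\<Sum>i. indicator B (Z i \<omega>, X i \<omega>)) :: ennreal"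
  have ind: "(\<integral>\<^sup>+\<omega>. indicator B (Z i \<omega>, X i \<omega>) \<partial>\<Omega>) = emeasure \<Omega> {\<omega> \<in> space \<Omega>. (Z i \<omega>, X i \<omega>) \<in> B}" for i
  proof -
    have "(\<integral>\<^sup>+\<omega>. indicator B (Z i \<omega>, X i \<omega>) \<partial>\<Omega>) = (\<integral>\<^sup>+\<omega>. indicator {\<omega> \<in> space \<Omega>. (Z i \<omega>, X i \<omega>) \<in> B} \<omega> \<partial>\<Omega>)"
      by (rule nn_integral_cong) (simp only: indicator_def mem_Collect_eq simp_thms)
    also have "\<dots> = emeasure \<Omega> {\<omega> \<in> space \<Omega>. (Z i \<omega>, X i \<omega>) \<in> B}"
      by (rule nn_integral_indicator) measurable
    finally show ?thesis .
  qed
  have "(\<integral>\<^sup>+\<omega>. ?N \<omega> \<partial>\<Omega>) = (\<Sum>i. \<integral>\<^sup>+\<omega>. indicator B (Z i \<omega>, X i \<omega>) \<partial>\<Omega>)"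
    by (rule nn_integral_suminf) measurable
  also have "\<dots> = intensity B"
    using suminf_emeasure_marked_points[OF B] by (simp only: ind)
  finally have "(\<integral>\<^sup>+\<omega>. ?N \<omega> \<partial>\<Omega>) < \<infinity>" using assms(2) by simp
  then have "AE \<omega> in \<Omega>. ?N \<omega> \<noteq> \<infinity>"
    by (intro nn_integral_PInf_AE) auto
  then show ?thesis
  proof eventually_elim
    case (elim \<omega>)
    have "?N \<omega> = (\<integral>\<^sup>+i. indicator {i. (Z i \<omega>, X i \<omega>) \<in> B} i \<partial>count_space UNIV)"
      by (simp add: nn_integral_count_space_nat indicator_def)
    also have "\<dots> = emeasure (count_space UNIV) {i. (Z i \<omega>, X i \<omega>) \<in> B}" by simp
    finally show ?case using elim by (cases "finite {i. (Z i \<omega>, X i \<omega>) \<in> B}") auto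
  qed
qed

text \<open>
  Given the points, the first \<open>N\<close> marked points avoid \<open>B\<close> with probability the product of \<open>1 - p z\<close>
  over these points, where \<open>p z\<close> is the probability that a leaf attached to \<open>z\<close> belongs to \<open>B\<close>. So
  \<open>B\<close> is empty with the probability that a thinned Poisson process is.
\<close>

lemma prob_no_marked_point:
  assumes B [measurable]: "B \<in> sets (borel \<Otimes>\<^sub>M fell_borel)" and "intensity B < \<infinity>"
  shows "prob {\<omega> \<in> space \<Omega>. \<forall>i. (Z i \<omega>, X i \<omega>) \<notin> B} = exp (- enn2real (intensity B))"
proof -
  interpret L: prob_space L by (rule prob_space_L)
  define p where "p z = measure L (Pair z -` B)" for z
  have pm [measurable]: "p \<in> borel_measurable borel"
    unfolding p_def measure_def by measurable
  have p: "0 \<le> p z" "p z \<le> 1" for z by (auto simp: p_def)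
  have int: "integrable lborel p"
    using assms(2) by (simp add: integrable_iff_bounded p L.emeasure_eq_measure[symmetric] p_def intensity_def)
  have Ip: "(\<integral>z. p z \<partial>lborel) = enn2real (intensity B)"
    by (subst integral_eq_nn_integral) (auto simp: p L.emeasure_eq_measure[symmetric] p_def intensity_def)
  let ?E = "\<lambda>N. {\<omega> \<in> space \<Omega>. \<forall>i\<in>{..<N}. (Z i \<omega>, X i \<omega>) \<in> space (borel \<Otimes>\<^sub>M fell_borel) - B}"
  have sp: "(Z i \<omega>, X i \<omega>) \<in> space (borel \<Otimes>\<^sub>M fell_borel)" if "\<omega> \<in> space \<Omega>" for i \<omega>
    using that closed_leaf by (simp add: space_pair_measure space_fell_borel)
  have "prob (?E N) = expectation (\<lambda>\<omega>. \<Prod>i<N. 1 - p (Z i \<omega>))" for N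
  proof -
    have B': "Pair z -` (space (borel \<Otimes>\<^sub>M fell_borel) - B) = space L - Pair z -` B" for z :: "plane \<times> real"
      using sets_eq_imp_space_eq[OF sets_L] by (auto simp: space_pair_measure)
    have Bz: "Pair z -` B \<in> sets L" for z
      using sets_Pair1[OF B] by (simp add: sets_L)
    have "emeasure \<Omega> (?E N) = (\<integral>\<^sup>+\<omega>. (\<Prod>i<N. emeasure L (space L - Pair (Z i \<omega>) -` B)) \<partial>\<Omega>)"
      by (subst emeasure_all_marked_points) (auto simp: B')
    also have "\<dots> = (\<integral>\<^sup>+\<omega>. ennreal (\<Prod>i<N. 1 - p (Z i \<omega>)) \<partial>\<Omega>)"
      by (intro nn_integral_cong) (simp add: L.emeasure_eq_measure L.prob_compl[OF Bz] p_def prod_ennreal)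
    finally have "prob (?E N) = enn2real (\<integral>\<^sup>+\<omega>. ennreal (\<Prod>i<N. 1 - p (Z i \<omega>)) \<partial>\<Omega>)"
      by (simp only: measure_def)
    also have "\<dots> = expectation (\<lambda>\<omega>. \<Prod>i<N. 1 - p (Z i \<omega>))"
      using p by (intro integral_eq_nn_integral[symmetric] AE_I2 prod_nonneg) auto
    finally show ?thesis .
  qed
  then have "(\<lambda>N. prob (?E N)) \<longlonglongrightarrow> exp (- enn2real (intensity B))"
    using expectation_prod_thinning[OF poisson pm p int] unfolding Ip by (simp only:)
  moreover have "(\<lambda>N. prob (?E N)) \<longlonglongrightarrow> prob (\<Inter>N. ?E N)"
    by (rule finite_Lim_measure_decseq) (auto simp: decseq_def)
  moreover have "(\<Inter>N. ?E N) = {\<omega> \<in> space \<Omega>. \<forall>i. (Z i \<omega>, X i \<omega>) \<notin> B}"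
    using sp by auto
  ultimately show ?thesis using LIMSEQ_unique by simp
qed

end

section \<open>The leaf seen at a point\<close>

definition covers :: "(plane \<times> real) \<times> plane set \<Rightarrow> plane \<Rightarrow> bool" where
  "covers \<zeta> x \<longleftrightarrow> x - fst (fst \<zeta>) \<in> snd \<zeta>"

lemma mem_translate: "x \<in> (\<lambda>v. a + v) ` F \<longleftrightarrow> x - a \<in> F" for x a :: "'a::ab_group_add"
  by (auto intro!: image_eqI[of _ _ "x - a"])

text \<open>Several leaves with the same time can be topmost at one point.\<close>

definition topmost :: "(nat \<Rightarrow> (plane \<times> real) \<times> plane set) \<Rightarrow> plane \<Rightarrow> nat \<Rightarrow> bool" where
  "topmost \<zeta> x i \<longleftrightarrow> snd (fst (\<zeta> i)) < 0 \<and> covers (\<zeta> i) x \<and>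
     (\<forall>j. snd (fst (\<zeta> j)) \<in> {snd (fst (\<zeta> i))<..<0} \<longrightarrow> \<not> covers (\<zeta> j) x)"

text \<open>These properties, almost sure at a fixed point, make the color seen there well defined.\<close>

definition regular_at :: "(nat \<Rightarrow> (plane \<times> real) \<times> plane set) \<Rightarrow> plane \<Rightarrow> bool" where
  "regular_at \<zeta> x \<longleftrightarrow>
     (\<forall>i. closed (snd (\<zeta> i))) \<and>
     (\<forall>i. snd (fst (\<zeta> i)) \<noteq> 0) \<and>
     (\<forall>i. x - fst (fst (\<zeta> i)) \<notin> frontier (snd (\<zeta> i))) \<and>
     (\<forall>n::nat. finite {i. snd (fst (\<zeta> i)) \<in> {- real n<..<0} \<and> snd (\<zeta> i) \<inter> ball (x - fst (fst (\<zeta> i))) 1 \<noteq> {}}) \<and>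
     (\<exists>i. snd (fst (\<zeta> i)) < 0 \<and> covers (\<zeta> i) x)"

lemma regular_at_finite_covers:
  assumes "regular_at \<zeta> x"
  shows "finite {i. snd (fst (\<zeta> i)) \<in> {t<..<0} \<and> covers (\<zeta> i) x}"
proof -
  obtain n :: nat where n: "- t < real n" using reals_Archimedean2 by blast
  have "{i. snd (fst (\<zeta> i)) \<in> {t<..<0} \<and> covers (\<zeta> i) x}
    \<subseteq> {i. snd (fst (\<zeta> i)) \<in> {- real n<..<0} \<and> snd (\<zeta> i) \<inter> ball (x - fst (fst (\<zeta> i))) 1 \<noteq> {}}"
    using n by (force simp: covers_def disjoint_iff)
  moreover have "finite {i. snd (fst (\<zeta> i)) \<in> {- real n<..<0} \<and> snd (\<zeta> i) \<inter> ball (x - fst (fst (\<zeta> i))) 1 \<noteq> {}}"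
    using assms by (simp add: regular_at_def)
  ultimately show ?thesis by (rule finite_subset)
qed

lemma finite_nonempty_topmost:
  fixes \<zeta> :: "nat \<Rightarrow> (plane \<times> real) \<times> plane set"
  assumes fin: "\<And>t. finite {i \<in> C. snd (fst (\<zeta> i)) \<in> {t<..<0}}"
    and ex: "i0 \<in> C" "snd (fst (\<zeta> i0)) < 0"
  shows "\<exists>i\<in>C. snd (fst (\<zeta> i)) < 0 \<and> snd (fst (\<zeta> i0)) \<le> snd (fst (\<zeta> i)) \<and>
    (\<forall>j\<in>C. \<not> snd (fst (\<zeta> j)) \<in> {snd (fst (\<zeta> i))<..<0})"
proof -
  define t where "t i = snd (fst (\<zeta> i))" for i
  let ?S = "insert i0 {i \<in> C. t i \<in> {t i0<..<0}}"
  have S: "finite ?S" "?S \<noteq> {}" using fin[of "t i0"] by (auto simp: t_def)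
  then have "Max (t ` ?S) \<in> t ` ?S" by (intro Max_in) simp_all
  then obtain i where i0: "i \<in> ?S" "Max (t ` ?S) = t i" by (rule imageE)
  have i: "i \<in> ?S" "\<And>j. j \<in> ?S \<Longrightarrow> t j \<le> t i"
    using i0 S by (auto simp del: Max_insert intro!: Max_ge simp flip: i0(2))
  have "\<not> t j \<in> {t i<..<0}" if "j \<in> C" for j
    using i(2)[of j] i(2)[of i0] that by auto
  then show ?thesis using i ex unfolding t_def by (intro bexI[of _ i]) auto
qed

lemma regular_at_topmost:
  assumes "regular_at \<zeta> x"
  shows "\<exists>i. topmost \<zeta> x i"
proof -
  obtain i0 where "snd (fst (\<zeta> i0)) < 0" "covers (\<zeta> i0) x"
    using assms by (auto simp: regular_at_def)
  moreover have "finite {i \<in> {i. covers (\<zeta> i) x}. snd (fst (\<zeta> i)) \<in> {t<..<0}}" for t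
    using regular_at_finite_covers[OF assms, of t] by (simp add: conj_commute)
  ultimately obtain i where "covers (\<zeta> i) x" "snd (fst (\<zeta> i)) < 0"
    "\<forall>j\<in>{i. covers (\<zeta> i) x}. \<not> snd (fst (\<zeta> j)) \<in> {snd (fst (\<zeta> i))<..<0}"
    using finite_nonempty_topmost[of "{i. covers (\<zeta> i) x}" \<zeta> i0] by auto
  then show ?thesis unfolding topmost_def by (intro exI[of _ i]) auto
qed

text \<open>
  Only finitely many leaves above a topmost leaf come close to \<open>x\<close>, they are closed and avoid \<open>x\<close>,
  and \<open>x\<close> is interior to the topmost leaf. So \<open>x\<close> is interior to its visible part, hence not on the
  boundary of any visible part, since those are closed and either hidden at \<open>x\<close> or topmost as well.
\<close>

lemma topmost_interior_visible_part:
  assumes reg: "regular_at (\<lambda>i. (z i, X i)) x" and top: "topmost (\<lambda>i. (z i, X i)) x i"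
  shows "x \<in> interior (visible_part z X i)"
proof -
  define above where "above = {j. snd (z j) \<in> {snd (z i)<..<0}}"
  define J where "J = {j \<in> above. X j \<inter> ball (x - fst (z j)) 1 \<noteq> {}}"
  define W where "W = ball x 1 \<inter> (\<lambda>v. fst (z i) + v) ` interior (X i) \<inter> (\<Inter>j\<in>J. - (\<lambda>v. fst (z j) + v) ` X j)"
  have J: "finite J"
  proof -
    obtain n :: nat where n: "- snd (z i) < real n" using reals_Archimedean2 by blast
    have "J \<subseteq> {i. snd (z i) \<in> {- real n<..<0} \<and> X i \<inter> ball (x - fst (z i)) 1 \<noteq> {}}"
      using n by (auto simp: J_def above_def)
    then show ?thesis using reg by (auto simp: regular_at_def intro: finite_subset)
  qed
  have cl: "closed (X j)" for j using reg by (simp add: regular_at_def)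
  have "x \<in> W"
  proof -
    have "x - fst (z i) \<in> X i" "x - fst (z i) \<notin> frontier (X i)"
      using top reg by (auto simp: topmost_def covers_def regular_at_def)
    then have "x - fst (z i) \<in> interior (X i)"
      using cl[of i] by (auto simp: frontier_def)
    moreover have "x - fst (z j) \<notin> X j" if "j \<in> J" for j
      using that top by (auto simp: topmost_def covers_def J_def above_def)
    ultimately show ?thesis by (auto simp: W_def mem_translate)
  qed
  moreover have "open W"
    unfolding W_def using J cl
    by (intro open_Int open_ball open_INT open_translation open_interior) (auto intro!: open_Compl closed_translation)
  moreover have "W \<subseteq> visible_part z X i"
  proof
    fix v assume v: "v \<in> W"
    then have "v - fst (z i) \<in> X i" using interior_subset by (auto simp: W_def mem_translate)
    moreover have "v - fst (z j) \<notin> interior (X j)" if "j \<in> above" for j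
    proof (cases "j \<in> J")
      case True
      then show ?thesis using v interior_subset by (auto simp: W_def mem_translate)
    next
      case False
      have "dist (x - fst (z j)) (v - fst (z j)) < 1" using v by (auto simp: W_def dist_norm)
      then show ?thesis using False that interior_subset[of "X j"] by (auto simp: J_def)
    qed
    ultimately show "v \<in> visible_part z X i"
      by (auto simp: visible_part_def mem_translate above_def)
  qed
  ultimately show ?thesis by (metis interiorI)
qed

lemma topmost_not_leaves_boundary:
  assumes reg: "regular_at (\<lambda>i. (z i, X i)) x" and top: "topmost (\<lambda>i. (z i, X i)) x i"
  shows "x \<notin> leaves_boundary z X"
proof
  assume "x \<in> leaves_boundary z X"
  then obtain k where k: "snd (z k) \<le> 0" "x \<in> frontier (visible_part z X k)"
    by (auto simp: leaves_boundary_def)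
  have cl: "closed (X j)" for j using reg by (simp add: regular_at_def)
  have t: "snd (z j) \<noteq> 0" for j using reg by (simp add: regular_at_def)
  have "closed (visible_part z X k)"
    unfolding visible_part_def using cl
    by (intro closed_Diff open_UN ballI open_translation open_interior closed_translation)
  then have xV: "x \<in> visible_part z X k" using k(2) frontier_subset_closed by blast
  then have cov: "covers (z k, X k) x" by (auto simp: visible_part_def covers_def mem_translate)
  have "x - fst (z i) \<in> X i" "x - fst (z i) \<notin> frontier (X i)"
    using top reg by (auto simp: topmost_def covers_def regular_at_def)
  then have int: "x - fst (z i) \<in> interior (X i)"
    using cl[of i] by (auto simp: frontier_def)
  have "\<not> snd (z k) < snd (z i)"
    using xV int top by (auto simp: visible_part_def mem_translate topmost_def)
  then have "topmost (\<lambda>i. (z i, X i)) x k"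
    using top cov k(1) t[of k] unfolding topmost_def
    by (auto simp: order_less_le)
  then have "x \<in> interior (visible_part z X k)"
    by (rule topmost_interior_visible_part[OF reg])
  then show False using k(2) by (auto simp: frontier_def)
qed

section \<open>Leaves over two points\<close>

lemma nn_integral_lborel_reflect:
  fixes f :: "'a::euclidean_space \<Rightarrow> ennreal"
  assumes [measurable]: "f \<in> borel_measurable borel"
  shows "(\<integral>\<^sup>+x. f (a - x) \<partial>lborel) = (\<integral>\<^sup>+x. f x \<partial>lborel)"
proof -
  have "(\<integral>\<^sup>+x. f x \<partial>lborel) = (\<integral>\<^sup>+x. f x \<partial>density (distr lborel borel (\<lambda>x. a + (-1) *\<^sub>R x)) (\<lambda>_. 1))"
    using lborel_affine[of "-1" a] by simp
  also have "\<dots> = (\<integral>\<^sup>+x. f x \<partial>distr lborel borel (\<lambda>x. a + (-1) *\<^sub>R x))"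
    by (subst nn_integral_density) auto
  also have "\<dots> = (\<integral>\<^sup>+x. f (a - x) \<partial>lborel)"
    by (subst nn_integral_distr) auto
  finally show ?thesis by simp
qed

lemma nn_integral_lborel_translate:
  fixes f :: "'a::euclidean_space \<Rightarrow> ennreal"
  assumes [measurable]: "f \<in> borel_measurable borel"
  shows "(\<integral>\<^sup>+x. f (x + a) \<partial>lborel) = (\<integral>\<^sup>+x. f x \<partial>lborel)"
proof -
  have "(\<integral>\<^sup>+x. f (x + a) \<partial>lborel) = (\<integral>\<^sup>+x. f ((a - x) + a) \<partial>lborel)"
    by (rule nn_integral_lborel_reflect[symmetric]) measurable
  also have "\<dots> = (\<integral>\<^sup>+x. f ((a + a) - x) \<partial>lborel)" by (simp add: algebra_simps)
  also have "\<dots> = (\<integral>\<^sup>+x. f x \<partial>lborel)" by (rule nn_integral_lborel_reflect) measurable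
  finally show ?thesis .
qed

lemma emeasure_lborel_reflect:
  fixes S :: "'a::euclidean_space set"
  assumes "S \<in> sets borel"
  shows "emeasure lborel {v. a - v \<in> S} = emeasure lborel S"
proof -
  have [measurable]: "S \<in> sets borel" by fact
  have "emeasure lborel {v. a - v \<in> S} = (\<integral>\<^sup>+v. indicator {v. a - v \<in> S} v \<partial>lborel)"
    by (rule nn_integral_indicator[symmetric]) measurable
  also have "\<dots> = (\<integral>\<^sup>+v. indicator S (a - v) \<partial>lborel)"
    by (intro nn_integral_cong) (auto simp: indicator_def)
  also have "\<dots> = emeasure lborel S"
    by (subst nn_integral_lborel_reflect) auto
  finally show ?thesis .
qed

lemma emeasure_lborel_translate:
  fixes S :: "'a::euclidean_space set"
  assumes "S \<in> sets borel"
  shows "emeasure lborel {v. v + a \<in> S} = emeasure lborel S"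
proof -
  have [measurable]: "S \<in> sets borel" by fact
  have "emeasure lborel {v. v + a \<in> S} = (\<integral>\<^sup>+v. indicator {v. v + a \<in> S} v \<partial>lborel)"
    by (rule nn_integral_indicator[symmetric]) measurable
  also have "\<dots> = (\<integral>\<^sup>+v. indicator S (v + a) \<partial>lborel)"
    by (intro nn_integral_cong) (auto simp: indicator_def)
  also have "\<dots> = emeasure lborel S"
    by (subst nn_integral_lborel_translate) auto
  finally show ?thesis .
qed

lemma fst_borel_measurable [measurable]:
  "fst \<in> borel_measurable (borel :: ('a::second_countable_topology \<times> 'b::second_countable_topology) measure)"
  unfolding borel_prod[symmetric] by measurable

lemma snd_borel_measurable [measurable]:
  "snd \<in> borel_measurable (borel :: ('a::second_countable_topology \<times> 'b::second_countable_topology) measure)"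
  unfolding borel_prod[symmetric] by measurable

text \<open>The area that \<open>F\<close> loses under the translation by \<open>h\<close>.\<close>

definition loss :: "plane set \<Rightarrow> plane \<Rightarrow> ennreal" where
  "loss F h = emeasure lborel {v. v \<in> F \<and> v - h \<notin> F}"

definition window :: "real set \<Rightarrow> (plane \<times> plane set) set \<Rightarrow> ((plane \<times> real) \<times> plane set) set" where
  "window T Q = {\<zeta>. snd (fst \<zeta>) \<in> T \<and> (fst (fst \<zeta>), snd \<zeta>) \<in> Q}"

lemma sets_window [measurable]:
  assumes [measurable]: "T \<in> sets borel" "Q \<in> sets (borel \<Otimes>\<^sub>M fell_borel)"
  shows "window T Q \<in> sets (borel \<Otimes>\<^sub>M fell_borel)"
proof -
  have "window T Q = {\<zeta> \<in> space (borel \<Otimes>\<^sub>M fell_borel). snd (fst \<zeta>) \<in> T \<and> (fst (fst \<zeta>), snd \<zeta>) \<in> Q}"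
    using sets.sets_into_space[OF assms(2)] by (auto simp: window_def space_pair_measure)
  also have "\<dots> \<in> sets (borel \<Otimes>\<^sub>M fell_borel)" by measurable
  finally show ?thesis .
qed

text \<open>
  Leaves over \<open>x\<close>, over both points, over at least one or over exactly one of them are all of this
  form, for different Boolean functions \<open>R\<close>.
\<close>

definition seen_from :: "plane \<Rightarrow> plane \<Rightarrow> (bool \<Rightarrow> bool \<Rightarrow> bool) \<Rightarrow> (plane \<times> plane set) set" where
  "seen_from x y R = {(v, F). closed F \<and> R (x - v \<in> F) (y - v \<in> F)}"

lemma sets_seen_from [measurable]: "seen_from x y R \<in> sets (borel \<Otimes>\<^sub>M fell_borel)"
proof -
  let ?M = "borel \<Otimes>\<^sub>M fell_borel :: (plane \<times> plane set) measure"
  have R: "R a b \<longleftrightarrow> (R True True \<and> a \<and> b) \<or> (R True False \<and> a \<and> \<not> b) \<or> (R False True \<and> \<not> a \<and> b) \<or> (R False False \<and> \<not> a \<and> \<not> b)" for a b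
    by (cases a; cases b) auto
  have "seen_from x y R = {q \<in> space ?M. R (x - fst q \<in> snd q) (y - fst q \<in> snd q)}"
    by (auto simp: seen_from_def space_pair_measure space_fell_borel)
  also have "\<dots> \<in> sets ?M" by (subst R) measurable
  finally show ?thesis .
qed

context dead_leaves begin

abbreviation leaves :: "'w \<Rightarrow> nat \<Rightarrow> (plane \<times> real) \<times> plane set" where
  "leaves \<omega> \<equiv> \<lambda>i. (Z i \<omega>, X i \<omega>)"

lemma intensity_window:
  assumes [measurable]: "T \<in> sets borel" "Q \<in> sets (borel \<Otimes>\<^sub>M fell_borel)"
  shows "intensity (window T Q) = emeasure lborel T * (\<integral>\<^sup>+F. emeasure lborel {v. (v, F) \<in> Q} \<partial>L)"
proof -
  interpret L: prob_space L by (rule prob_space_L)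
  interpret LL: pair_sigma_finite "lborel :: plane measure" L ..
  have Q' [measurable]: "Q \<in> sets (lborel \<Otimes>\<^sub>M L)"
    using assms(2) by (simp add: sets_pair_measure_cong[OF sets_lborel sets_L])
  have m: "(\<lambda>x. emeasure L (Pair x -` Q)) \<in> borel_measurable borel"
    using L.measurable_emeasure_Pair[OF Q'] by simp
  have "intensity (window T Q) = (\<integral>\<^sup>+z. emeasure L (Pair z -` window T Q) \<partial>(lborel \<Otimes>\<^sub>M lborel))"
    by (simp add: intensity_def lborel_prod)
  also have "\<dots> = (\<integral>\<^sup>+z. indicator T (snd z) * emeasure L (Pair (fst z) -` Q) \<partial>(lborel \<Otimes>\<^sub>M lborel))"
    by (intro nn_integral_cong) (auto simp: window_def vimage_def indicator_def)
  also have "\<dots> = (\<integral>\<^sup>+x. \<integral>\<^sup>+t. indicator T t * emeasure L (Pair x -` Q) \<partial>lborel \<partial>lborel)"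
    using m by (subst lborel.nn_integral_fst[symmetric]) auto
  also have "\<dots> = (\<integral>\<^sup>+x. emeasure lborel T * emeasure L (Pair x -` Q) \<partial>lborel)"
    by (intro nn_integral_cong) (simp add: nn_integral_multc)
  also have "\<dots> = emeasure lborel T * (\<integral>\<^sup>+x. emeasure L (Pair x -` Q) \<partial>lborel)"
    using m by (intro nn_integral_cmult) auto
  also have "(\<integral>\<^sup>+x. emeasure L (Pair x -` Q) \<partial>lborel) = emeasure (lborel \<Otimes>\<^sub>M L) Q"
    by (rule L.emeasure_pair_measure_alt[OF Q', symmetric])
  also have "\<dots> = (\<integral>\<^sup>+F. emeasure lborel ((\<lambda>v. (v, F)) -` Q) \<partial>L)"
    by (rule LL.emeasure_pair_measure_alt2[OF Q'])
  finally show ?thesis by (simp add: vimage_def)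
qed

lemma leaves_in_seen_from:
  assumes "\<omega> \<in> space \<Omega>"
  shows "leaves \<omega> i \<in> window T (seen_from x y R) \<longleftrightarrow>
    snd (Z i \<omega>) \<in> T \<and> R (covers (leaves \<omega> i) x) (covers (leaves \<omega> i) y)"
  using closed_leaf[OF assms] by (auto simp: window_def seen_from_def covers_def)

end

text \<open>Under these integrability conditions almost every outcome is regular at a given point.\<close>

locale tame_dead_leaves = dead_leaves \<Omega> L Z X for \<Omega> :: "'w measure" and L Z X +
  fixes M :: real
  assumes mean_area: "(\<integral>\<^sup>+F. emeasure lborel F \<partial>L) = ennreal M" and M_pos: "0 < M"
    and null_frontier: "(\<integral>\<^sup>+F. emeasure lborel (frontier F) \<partial>L) = 0"
    and finite_neighbourhood: "(\<integral>\<^sup>+F. emeasure lborel {v. F \<inter> ball v 1 \<noteq> {}} \<partial>L) < \<infinity>"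
begin

lemma closed_L: "F \<in> space L \<Longrightarrow> closed F"
  using sets_eq_imp_space_eq[OF sets_L] by (auto simp: space_fell_borel)

lemma sets_hit_ball:
  fixes x :: plane
  shows "{(v, F). closed F \<and> F \<inter> ball (x - v) 1 \<noteq> {}} \<in> sets (borel \<Otimes>\<^sub>M fell_borel)" (is "?Q \<in> _")
proof -
  let ?M = "borel \<Otimes>\<^sub>M fell_borel :: (plane \<times> plane set) measure"
  let ?G = "{(v, w). dist v w < 1} :: (plane \<times> plane) set"
  have "open ?G" unfolding case_prod_beta by (intro open_Collect_less continuous_intros)
  then have "Measurable.pred ?M (\<lambda>q. \<exists>w\<in>snd q. (x - fst q, w) \<in> ?G)"
    by (rule pred_open_hit) measurable
  moreover have "?Q = {q \<in> space ?M. \<exists>w\<in>snd q. (x - fst q, w) \<in> ?G}"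
    by (auto simp: space_pair_measure space_fell_borel)
  ultimately show ?thesis by (simp add: pred_def)
qed

lemma sets_frontier:
  fixes x :: plane
  shows "{(v, F). closed F \<and> x - v \<in> frontier F} \<in> sets (borel \<Otimes>\<^sub>M fell_borel)" (is "?Q \<in> _")
proof -
  let ?M = "borel \<Otimes>\<^sub>M fell_borel :: (plane \<times> plane set) measure"
  have "?Q = {q \<in> space ?M. x - fst q \<in> snd q \<and> x - fst q \<notin> interior (snd q)}"
    by (auto simp: space_pair_measure space_fell_borel frontier_def)
  also have "\<dots> \<in> sets ?M" by measurable
  finally show ?thesis .
qed

text \<open>
  The leaves through \<open>x\<close> with time \<open>0\<close> or with \<open>x\<close> on their boundary have intensity zero, and those
  near \<open>x\<close> during a bounded time have finite intensity. The probability that no leaf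
  covers \<open>x\<close> during \<open>n\<close> units of time is \<open>exp (- n * M)\<close>, which tends to zero.
\<close>

lemma AE_regular_at: "AE \<omega> in \<Omega>. regular_at (leaves \<omega>) x"
proof -
  have time0: "AE \<omega> in \<Omega>. \<forall>i. snd (Z i \<omega>) \<noteq> 0"
  proof -
    have s: "window {0} (space (borel \<Otimes>\<^sub>M fell_borel)) \<in> sets (borel \<Otimes>\<^sub>M fell_borel)" by measurable
    have "intensity (window {0} (space (borel \<Otimes>\<^sub>M fell_borel))) = 0"
      by (subst intensity_window) auto
    from AE_no_marked_point[OF s this] AE_space show ?thesis
      by eventually_elim (auto simp: window_def space_pair_measure space_fell_borel closed_leaf)
  qed
  have frontier0: "AE \<omega> in \<Omega>. \<forall>i. x - fst (Z i \<omega>) \<notin> frontier (X i \<omega>)"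
  proof -
    let ?Q = "{(v, F). closed F \<and> x - v \<in> frontier F}"
    have s: "window UNIV ?Q \<in> sets (borel \<Otimes>\<^sub>M fell_borel)"
      using sets_frontier by measurable
    have "(\<integral>\<^sup>+F. emeasure lborel {v. (v, F) \<in> ?Q} \<partial>L) = (\<integral>\<^sup>+F. emeasure lborel (frontier F) \<partial>L)"
      by (intro nn_integral_cong) (simp add: closed_L emeasure_lborel_reflect)
    then have "intensity (window UNIV ?Q) = 0"
      using sets_frontier by (subst intensity_window) (auto simp: null_frontier)
    from AE_no_marked_point[OF s this] AE_space show ?thesis
      by eventually_elim (auto simp: window_def closed_leaf)
  qed
  have finite: "AE \<omega> in \<Omega>. finite {i. snd (Z i \<omega>) \<in> {- real n<..<0} \<and> X i \<omega> \<inter> ball (x - fst (Z i \<omega>)) 1 \<noteq> {}}" for n :: nat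
  proof -
    let ?Q = "{(v, F). closed F \<and> F \<inter> ball (x - v) 1 \<noteq> {}}"
    have s: "window {- real n<..<0} ?Q \<in> sets (borel \<Otimes>\<^sub>M fell_borel)"
      using sets_hit_ball by measurable
    have "(\<integral>\<^sup>+F. emeasure lborel {v. (v, F) \<in> ?Q} \<partial>L) = (\<integral>\<^sup>+F. emeasure lborel {v. F \<inter> ball v 1 \<noteq> {}} \<partial>L)"
    proof (rule nn_integral_cong)
      fix F assume "F \<in> space L"
      have "open {v. F \<inter> ball v 1 \<noteq> {}}"
      proof -
        have "{v. F \<inter> ball v 1 \<noteq> {}} = (\<Union>w\<in>F. ball w 1)" by (auto simp: dist_commute)
        then show ?thesis by auto
      qed
      then show "emeasure lborel {v. (v, F) \<in> ?Q} = emeasure lborel {v. F \<inter> ball v 1 \<noteq> {}}"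
        using emeasure_lborel_reflect[of "{v. F \<inter> ball v 1 \<noteq> {}}" x] closed_L[OF \<open>F \<in> space L\<close>] by simp
    qed
    then have "intensity (window {- real n<..<0} ?Q) < \<infinity>"
      using sets_hit_ball finite_neighbourhood by (subst intensity_window) (auto simp: ennreal_mult_less_top)
    from AE_finitely_many_marked_points[OF s this] AE_space show ?thesis
      by eventually_elim (simp add: window_def closed_leaf)
  qed
  have cover: "AE \<omega> in \<Omega>. \<exists>i. snd (Z i \<omega>) < 0 \<and> covers (leaves \<omega> i) x"
  proof -
    let ?R = "\<lambda>a b :: bool. a"
    let ?N = "\<lambda>T. {\<omega> \<in> space \<Omega>. \<forall>i. leaves \<omega> i \<notin> window T (seen_from x x ?R)}"
    have Q: "(\<integral>\<^sup>+F. emeasure lborel {v. (v, F) \<in> seen_from x x ?R} \<partial>L) = ennreal M"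
      unfolding mean_area[symmetric]
      by (intro nn_integral_cong) (simp add: seen_from_def closed_L emeasure_lborel_reflect)
    have s: "?N T \<in> sets \<Omega>" if "T \<in> sets borel" for T
      using sets_window[OF that sets_seen_from] by measurable
    have "prob (?N {..<0}) \<le> exp (- M) ^ n" for n
    proof -
      have I: "intensity (window {- real n<..<0} (seen_from x x ?R)) = ennreal (real n * M)"
        by (subst intensity_window) (auto simp: Q ennreal_mult' M_pos less_imp_le)
      have "prob (?N {..<0}) \<le> prob (?N {- real n<..<0})"
        by (intro finite_measure_mono s) (auto simp: window_def)
      also have "\<dots> = exp (- (real n * M))"
        using M_pos by (subst prob_no_marked_point) (auto simp: I)
      also have "\<dots> = exp (- M) ^ n" by (simp add: exp_of_nat_mult[symmetric])
      finally show ?thesis .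
    qed
    moreover have "(\<lambda>n. exp (- M) ^ n) \<longlonglongrightarrow> 0"
      using M_pos by (intro LIMSEQ_realpow_zero) auto
    ultimately have "prob (?N {..<0}) \<le> 0"
      by (intro LIMSEQ_le_const) auto
    then have "AE \<omega> in \<Omega>. \<omega> \<notin> ?N {..<0}"
      using s[of "{..<0}"] measure_nonneg[of \<Omega> "?N {..<0}"]
      by (intro AE_not_in) (auto simp: null_sets_def emeasure_eq_measure)
    then show ?thesis
      using AE_space
    proof eventually_elim
      case (elim \<omega>)
      then show ?case using leaves_in_seen_from[OF elim(2), of _ "{..<0}" x x ?R] by auto
    qed
  qed
  have "AE \<omega> in \<Omega>. \<forall>n::nat. finite {i. snd (Z i \<omega>) \<in> {- real n<..<0} \<and> X i \<omega> \<inter> ball (x - fst (Z i \<omega>)) 1 \<noteq> {}}"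
    using finite by (simp add: AE_all_countable)
  with time0 frontier0 cover AE_space show ?thesis
    by eventually_elim (simp add: regular_at_def closed_leaf)
qed

end

section \<open>The probability that two points see different leaves\<close>

context tame_dead_leaves begin

lemma intensity_seen_from:
  assumes "T \<in> sets borel"
  shows "intensity (window T (seen_from x y R)) =
    emeasure lborel T * (\<integral>\<^sup>+F. emeasure lborel {v. R (x - v \<in> F) (y - v \<in> F)} \<partial>L)"
  by (subst intensity_window[OF assms sets_seen_from])
    (auto simp: seen_from_def closed_L intro!: arg_cong2[where f = "(*)"] nn_integral_cong)

lemma measurable_area [measurable]: "emeasure lborel \<in> borel_measurable L"
proof -
  have "{(F, v). closed F \<and> v \<in> F} = {q \<in> space (fell_borel \<Otimes>\<^sub>M borel). snd q \<in> fst q}"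
    by (auto simp: space_pair_measure space_fell_borel)
  also have "\<dots> \<in> sets (fell_borel \<Otimes>\<^sub>M (borel :: plane measure))" by measurable
  finally have "{(F, v). closed F \<and> v \<in> F} \<in> sets (L \<Otimes>\<^sub>M (lborel :: plane measure))"
    by (simp add: sets_pair_measure_cong[OF sets_L sets_lborel])
  then have "(\<lambda>F. emeasure lborel (Pair F -` {(F, v :: plane). closed F \<and> v \<in> F})) \<in> borel_measurable L"
    by (rule lborel.measurable_emeasure_Pair)
  moreover have "emeasure lborel (Pair F -` {(F, v :: plane). closed F \<and> v \<in> F}) = emeasure lborel F" if "F \<in> space L" for F
    using closed_L[OF that] by (simp add: vimage_def)
  ultimately show ?thesis by (simp cong: measurable_cong)
qed

lemma measurable_pair_area [measurable]:
  "(\<lambda>F. emeasure lborel {v. R (x - v \<in> F) (y - v \<in> F)}) \<in> borel_measurable L"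
proof -
  let ?Q = "{(F, v). (v, F) \<in> seen_from x y R}"
  have "?Q = (\<lambda>(F, v). (v, F)) -` seen_from x y R \<inter> space (fell_borel \<Otimes>\<^sub>M borel)"
    by (auto simp: seen_from_def space_pair_measure space_fell_borel)
  also have "\<dots> \<in> sets (fell_borel \<Otimes>\<^sub>M borel)" by measurable
  finally have "?Q \<in> sets (L \<Otimes>\<^sub>M lborel)"
    by (simp add: sets_pair_measure_cong[OF sets_L sets_lborel])
  then have "(\<lambda>F. emeasure lborel (Pair F -` ?Q)) \<in> borel_measurable L"
    by (rule lborel.measurable_emeasure_Pair)
  moreover have "emeasure lborel (Pair F -` ?Q) = emeasure lborel {v. R (x - v \<in> F) (y - v \<in> F)}" if "F \<in> space L" for F
    using closed_L[OF that] by (simp add: seen_from_def vimage_def)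
  ultimately show ?thesis by (simp cong: measurable_cong)
qed

text \<open>
  By reflection, the leaves covering \<open>x\<close> but not \<open>y\<close> have intensity \<open>loss F (x - y)\<close>; those
  covering \<open>y\<close> but not \<open>x\<close> have the same one, since leaves have equal areas at both points.
\<close>

lemma pair_areas:
  assumes D: "(\<integral>\<^sup>+F. loss F (x - y) \<partial>L) = ennreal D" and D0: "0 \<le> D"
  shows "D \<le> M"
    and "(\<integral>\<^sup>+F. emeasure lborel {v. x - v \<in> F \<and> y - v \<in> F} \<partial>L) = ennreal (M - D)"
    and "(\<integral>\<^sup>+F. emeasure lborel {v. x - v \<in> F \<or> y - v \<in> F} \<partial>L) = ennreal (M + D)"
    and "(\<integral>\<^sup>+F. emeasure lborel {v. (x - v \<in> F) \<noteq> (y - v \<in> F)} \<partial>L) = ennreal (2 * D)"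
proof -
  note [measurable] = measurable_pair_area[of "\<lambda>a b. a \<and> \<not> b" x y] measurable_pair_area[of "\<lambda>a b. a \<and> b" x y]
    measurable_pair_area[of "\<lambda>a b. b \<and> \<not> a" x y]
  let ?c = "\<integral>\<^sup>+F. emeasure lborel {v. x - v \<in> F \<and> y - v \<in> F} \<partial>L"
  let ?d = "\<integral>\<^sup>+F. emeasure lborel {v. x - v \<in> F \<and> y - v \<notin> F} \<partial>L"
  let ?e = "\<integral>\<^sup>+F. emeasure lborel {v. y - v \<in> F \<and> x - v \<notin> F} \<partial>L"
  have d: "?d = ennreal D"
    unfolding D[symmetric]
  proof (rule nn_integral_cong)
    fix F assume F: "F \<in> space L"
    have [measurable]: "F \<in> sets borel" using closed_L[OF F] by (rule borel_closed)
    have "{v. v \<in> F \<and> v - (x - y) \<notin> F} \<in> sets borel" by measurable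
    from emeasure_lborel_reflect[OF this, of x]
    show "emeasure lborel {v. x - v \<in> F \<and> y - v \<notin> F} = loss F (x - y)"
      by (simp add: loss_def algebra_simps)
  qed
  have split1: "emeasure lborel F = emeasure lborel {v. x - v \<in> F \<and> y - v \<in> F} + emeasure lborel {v. x - v \<in> F \<and> y - v \<notin> F}"
    and split2: "emeasure lborel F = emeasure lborel {v. x - v \<in> F \<and> y - v \<in> F} + emeasure lborel {v. y - v \<in> F \<and> x - v \<notin> F}"
    and split3: "emeasure lborel {v. x - v \<in> F \<or> y - v \<in> F} = emeasure lborel F + emeasure lborel {v. y - v \<in> F \<and> x - v \<notin> F}"
    and split4: "emeasure lborel {v. (x - v \<in> F) \<noteq> (y - v \<in> F)} =
      emeasure lborel {v. x - v \<in> F \<and> y - v \<notin> F} + emeasure lborel {v. y - v \<in> F \<and> x - v \<notin> F}"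
    if F: "F \<in> space L" for F
  proof -
    have [measurable]: "F \<in> sets borel" using closed_L[OF F] by (rule borel_closed)
    have "emeasure lborel F = emeasure lborel {v. x - v \<in> F}"
      by (simp add: emeasure_lborel_reflect)
    also have "\<dots> = emeasure lborel ({v. x - v \<in> F \<and> y - v \<in> F} \<union> {v. x - v \<in> F \<and> y - v \<notin> F})"
      by (rule arg_cong[where f = "emeasure lborel"]) auto
    also have "\<dots> = emeasure lborel {v. x - v \<in> F \<and> y - v \<in> F} + emeasure lborel {v. x - v \<in> F \<and> y - v \<notin> F}"
      by (intro plus_emeasure[symmetric]) (simp_all, auto)
    finally show s1: "emeasure lborel F = emeasure lborel {v. x - v \<in> F \<and> y - v \<in> F} + emeasure lborel {v. x - v \<in> F \<and> y - v \<notin> F}" .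
    have "emeasure lborel F = emeasure lborel {v. y - v \<in> F}"
      by (simp add: emeasure_lborel_reflect)
    also have "\<dots> = emeasure lborel ({v. x - v \<in> F \<and> y - v \<in> F} \<union> {v. y - v \<in> F \<and> x - v \<notin> F})"
      by (rule arg_cong[where f = "emeasure lborel"]) auto
    also have "\<dots> = emeasure lborel {v. x - v \<in> F \<and> y - v \<in> F} + emeasure lborel {v. y - v \<in> F \<and> x - v \<notin> F}"
      by (intro plus_emeasure[symmetric]) (simp_all, auto)
    finally show "emeasure lborel F = emeasure lborel {v. x - v \<in> F \<and> y - v \<in> F} + emeasure lborel {v. y - v \<in> F \<and> x - v \<notin> F}" .
    have "emeasure lborel {v. x - v \<in> F \<or> y - v \<in> F} = emeasure lborel ({v. x - v \<in> F} \<union> {v. y - v \<in> F \<and> x - v \<notin> F})"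
      by (rule arg_cong[where f = "emeasure lborel"]) auto
    also have "\<dots> = emeasure lborel {v. x - v \<in> F} + emeasure lborel {v. y - v \<in> F \<and> x - v \<notin> F}"
      by (intro plus_emeasure[symmetric]) (simp_all, auto)
    also have "emeasure lborel {v. x - v \<in> F} = emeasure lborel F"
      by (simp add: emeasure_lborel_reflect)
    finally show "emeasure lborel {v. x - v \<in> F \<or> y - v \<in> F} = emeasure lborel F + emeasure lborel {v. y - v \<in> F \<and> x - v \<notin> F}" .
    have "emeasure lborel {v. (x - v \<in> F) \<noteq> (y - v \<in> F)} =
        emeasure lborel ({v. x - v \<in> F \<and> y - v \<notin> F} \<union> {v. y - v \<in> F \<and> x - v \<notin> F})"
      by (rule arg_cong[where f = "emeasure lborel"]) auto
    also have "\<dots> = emeasure lborel {v. x - v \<in> F \<and> y - v \<notin> F} + emeasure lborel {v. y - v \<in> F \<and> x - v \<notin> F}"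
      by (intro plus_emeasure[symmetric]) (simp_all, auto)
    finally show "emeasure lborel {v. (x - v \<in> F) \<noteq> (y - v \<in> F)} =
      emeasure lborel {v. x - v \<in> F \<and> y - v \<notin> F} + emeasure lborel {v. y - v \<in> F \<and> x - v \<notin> F}" .
  qed
  have "ennreal M = (\<integral>\<^sup>+F. emeasure lborel {v. x - v \<in> F \<and> y - v \<in> F} + emeasure lborel {v. x - v \<in> F \<and> y - v \<notin> F} \<partial>L)"
    unfolding mean_area[symmetric] by (rule nn_integral_cong) (rule split1)
  also have "\<dots> = ?c + ?d" by (rule nn_integral_add) measurable
  finally have Mc: "ennreal M = ?c + ?d" .
  have "ennreal M = (\<integral>\<^sup>+F. emeasure lborel {v. x - v \<in> F \<and> y - v \<in> F} + emeasure lborel {v. y - v \<in> F \<and> x - v \<notin> F} \<partial>L)"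
    unfolding mean_area[symmetric] by (rule nn_integral_cong) (rule split2)
  also have "\<dots> = ?c + ?e" by (rule nn_integral_add) measurable
  finally have Me: "ennreal M = ?c + ?e" .
  have "?c \<le> ennreal M" unfolding Mc by simp
  then have cfin: "?c \<noteq> \<infinity>" by (auto simp: top_unique)
  have "?c + ?d = ?c + ?e" using Mc Me by (rule trans[OF sym])
  then have "?d = ?e" using cfin by (simp only: ennreal_add_left_cancel simp_thms infinity_ennreal_def)
  then have e: "?e = ennreal D" using d by (rule trans[OF sym])
  obtain c where c: "?c = ennreal c" "0 \<le> c"
    using cfin by (cases ?c) auto
  have McD: "M = c + D"
    using Mc c d D0 M_pos by (simp add: ennreal_plus[symmetric] del: ennreal_plus)
  then show "D \<le> M" using c by simp
  show "?c = ennreal (M - D)" using c McD by simp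
  have "(\<integral>\<^sup>+F. emeasure lborel {v. x - v \<in> F \<or> y - v \<in> F} \<partial>L) =
      (\<integral>\<^sup>+F. emeasure lborel F + emeasure lborel {v. y - v \<in> F \<and> x - v \<notin> F} \<partial>L)"
    by (rule nn_integral_cong) (rule split3)
  also have "\<dots> = ennreal M + ?e"
    unfolding mean_area[symmetric] by (rule nn_integral_add) measurable
  finally have "(\<integral>\<^sup>+F. emeasure lborel {v. x - v \<in> F \<or> y - v \<in> F} \<partial>L) = ennreal M + ?e" .
  then show "(\<integral>\<^sup>+F. emeasure lborel {v. x - v \<in> F \<or> y - v \<in> F} \<partial>L) = ennreal (M + D)"
    using e D0 M_pos by simp
  have "(\<integral>\<^sup>+F. emeasure lborel {v. (x - v \<in> F) \<noteq> (y - v \<in> F)} \<partial>L) =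
      (\<integral>\<^sup>+F. emeasure lborel {v. x - v \<in> F \<and> y - v \<notin> F} + emeasure lborel {v. y - v \<in> F \<and> x - v \<notin> F} \<partial>L)"
    by (rule nn_integral_cong) (rule split4)
  also have "\<dots> = ?d + ?e" by (rule nn_integral_add) measurable
  finally have "(\<integral>\<^sup>+F. emeasure lborel {v. (x - v \<in> F) \<noteq> (y - v \<in> F)} \<partial>L) = ?d + ?e" .
  then show "(\<integral>\<^sup>+F. emeasure lborel {v. (x - v \<in> F) \<noteq> (y - v \<in> F)} \<partial>L) = ennreal (2 * D)"
    using e d D0 by (simp add: ennreal_plus[symmetric] del: ennreal_plus)
qed

end

text \<open>
  The time below zero is cut into slots. If the slot of the highest leaf over \<open>x\<close> or \<open>y\<close> contains
  no leaf over exactly one of them, then that highest leaf is topmost at both points.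
\<close>

lemma common_topmost:
  assumes reg: "regular_at \<zeta> x" "regular_at \<zeta> y" and tau: "0 < \<tau>"
    and slots: "\<And>k::nat. \<not> ((\<forall>i. snd (fst (\<zeta> i)) \<in> {- (real k * \<tau>)<..<0} \<longrightarrow> \<not> (covers (\<zeta> i) x \<or> covers (\<zeta> i) y)) \<and>
      (\<exists>i. snd (fst (\<zeta> i)) \<in> {- (real (Suc k) * \<tau>)<..- (real k * \<tau>)} \<and> covers (\<zeta> i) x \<noteq> covers (\<zeta> i) y))"
  shows "\<exists>i. topmost \<zeta> x i \<and> topmost \<zeta> y i"
proof -
  let ?C = "{i. covers (\<zeta> i) x \<or> covers (\<zeta> i) y}"
  have "finite {i \<in> ?C. snd (fst (\<zeta> i)) \<in> {t<..<0}}" for t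
  proof -
    have "{i \<in> ?C. snd (fst (\<zeta> i)) \<in> {t<..<0}} =
      {i. snd (fst (\<zeta> i)) \<in> {t<..<0} \<and> covers (\<zeta> i) x} \<union> {i. snd (fst (\<zeta> i)) \<in> {t<..<0} \<and> covers (\<zeta> i) y}"
      by auto
    then show ?thesis using regular_at_finite_covers[OF reg(1)] regular_at_finite_covers[OF reg(2)] by simp
  qed
  moreover obtain i0 where "i0 \<in> ?C" "snd (fst (\<zeta> i0)) < 0"
    using reg by (auto simp: regular_at_def)
  ultimately obtain i where i: "i \<in> ?C" "snd (fst (\<zeta> i)) < 0"
    "\<And>j. j \<in> ?C \<Longrightarrow> \<not> snd (fst (\<zeta> j)) \<in> {snd (fst (\<zeta> i))<..<0}"
    using finite_nonempty_topmost[of ?C \<zeta> i0] by blast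
  \<comment> \<open>The slot of the highest leaf; slots are closed at their upper end because times are negative.\<close>
  define k where "k = nat \<lfloor>- snd (fst (\<zeta> i)) / \<tau>\<rfloor>"
  have "real k \<le> - snd (fst (\<zeta> i)) / \<tau>" "- snd (fst (\<zeta> i)) / \<tau> < real (Suc k)"
    using i(2) tau unfolding k_def by (auto simp: divide_nonpos_pos) linarith
  then have k: "snd (fst (\<zeta> i)) \<in> {- (real (Suc k) * \<tau>)<..- (real k * \<tau>)}"
    unfolding pos_le_divide_eq[OF tau] pos_divide_less_eq[OF tau] by simp
  have "\<not> snd (fst (\<zeta> j)) \<in> {- (real k * \<tau>)<..<0}" if "j \<in> ?C" for j
    using i(3)[OF that] k by auto
  then have "covers (\<zeta> i) x = covers (\<zeta> i) y"
    using slots[of k] k by blast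
  then show ?thesis using i by (auto simp: topmost_def)
qed

context tame_dead_leaves begin

context
  fixes x y :: plane and D :: real
  assumes D: "(\<integral>\<^sup>+F. loss F (x - y) \<partial>L) = ennreal D" and D0: "0 \<le> D"
begin

lemma intensity_pair:
  assumes "T \<in> sets borel" "emeasure lborel T = ennreal t" "0 \<le> t"
  shows "intensity (window T (seen_from x y (\<and>))) = ennreal (t * (M - D))"
    and "intensity (window T (seen_from x y (\<or>))) = ennreal (t * (M + D))"
    and "intensity (window T (seen_from x y (\<noteq>))) = ennreal (t * (2 * D))"
  using pair_areas[OF D D0] M_pos D0 assms by (simp_all add: intensity_seen_from ennreal_mult)

lemma sets_no_leaf [measurable]:
  assumes [measurable]: "B \<in> sets (borel \<Otimes>\<^sub>M fell_borel)"
  shows "{\<omega> \<in> space \<Omega>. \<forall>i. leaves \<omega> i \<notin> B} \<in> sets \<Omega>"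
  by measurable

text \<open>
  The event is the difference of two events that certain sets contain no leaf; the larger set is the
  union of the smaller one with leaves from an earlier time slot.
\<close>

lemma prob_split_at_slot:
  assumes "0 < \<tau>"
  shows "prob {\<omega> \<in> space \<Omega>. (\<forall>i. leaves \<omega> i \<notin> window {- (real k * \<tau>)<..<0} (seen_from x y (\<or>))) \<and>
      (\<exists>i. leaves \<omega> i \<in> window {- (real (Suc k) * \<tau>)<..- (real k * \<tau>)} (seen_from x y (\<noteq>)))}
    = exp (- (real k * \<tau> * (M + D))) * (1 - exp (- (\<tau> * (2 * D))))"
proof -
  let ?A = "window {- (real k * \<tau>)<..<0} (seen_from x y (\<or>))"
  let ?B = "window {- (real (Suc k) * \<tau>)<..- (real k * \<tau>)} (seen_from x y (\<noteq>))"
  have iA: "intensity ?A = ennreal (real k * \<tau> * (M + D))"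
    by (rule intensity_pair) (use assms in auto)
  have iB: "intensity ?B = ennreal (\<tau> * (2 * D))"
    by (rule intensity_pair) (use assms in \<open>auto simp: algebra_simps\<close>)
  have "intensity (?A \<union> ?B) = intensity ?A + intensity ?B"
  proof -
    interpret L: prob_space L by (rule prob_space_L)
    have s: "?A \<in> sets (borel \<Otimes>\<^sub>M fell_borel)" "?B \<in> sets (borel \<Otimes>\<^sub>M fell_borel)"
      by measurable
    have "emeasure L (Pair z -` (?A \<union> ?B)) = emeasure L (Pair z -` ?A) + emeasure L (Pair z -` ?B)" for z
      using sets_Pair1[OF s(1), of z] sets_Pair1[OF s(2), of z]
      by (subst plus_emeasure) (auto simp: sets_L window_def intro!: arg_cong[where f = "emeasure L"])
    then show ?thesis
      unfolding intensity_def by (simp only:) (rule nn_integral_add; measurable)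
  qed
  then have iAB: "intensity (?A \<union> ?B) = ennreal (real k * \<tau> * (M + D) + \<tau> * (2 * D))"
    using iA iB assms D0 M_pos by simp
  have "{\<omega> \<in> space \<Omega>. (\<forall>i. leaves \<omega> i \<notin> ?A) \<and> (\<exists>i. leaves \<omega> i \<in> ?B)} =
      {\<omega> \<in> space \<Omega>. \<forall>i. leaves \<omega> i \<notin> ?A} - {\<omega> \<in> space \<Omega>. \<forall>i. leaves \<omega> i \<notin> ?A \<union> ?B}"
    by auto
  then have "prob {\<omega> \<in> space \<Omega>. (\<forall>i. leaves \<omega> i \<notin> ?A) \<and> (\<exists>i. leaves \<omega> i \<in> ?B)} =
      prob ({\<omega> \<in> space \<Omega>. \<forall>i. leaves \<omega> i \<notin> ?A} - {\<omega> \<in> space \<Omega>. \<forall>i. leaves \<omega> i \<notin> ?A \<union> ?B})"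
    by (rule arg_cong)
  also have "\<dots> = prob {\<omega> \<in> space \<Omega>. \<forall>i. leaves \<omega> i \<notin> ?A} - prob {\<omega> \<in> space \<Omega>. \<forall>i. leaves \<omega> i \<notin> ?A \<union> ?B}"
  proof (rule finite_measure_Diff)
    show "{\<omega> \<in> space \<Omega>. \<forall>i. leaves \<omega> i \<notin> ?A} \<in> events" "{\<omega> \<in> space \<Omega>. \<forall>i. leaves \<omega> i \<notin> ?A \<union> ?B} \<in> events"
      by (rule sets_no_leaf, (rule sets.Un)?, (rule sets_window[OF _ sets_seen_from], simp)+)+
  qed (rule Collect_mono, simp)
  also have "\<dots> = exp (- (real k * \<tau> * (M + D))) - exp (- (real k * \<tau> * (M + D) + \<tau> * (2 * D)))"
  proof -
    have "0 \<le> real k * \<tau> * (M + D)" "0 \<le> real k * \<tau> * (M + D) + \<tau> * (2 * D)"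
      using assms D0 M_pos by simp_all
    moreover have "?A \<in> sets (borel \<Otimes>\<^sub>M fell_borel)" "?A \<union> ?B \<in> sets (borel \<Otimes>\<^sub>M fell_borel)" by measurable
    ultimately show ?thesis
      using prob_no_marked_point[of ?A] prob_no_marked_point[of "?A \<union> ?B"] unfolding iA iAB
      by (simp only: ennreal_less_top infinity_ennreal_def enn2real_ennreal simp_thms)
  qed
  also have "\<dots> = exp (- (real k * \<tau> * (M + D))) * (1 - exp (- (\<tau> * (2 * D))))"
    by (simp only: right_diff_distrib mult_exp_exp mult_1_right minus_add_distrib)
  finally show ?thesis .
qed

text \<open>
  The slots have length \<open>1 / M\<close>, in which one leaf over a given point is expected.
\<close>

definition split_event :: "nat \<Rightarrow> 'w set" where
  "split_event k = {\<omega> \<in> space \<Omega>. (\<forall>i. leaves \<omega> i \<notin> window {- (real k * (1 / M))<..<0} (seen_from x y (\<or>))) \<and>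
      (\<exists>i. leaves \<omega> i \<in> window {- (real (Suc k) * (1 / M))<..- (real k * (1 / M))} (seen_from x y (\<noteq>)))}"

lemma sets_split_event [measurable]: "split_event k \<in> sets \<Omega>"
proof -
  have "split_event k = {\<omega> \<in> space \<Omega>. \<forall>i. leaves \<omega> i \<notin> window {- (real k * (1 / M))<..<0} (seen_from x y (\<or>))} -
      {\<omega> \<in> space \<Omega>. \<forall>i. leaves \<omega> i \<notin> window {- (real (Suc k) * (1 / M))<..- (real k * (1 / M))} (seen_from x y (\<noteq>))}"
    unfolding split_event_def by blast
  then show ?thesis by (simp only:) (intro sets.Diff sets_no_leaf sets_window sets_seen_from; simp)
qed

text \<open>
  The probability that no leaf has covered \<open>x\<close> or \<open>y\<close> before a slot is reached decreases geometrically
  from slot to slot, so the total is comparable with the probability for a single slot.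
\<close>

lemma emeasure_split_events: "emeasure \<Omega> (\<Union>k. split_event k) \<le> ennreal (2 / (1 - exp (- 1)) * (D / M))"
proof -
  have "prob (split_event k) \<le> exp (- 1) ^ k * (2 * (D / M))" for k
  proof -
    have "1 - exp (- (1 / M * (2 * D))) \<le> 2 * (D / M)"
      using exp_ge_add_one_self[of "- (1 / M * (2 * D))"] by simp
    moreover have "exp (- (real k * (1 / M) * (M + D))) \<le> exp (- 1) ^ k"
    proof -
      have "1 \<le> (M + D) / M" using M_pos D0 by simp
      then have "real k * 1 \<le> real k * ((M + D) / M)" by (intro mult_left_mono) auto
      then show ?thesis by (simp add: exp_of_nat_mult[symmetric])
    qed
    ultimately have "exp (- (real k * (1 / M) * (M + D))) * (1 - exp (- (1 / M * (2 * D)))) \<le> exp (- 1) ^ k * (2 * (D / M))"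
      using M_pos D0 by (intro mult_mono) auto
    then show ?thesis
      unfolding split_event_def using M_pos by (simp only: prob_split_at_slot zero_less_divide_1_iff)
  qed
  then have "(\<Sum>k. emeasure \<Omega> (split_event k)) \<le> (\<Sum>k. ennreal (exp (- 1) ^ k * (2 * (D / M))))"
    by (intro suminf_le) (auto simp: emeasure_eq_measure ennreal_leI)
  also have "\<dots> = ennreal (1 / (1 - exp (- 1)) * (2 * (D / M)))"
    using M_pos D0 by (intro suminf_ennreal_eq sums_mult2 geometric_sums) auto
  finally have "(\<Sum>k. emeasure \<Omega> (split_event k)) \<le> ennreal (2 / (1 - exp (- 1)) * (D / M))"
    by (simp add: field_simps)
  moreover have "emeasure \<Omega> (\<Union>k. split_event k) \<le> (\<Sum>k. emeasure \<Omega> (split_event k))"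
    by (rule emeasure_subadditive_countably) auto
  ultimately show ?thesis by (rule order_trans[rotated])
qed

lemma AE_common_topmost:
  "AE \<omega> in \<Omega>. \<omega> \<notin> (\<Union>k. split_event k) \<longrightarrow> (\<exists>i. topmost (leaves \<omega>) x i \<and> topmost (leaves \<omega>) y i)"
  using AE_regular_at[of x] AE_regular_at[of y] AE_space
proof eventually_elim
  case (elim \<omega>)
  show ?case
  proof
    assume "\<omega> \<notin> (\<Union>k. split_event k)"
    then have no: "\<omega> \<notin> split_event k" for k by blast
    show "\<exists>i. topmost (leaves \<omega>) x i \<and> topmost (leaves \<omega>) y i"
    proof (rule common_topmost[OF elim(1,2)])
      show "0 < 1 / M" using M_pos by simp
    qed (use no elim(3) in \<open>simp only: split_event_def leaves_in_seen_from[OF elim(3)] mem_Collect_eq fst_conv snd_conv simp_thms imp_conv_disj de_Morgan_conj not_all not_ex\<close>)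
  qed
qed

text \<open>
  If some leaf in the slot below time \<open>0\<close> covers \<open>x\<close> or \<open>y\<close> but none covers both, then different
  leaves are seen. A single slot suffices for a lower bound of the right order.
\<close>

definition distinct_event :: "(nat \<Rightarrow> (plane \<times> real) \<times> plane set) set" where
  "distinct_event = {\<zeta> \<in> space (PiM UNIV (\<lambda>_. borel \<Otimes>\<^sub>M fell_borel)).
     (\<forall>i. \<zeta> i \<notin> window {- (1 / M)<..<0} (seen_from x y (\<and>))) \<and>
     (\<exists>i. \<zeta> i \<in> window {- (1 / M)<..<0} (seen_from x y (\<or>)))}"

lemma sets_distinct_event [measurable]:
  "distinct_event \<in> sets (PiM UNIV (\<lambda>_. borel \<Otimes>\<^sub>M fell_borel))"
proof -
  let ?P = "PiM UNIV (\<lambda>_::nat. borel \<Otimes>\<^sub>M fell_borel) :: (nat \<Rightarrow> (plane \<times> real) \<times> plane set) measure"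
  have m: "{\<zeta> \<in> space ?P. \<forall>i. \<zeta> i \<notin> B} \<in> sets ?P" if [measurable]: "B \<in> sets (borel \<Otimes>\<^sub>M fell_borel)" for B
    by measurable
  have "distinct_event = {\<zeta> \<in> space ?P. \<forall>i. \<zeta> i \<notin> window {- (1 / M)<..<0} (seen_from x y (\<and>))} -
      {\<zeta> \<in> space ?P. \<forall>i. \<zeta> i \<notin> window {- (1 / M)<..<0} (seen_from x y (\<or>))}"
    unfolding distinct_event_def by blast
  then show ?thesis by (simp only:) (intro sets.Diff m sets_window sets_seen_from; simp)
qed

lemma leaves_measurable [measurable]: "leaves \<in> measurable \<Omega> (PiM UNIV (\<lambda>_. borel \<Otimes>\<^sub>M fell_borel))"
proof (rule measurable_PiM_single')
  show "(\<lambda>\<omega>. leaves \<omega> i) \<in> measurable \<Omega> (borel \<Otimes>\<^sub>M fell_borel)" for i by measurable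
  show "leaves \<in> space \<Omega> \<rightarrow> UNIV \<rightarrow>\<^sub>E space (borel \<Otimes>\<^sub>M fell_borel)"
    by (auto simp: space_pair_measure space_fell_borel closed_leaf)
qed

lemma prob_distinct_event: "exp (- 1) * (D / M) \<le> prob {\<omega> \<in> space \<Omega>. leaves \<omega> \<in> distinct_event}"
proof -
  let ?C = "window {- (1 / M)<..<0} (seen_from x y (\<and>))"
  let ?A = "window {- (1 / M)<..<0} (seen_from x y (\<or>))"
  have iC: "intensity ?C = ennreal (1 / M * (M - D))" and iA: "intensity ?A = ennreal (1 / M * (M + D))"
    by (rule intensity_pair; use M_pos in simp)+
  have DM: "D \<le> M" by (rule pair_areas[OF D D0])
  have sub: "?C \<subseteq> ?A" by (auto simp: window_def seen_from_def)
  have "{\<omega> \<in> space \<Omega>. leaves \<omega> \<in> distinct_event} =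
      {\<omega> \<in> space \<Omega>. \<forall>i. leaves \<omega> i \<notin> ?C} - {\<omega> \<in> space \<Omega>. \<forall>i. leaves \<omega> i \<notin> ?A}"
    using measurable_space[OF leaves_measurable] by (auto simp: distinct_event_def)
  then have "prob {\<omega> \<in> space \<Omega>. leaves \<omega> \<in> distinct_event} =
      prob ({\<omega> \<in> space \<Omega>. \<forall>i. leaves \<omega> i \<notin> ?C} - {\<omega> \<in> space \<Omega>. \<forall>i. leaves \<omega> i \<notin> ?A})"
    by (simp only:)
  also have "\<dots> = prob {\<omega> \<in> space \<Omega>. \<forall>i. leaves \<omega> i \<notin> ?C} - prob {\<omega> \<in> space \<Omega>. \<forall>i. leaves \<omega> i \<notin> ?A}"
  proof (rule finite_measure_Diff)
    show "{\<omega> \<in> space \<Omega>. \<forall>i. leaves \<omega> i \<notin> ?C} \<in> events" "{\<omega> \<in> space \<Omega>. \<forall>i. leaves \<omega> i \<notin> ?A} \<in> events"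
      by (rule sets_no_leaf, (rule sets_window[OF _ sets_seen_from], simp)+)+
  qed (rule Collect_mono, use sub in blast)
  also have "\<dots> = exp (- (1 / M * (M - D))) - exp (- (1 / M * (M + D)))"
  proof -
    have "0 \<le> 1 / M * (M - D)" "0 \<le> 1 / M * (M + D)" using M_pos D0 DM by simp_all
    moreover have "?C \<in> sets (borel \<Otimes>\<^sub>M fell_borel)" "?A \<in> sets (borel \<Otimes>\<^sub>M fell_borel)" by measurable
    ultimately show ?thesis
      using prob_no_marked_point[of ?C] prob_no_marked_point[of ?A] unfolding iA iC
      by (simp only: ennreal_less_top infinity_ennreal_def enn2real_ennreal simp_thms)
  qed
  also have "\<dots> = exp (- 1) * (exp (D / M) - exp (- (D / M)))"
  proof -
    have "- (1 / M * (M - D)) = - 1 + D / M" "- (1 / M * (M + D)) = - 1 + - (D / M)"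
      using M_pos by (simp_all add: field_simps)
    then show ?thesis by (simp only: right_diff_distrib mult_exp_exp)
  qed
  finally have "prob {\<omega> \<in> space \<Omega>. leaves \<omega> \<in> distinct_event} = exp (- 1) * (exp (D / M) - exp (- (D / M)))" .
  moreover have "D / M \<le> exp (D / M) - exp (- (D / M))"
  proof -
    have "exp (- (D / M)) \<le> 1" using M_pos D0 by simp
    then show ?thesis using exp_ge_add_one_self[of "D / M"] by linarith
  qed
  ultimately show ?thesis by (simp only:) (rule mult_left_mono; simp)
qed

lemma distinct_event_topmost:
  assumes "\<zeta> \<in> distinct_event" and "topmost \<zeta> x i" "topmost \<zeta> y j"
  shows "i \<noteq> j"
proof
  assume "i = j"
  then have i: "covers (\<zeta> i) x" "covers (\<zeta> i) y" "snd (fst (\<zeta> i)) < 0"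
    and above: "\<And>k. snd (fst (\<zeta> k)) \<in> {snd (fst (\<zeta> i))<..<0} \<Longrightarrow> \<not> covers (\<zeta> k) x \<and> \<not> covers (\<zeta> k) y"
    using assms by (auto simp: topmost_def)
  have cl: "closed (snd (\<zeta> k))" for k
  proof -
    have "\<zeta> k \<in> space (borel \<Otimes>\<^sub>M fell_borel)"
      using assms(1) unfolding distinct_event_def space_PiM by auto
    then show ?thesis by (cases "\<zeta> k") (auto simp: space_pair_measure space_fell_borel)
  qed
  have w: "\<zeta> k \<in> window T (seen_from x y R) \<longleftrightarrow> snd (fst (\<zeta> k)) \<in> T \<and> R (covers (\<zeta> k) x) (covers (\<zeta> k) y)" for k T R
    using cl[of k] by (auto simp: window_def seen_from_def covers_def)
  have "\<not> (snd (fst (\<zeta> i)) \<in> {- (1 / M)<..<0} \<and> (covers (\<zeta> i) x \<and> covers (\<zeta> i) y))"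
    using assms(1) unfolding distinct_event_def mem_Collect_eq w by blast
  then have low: "snd (fst (\<zeta> i)) \<le> - (1 / M)" using i by auto
  obtain k where k: "snd (fst (\<zeta> k)) \<in> {- (1 / M)<..<0}" "covers (\<zeta> k) x \<or> covers (\<zeta> k) y"
    using assms(1) unfolding distinct_event_def mem_Collect_eq w by blast
  then have "snd (fst (\<zeta> k)) \<in> {snd (fst (\<zeta> i))<..<0}" using low by simp
  from above[OF this] k(2) show False by simp
qed

end

end

section \<open>Two-point increments of the colored field\<close>

locale tame_colored_dead_leaves =
  tame_dead_leaves \<Omega> L Z X M + colored_dead_leaves \<Omega> L Z X U I
  for \<Omega> :: "'w measure" and L Z X M U I
begin

lemma AE_field_topmost: "AE \<omega> in \<Omega>. \<forall>i. topmost (leaves \<omega>) x i \<longrightarrow> I \<omega> x = U i \<omega>"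
  using field_interior AE_regular_at[of x]
proof eventually_elim
  case (elim \<omega>)
  show ?case
  proof (intro allI impI)
    fix i assume t: "topmost (leaves \<omega>) x i"
    then have "snd (Z i \<omega>) \<le> 0" by (simp add: topmost_def)
    with topmost_interior_visible_part[OF elim(2) t] topmost_not_leaves_boundary[OF elim(2) t] elim(1)
    show "I \<omega> x = U i \<omega>" by blast
  qed
qed

lemma color_measurable [measurable]: "U i \<in> borel_measurable \<Omega>"
  using colors_indep by (simp add: indep_vars_def2)

lemma prob_color:
  assumes [measurable]: "A \<in> sets borel"
  shows "prob {\<omega> \<in> space \<Omega>. U i \<omega> \<in> A} = measure lborel ({0<..<1} \<inter> A)"
proof -
  have "prob {\<omega> \<in> space \<Omega>. U i \<omega> \<in> A} = measure (distr \<Omega> borel (U i)) A"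
    by (subst measure_distr) (auto simp: vimage_def Int_def conj_commute)
  also have "\<dots> = measure lborel ({0<..<1} \<inter> A)"
    by (simp add: colors_uniform measure_def divide_ennreal_def)
  finally show ?thesis .
qed

lemma AE_color_range: "AE \<omega> in \<Omega>. \<forall>i. U i \<omega> \<in> {0<..<1}"
proof -
  have "AE \<omega> in \<Omega>. U i \<omega> \<in> {0<..<1}" for i
  proof -
    have "prob {\<omega> \<in> space \<Omega>. U i \<omega> \<in> {0<..<1}} = 1"
      by (subst prob_color) auto
    then have "AE \<omega> in \<Omega>. \<omega> \<in> {\<omega> \<in> space \<Omega>. U i \<omega> \<in> {0<..<1}}"
      by (rule AE_prob_1)
    then show ?thesis by eventually_elim auto
  qed
  then show ?thesis unfolding AE_all_countable by blast
qed

lemma AE_field_range: "AE \<omega> in \<Omega>. I \<omega> x \<in> {0<..<1}"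
  using AE_field_topmost[of x] AE_color_range AE_regular_at[of x]
proof eventually_elim
  case (elim \<omega>)
  then show ?case using regular_at_topmost[OF elim(3)] by metis
qed

lemma field_measurable [measurable]: "(\<lambda>\<omega>. I \<omega> x) \<in> borel_measurable \<Omega>"
  using field by (simp add: random_field_def)

context
  fixes x y :: plane and D p :: real
  assumes D: "(\<integral>\<^sup>+F. loss F (x - y) \<partial>L) = ennreal D" and D0: "0 \<le> D" and p: "1 \<le> p"
begin

text \<open>
  Outside the split events some leaf is topmost at both points, and both have its color.
\<close>

lemma increment_moment_le:
  "(\<integral>\<^sup>+\<omega>. ennreal (\<bar>I \<omega> x - I \<omega> y\<bar> powr p) \<partial>\<Omega>) \<le> ennreal (2 / (1 - exp (- 1)) * (D / M))"
proof -
  have "(\<integral>\<^sup>+\<omega>. ennreal (\<bar>I \<omega> x - I \<omega> y\<bar> powr p) \<partial>\<Omega>) \<le> (\<integral>\<^sup>+\<omega>. indicator (\<Union>k. split_event x y k) \<omega> \<partial>\<Omega>)"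
  proof (rule nn_integral_mono_AE)
    show "AE \<omega> in \<Omega>. ennreal (\<bar>I \<omega> x - I \<omega> y\<bar> powr p) \<le> indicator (\<Union>k. split_event x y k) \<omega>"
      using AE_common_topmost[OF D D0] AE_field_topmost[of x] AE_field_topmost[of y] AE_field_range[of x] AE_field_range[of y]
    proof eventually_elim
      case (elim \<omega>)
      show ?case
      proof (cases "\<omega> \<in> (\<Union>k. split_event x y k)")
        case True
        have "\<bar>I \<omega> x - I \<omega> y\<bar> \<le> 1" using elim(4,5) by (auto simp: abs_if)
        then have "\<bar>I \<omega> x - I \<omega> y\<bar> powr p \<le> 1" using p by (intro powr_le1) auto
        then show ?thesis using True by (simp only: indicator_simps ennreal_le_1)
      next
        case False
        then obtain i where "topmost (leaves \<omega>) x i" "topmost (leaves \<omega>) y i" using elim(1) by blast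
        then have "I \<omega> x = I \<omega> y" using elim(2,3) by simp
        then show ?thesis by simp
      qed
    qed
  qed
  also have "\<dots> = emeasure \<Omega> (\<Union>k. split_event x y k)"
    using sets_split_event[OF D D0] by (intro nn_integral_indicator) auto
  also have "\<dots> \<le> ennreal (2 / (1 - exp (- 1)) * (D / M))"
    by (rule emeasure_split_events[OF D D0])
  finally show ?thesis .
qed

text \<open>Choosing the first topmost leaf makes the events below disjoint even if there are ties.\<close>

definition first_topmost :: "plane \<Rightarrow> nat \<Rightarrow> (nat \<Rightarrow> (plane \<times> real) \<times> plane set) set" where
  "first_topmost v i = {\<zeta> \<in> space (PiM UNIV (\<lambda>_. borel \<Otimes>\<^sub>M fell_borel)). topmost \<zeta> v i \<and> (\<forall>k<i. \<not> topmost \<zeta> v k)}"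

lemma sets_first_topmost: "first_topmost v i \<in> sets (PiM UNIV (\<lambda>_. borel \<Otimes>\<^sub>M fell_borel))"
proof -
  let ?P = "PiM UNIV (\<lambda>_::nat. borel \<Otimes>\<^sub>M fell_borel) :: (nat \<Rightarrow> (plane \<times> real) \<times> plane set) measure"
  have [measurable]: "(\<lambda>\<zeta>. \<zeta> i) \<in> measurable ?P (borel \<Otimes>\<^sub>M fell_borel)" for i
    by (rule measurable_component_singleton) simp
  have [measurable]: "Measurable.pred ?P (\<lambda>\<zeta>. covers (\<zeta> i) v)" for i
    unfolding covers_def by (rule pred_mem_fell) measurable
  have [measurable]: "Measurable.pred ?P (\<lambda>\<zeta>. topmost \<zeta> v i)" for i
    unfolding topmost_def greaterThanLessThan_iff by measurable
  show ?thesis unfolding first_topmost_def by measurable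
qed

text \<open>
  Given that \<open>x\<close> and \<open>y\<close> see the different leaves \<open>i\<close> and \<open>j\<close>, their colors are independent of this
  event, and with probability \<open>1 / 9\<close> they lie in the lower and in the upper third of the unit
  interval.
\<close>

lemma increment_moment_ge:
  "ennreal (exp (- 1) / (9 * 3 powr p) * (D / M)) \<le> (\<integral>\<^sup>+\<omega>. ennreal (\<bar>I \<omega> x - I \<omega> y\<bar> powr p) \<partial>\<Omega>)"
proof -
  define S where "S n = (case prod_decode n of (i, j) \<Rightarrow> distinct_event x y \<inter> first_topmost x i \<inter> first_topmost y j)" for n
  define B where "B n = (case prod_decode n of (i, j) \<Rightarrow> {c \<in> space (PiM UNIV (\<lambda>_::nat. borel :: real measure)). c i < 1 / 3 \<and> 2 / 3 < c j})"
    for n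
  have S: "S n \<in> sets (PiM UNIV (\<lambda>_. borel \<Otimes>\<^sub>M fell_borel))" for n
    unfolding S_def using sets_distinct_event[OF D D0] sets_first_topmost by (auto split: prod.split)
  have B: "B n \<in> sets (PiM UNIV (\<lambda>_. borel))" for n
    unfolding B_def by (cases "prod_decode n") (simp, measurable)
  define SE where "SE n = {\<omega> \<in> space \<Omega>. leaves \<omega> \<in> S n}" for n
  define SBE where "SBE n = {\<omega> \<in> space \<Omega>. leaves \<omega> \<in> S n \<and> (\<lambda>i. U i \<omega>) \<in> B n}" for n
  have lm: "leaves \<in> measurable \<Omega> (PiM UNIV (\<lambda>_. borel \<Otimes>\<^sub>M fell_borel))"
    by (rule leaves_measurable[OF D D0])
  have Um: "(\<lambda>\<omega> i. U i \<omega>) \<in> measurable \<Omega> (PiM UNIV (\<lambda>_. borel))"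
    by (rule measurable_PiM_single') auto
  have SE: "SE n \<in> sets \<Omega>" for n
    unfolding SE_def using measurable_sets[OF lm S[of n]] by (simp add: vimage_def Int_def conj_commute)
  have SBE: "SBE n \<in> sets \<Omega>" for n
  proof -
    have "SBE n = SE n \<inter> ((\<lambda>\<omega> i. U i \<omega>) -` B n \<inter> space \<Omega>)" unfolding SBE_def SE_def by auto
    then show ?thesis using SE[of n] measurable_sets[OF Um B[of n]] by simp
  qed
  have disj: "S m \<inter> S n = {}" if "m \<noteq> n" for m n
  proof -
    have "i = i'" if "\<zeta> \<in> first_topmost v i" "\<zeta> \<in> first_topmost v i'" for \<zeta> v i i'
      using that unfolding first_topmost_def by (metis (mono_tags, lifting) linorder_neqE_nat mem_Collect_eq)
    moreover obtain i j i' j' where "prod_decode m = (i, j)" "prod_decode n = (i', j')" by fastforce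
    moreover have "(i, j) \<noteq> (i', j')" using that calculation(2,3) by (metis prod_decode_inverse)
    ultimately show ?thesis unfolding S_def by auto
  qed
  have prob_SBE: "prob (SBE n) = prob (SE n) / 9" for n
  proof -
    obtain i j where n: "prod_decode n = (i, j)" by fastforce
    show ?thesis
    proof (cases "i = j")
      case True
      have "S n = {}"
        using distinct_event_topmost[OF D D0] True unfolding S_def n first_topmost_def by auto
      then show ?thesis by (simp add: SBE_def SE_def)
    next
      case False
      define A :: "nat \<Rightarrow> real set" where "A k = (if k = i then {..<1/3} else {2/3<..})" for k
      have "prob (SBE n) = prob (SE n) * prob {\<omega> \<in> space \<Omega>. (\<lambda>i. U i \<omega>) \<in> B n}"
        unfolding SBE_def SE_def using S B by (rule prob_indep_rv[OF colors_indep_leaves])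
      also have "{\<omega> \<in> space \<Omega>. (\<lambda>i. U i \<omega>) \<in> B n} = (\<Inter>k\<in>{i, j}. U k -` A k \<inter> space \<Omega>)"
        using False by (auto simp: B_def n A_def space_PiM)
      also have "prob \<dots> = (\<Prod>k\<in>{i, j}. prob (U k -` A k \<inter> space \<Omega>))"
        by (rule indep_varsD[OF colors_indep]) (auto simp: A_def)
      also have "\<dots> = (\<Prod>k\<in>{i, j}. 1 / 3)"
      proof (rule prod.cong)
        fix k
        have "{0<..<1} \<inter> {..<1 / 3 :: real} = {0<..<1/3}" "{0<..<1} \<inter> {2 / 3 :: real<..} = {2/3<..<1}" by auto
        then have "measure lborel ({0<..<1} \<inter> A k) = 1 / 3" by (simp add: A_def)
        moreover have "U k -` A k \<inter> space \<Omega> = {\<omega> \<in> space \<Omega>. U k \<omega> \<in> A k}" by auto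
        ultimately show "prob (U k -` A k \<inter> space \<Omega>) = 1 / 3"
          using prob_color[of "A k" k] by (simp add: A_def)
      qed simp
      finally show ?thesis using False by simp
    qed
  qed
  have "AE \<omega> in \<Omega>. leaves \<omega> \<in> distinct_event x y \<longrightarrow> \<omega> \<in> (\<Union>n. SE n)"
    using AE_regular_at[of x] AE_regular_at[of y] AE_space
  proof eventually_elim
    case (elim \<omega>)
    have ex: "\<exists>i. leaves \<omega> \<in> first_topmost v i" if "regular_at (leaves \<omega>) v" for v
    proof -
      have "\<exists>i. topmost (leaves \<omega>) v i" by (rule regular_at_topmost[OF that])
      then obtain i where "topmost (leaves \<omega>) v i" "\<And>k. k < i \<Longrightarrow> \<not> topmost (leaves \<omega>) v k"
        using exists_least_iff[of "topmost (leaves \<omega>) v"] by blast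
      then show ?thesis
        unfolding first_topmost_def using measurable_space[OF lm elim(3)] by blast
    qed
    then obtain i j where ij: "leaves \<omega> \<in> first_topmost x i" "leaves \<omega> \<in> first_topmost y j"
      using elim(1,2) by blast
    show ?case
    proof
      assume "leaves \<omega> \<in> distinct_event x y"
      then have "\<omega> \<in> SE (prod_encode (i, j))"
        using ij elim(3) by (simp add: SE_def S_def)
      then show "\<omega> \<in> (\<Union>n. SE n)" by blast
    qed
  qed
  then have "prob {\<omega> \<in> space \<Omega>. leaves \<omega> \<in> distinct_event x y} \<le> prob (\<Union>n. SE n)"
    using SE by (intro finite_measure_mono_AE) auto
  then have DS: "exp (- 1) * (D / M) \<le> prob (\<Union>n. SE n)"
    using prob_distinct_event[OF D D0] by (rule order_trans[rotated])
  have "(\<lambda>n. prob (SE n)) sums prob (\<Union>n. SE n)"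
    using SE disj by (intro finite_measure_UNION) (auto simp: disjoint_family_on_def SE_def)
  then have "(\<lambda>n. prob (SBE n)) sums (prob (\<Union>n. SE n) / 9)"
    unfolding prob_SBE by (rule sums_divide)
  moreover have "(\<lambda>n. prob (SBE n)) sums prob (\<Union>n. SBE n)"
    using SBE disj by (intro finite_measure_UNION) (auto simp: disjoint_family_on_def SBE_def)
  ultimately have SB: "prob (\<Union>n. SBE n) = prob (\<Union>n. SE n) / 9" using sums_unique2 by blast
  have "ennreal (exp (- 1) / (9 * 3 powr p) * (D / M)) \<le> ennreal (prob (\<Union>n. SBE n) / 3 powr p)"
    using DS SB by (intro ennreal_leI) (simp add: field_simps)
  also have "\<dots> = ennreal (1 / 3 powr p) * emeasure \<Omega> (\<Union>n. SBE n)"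
    by (simp add: emeasure_eq_measure ennreal_mult[symmetric])
  also have "\<dots> = (\<integral>\<^sup>+\<omega>. ennreal (1 / 3 powr p) * indicator (\<Union>n. SBE n) \<omega> \<partial>\<Omega>)"
    using SBE by (intro nn_integral_cmult_indicator[symmetric]) auto
  also have "\<dots> \<le> (\<integral>\<^sup>+\<omega>. ennreal (\<bar>I \<omega> x - I \<omega> y\<bar> powr p) \<partial>\<Omega>)"
  proof (rule nn_integral_mono_AE)
    show "AE \<omega> in \<Omega>. ennreal (1 / 3 powr p) * indicator (\<Union>n. SBE n) \<omega> \<le> ennreal (\<bar>I \<omega> x - I \<omega> y\<bar> powr p)"
      using AE_field_topmost[of x] AE_field_topmost[of y]
    proof eventually_elim
      case (elim \<omega>)
      show ?case
      proof (cases "\<omega> \<in> (\<Union>n. SBE n)")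
        case True
        then obtain n i j where "\<omega> \<in> SBE n" and n: "prod_decode n = (i, j)" by fastforce
        then have "topmost (leaves \<omega>) x i" "topmost (leaves \<omega>) y j" "U i \<omega> < 1 / 3" "2 / 3 < U j \<omega>"
          unfolding SBE_def S_def B_def n first_topmost_def by auto
        then have "1 / 3 \<le> \<bar>I \<omega> x - I \<omega> y\<bar>" using elim by auto
        then have "(1 / 3) powr p \<le> \<bar>I \<omega> x - I \<omega> y\<bar> powr p" using p by (intro powr_mono2) auto
        then show ?thesis using True by (simp add: powr_divide ennreal_leI)
      qed simp
    qed
  qed
  finally show ?thesis .
qed

end

end

section \<open>Besov norms through integrated increments\<close>

lemma epowr_mono: "0 < a \<Longrightarrow> x \<le> y \<Longrightarrow> epowr x a \<le> epowr y a"
  unfolding epowr_def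
  by (auto simp: top_unique intro!: ennreal_leI powr_mono2 enn2real_mono) (auto simp: less_top)

lemma epowr_epowr_inverse:
  assumes "0 < a" "0 < b" "a * b = 1"
  shows "epowr (epowr x a) b = x"
  using assms by (cases x) (auto simp: epowr_def powr_powr)

lemma epowr_le_iff:
  assumes "0 < p"
  shows "epowr x p \<le> B \<longleftrightarrow> x \<le> epowr B (1 / p)"
  using epowr_mono[of "1 / p" "epowr x p" B] epowr_mono[of p x "epowr B (1 / p)"]
    epowr_epowr_inverse[of p "1 / p" x] epowr_epowr_inverse[of "1 / p" p B] assms by auto

lemma epowr_mult:
  assumes "0 < p" "0 < c"
  shows "epowr (x * ennreal c) p = epowr x p * ennreal (c powr p)"
  using assms by (cases x) (auto simp: epowr_def ennreal_mult[symmetric] powr_mult ennreal_top_mult)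

lemma epowr_add_le:
  assumes "0 < p"
  shows "epowr (a + b) p \<le> ennreal (2 powr p) * (epowr a p + epowr b p)"
proof -
  have "a + b \<le> max a b * ennreal 2"
    by (metis add_mono ennreal_numeral max.cobounded1 max.cobounded2 mult_2_right)
  then have "epowr (a + b) p \<le> epowr (max a b * ennreal 2) p"
    using assms by (intro epowr_mono)
  also have "\<dots> = epowr (max a b) p * ennreal (2 powr p)"
    using assms by (intro epowr_mult) auto
  also have "epowr (max a b) p \<le> epowr a p + epowr b p"
    by (cases "a \<le> b") (auto simp: max_def add_increasing add_increasing2)
  finally show ?thesis by (simp add: mult_right_mono mult.commute)
qed

definition increment_integral :: "real \<Rightarrow> (plane \<Rightarrow> real) \<Rightarrow> plane \<Rightarrow> ennreal" where
  "increment_integral p f y = (\<integral>\<^sup>+x\<in>unit_square. ennreal (\<bar>increment f y x\<bar> powr p) \<partial>lborel)"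

lemma epowr_modulus_le:
  assumes p: "0 < p" and B: "\<And>y. norm y < u \<Longrightarrow> increment_integral p f y \<le> B"
  shows "epowr (modulus p f u) p \<le> B"
  unfolding epowr_le_iff[OF p] modulus_def
proof (rule SUP_least)
  fix y :: plane assume "y \<in> {y. norm y < u}"
  then show "Lp_norm p (increment f y) \<le> epowr B (1 / p)"
    unfolding Lp_norm_def increment_integral_def[symmetric] using p B by (intro epowr_mono) auto
qed

lemma epowr_modulus_ge:
  assumes p: "0 < p" and y: "norm y < u"
  shows "increment_integral p f y \<le> epowr (modulus p f u) p"
proof -
  have "increment_integral p f y = epowr (Lp_norm p (increment f y)) p"
    unfolding Lp_norm_def increment_integral_def[symmetric] using p by (simp add: epowr_epowr_inverse)
  also have "\<dots> \<le> epowr (modulus p f u) p"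
    unfolding modulus_def using p y by (intro epowr_mono SUP_upper) auto
  finally show ?thesis .
qed

lemma mem_unit_square: "x \<in> unit_square \<longleftrightarrow> (\<forall>i. 0 \<le> x $ i \<and> x $ i \<le> 1)"
  by (simp add: unit_square_def mem_box_cart)

lemma norm_le_abs_sum: "norm (x :: plane) \<le> \<bar>x $ 1\<bar> + \<bar>x $ 2\<bar>"
  using norm_le_l1_cart[of x] by (simp add: sum_2)

lemma sets_unit_square [measurable]: "unit_square \<in> sets borel"
  unfolding unit_square_def by simp

lemma emeasure_plane_box:
  fixes a b :: plane
  assumes "\<And>i. a $ i \<le> b $ i"
  shows "emeasure lborel (cbox a b) = ennreal ((b $ 1 - a $ 1) * (b $ 2 - a $ 2))"
proof -
  have "emeasure lborel (cbox a b) = ennreal (measure lborel (cbox a b))"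
    using emeasure_lborel_cbox_finite[of a b] by (intro emeasure_eq_ennreal_measure) (auto simp: less_top)
  also have "measure lborel (cbox a b) = (\<Prod>i\<in>UNIV. b $ i - a $ i)"
    using assms by (intro content_cbox_cart) (auto simp: interval_ne_empty_cart)
  finally show ?thesis by (simp add: UNIV_2)
qed

lemma emeasure_unit_square: "emeasure lborel unit_square = 1"
  unfolding unit_square_def by (subst emeasure_plane_box) auto

definition near :: "real \<Rightarrow> (plane \<times> plane) set" where
  "near v = {(x, z). x \<in> unit_square \<and> z \<in> unit_square \<and> norm (x - z) \<le> 2 * v}"

lemma pred_near [measurable (raw)]:
  assumes [measurable]: "f \<in> borel_measurable M" "g \<in> borel_measurable M" "h \<in> borel_measurable M"
  shows "Measurable.pred M (\<lambda>\<omega>. (f \<omega>, g \<omega>) \<in> near (h \<omega>))"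
  unfolding near_def by simp

text \<open>
  An increment over \<open>y\<close> with \<open>norm y < u\<close> is split at a point \<open>z\<close> of the square near \<open>x\<close>.
  Averaging over \<open>z\<close> bounds every such increment, hence their supremum, by one double integral.
\<close>

lemma increment_integral_le:
  fixes f :: "plane \<Rightarrow> real"
  assumes [measurable]: "f \<in> borel_measurable borel" and p: "1 \<le> p" and u: "0 < u" and y: "norm y < u"
  shows "increment_integral p f y \<le> ennreal (8 * 2 powr p / (min u 1)\<^sup>2) *
    (\<integral>\<^sup>+x. \<integral>\<^sup>+z. indicator (near (min u 1)) (x, z) * ennreal (\<bar>f x - f z\<bar> powr p) \<partial>lborel \<partial>lborel)"
proof -
  define v where "v = min u 1"
  have v: "0 < v" "v \<le> 1" using u by (auto simp: v_def)
  define w where "w x = (\<integral>\<^sup>+z. indicator (near v) (x, z) * ennreal (\<bar>f x - f z\<bar> powr p) \<partial>lborel)" for x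
  have indm: "(\<lambda>(x, z). indicator (near v) (x, z) :: ennreal) \<in> borel_measurable (lborel \<Otimes>\<^sub>M lborel)"
    unfolding indicator_def by measurable
  have wm [measurable]: "w \<in> borel_measurable borel"
  proof -
    have "(\<lambda>(x, z). indicator (near v) (x, z) * ennreal (\<bar>f x - f z\<bar> powr p)) \<in> borel_measurable (lborel \<Otimes>\<^sub>M lborel)"
      using indm by measurable
    from lborel.borel_measurable_nn_integral[OF this] show ?thesis by (simp add: w_def[abs_def])
  qed
  have key: "ennreal (\<bar>increment f y x\<bar> powr p) * ennreal ((v / 2)\<^sup>2) \<le> ennreal (2 powr p) * (w (x + y) + w x)"
    if x: "x \<in> unit_square" for x
  proof (cases "x + y \<in> unit_square")
    case False
    then show ?thesis using p by (simp add: increment_def)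
  next
    case True
    \<comment> \<open>A square of side \<open>v / 2\<close> inside the unit square, with \<open>x\<close> as the corner from which it extends inwards.\<close>
    define c :: plane where "c = (\<chi> i. if x $ i \<le> 1 / 2 then x $ i else x $ i - v / 2)"
    define A where "A = cbox c (c + (\<chi> i. v / 2))"
    have A: "emeasure lborel A = ennreal ((v / 2)\<^sup>2)"
      unfolding A_def using v by (subst emeasure_plane_box) (auto simp: power2_eq_square)
    have zA: "z \<in> unit_square \<and> norm (x - z) \<le> v" if "z \<in> A" for z
    proof -
      have c: "c $ i \<le> z $ i \<and> z $ i \<le> c $ i + v / 2" for i
        using that by (auto simp: A_def mem_box_cart)
      have x01: "0 \<le> x $ i \<and> x $ i \<le> 1" for i using x by (simp add: mem_unit_square)
      have z: "0 \<le> z $ i \<and> z $ i \<le> 1 \<and> \<bar>x $ i - z $ i\<bar> \<le> v / 2" for i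
        using c[of i] x01[of i] v by (auto simp: c_def split: if_splits)
      have "norm (x - z) \<le> \<bar>(x - z) $ 1\<bar> + \<bar>(x - z) $ 2\<bar>" by (rule norm_le_abs_sum)
      also have "\<dots> \<le> v" using z[of 1] z[of 2] by simp
      finally show ?thesis using z by (simp add: mem_unit_square)
    qed
    have n1: "(x, z) \<in> near v" if "z \<in> A" for z
      using zA[OF that] x v by (auto simp: near_def)
    have n2: "(x + y, z) \<in> near v" if "z \<in> A" for z
    proof -
      have "norm (x + y - z) \<le> 2 * v"
      proof (cases "u \<le> 1")
        case True
        then show ?thesis using norm_triangle_ineq[of "x - z" y] zA[OF that] y by (simp add: v_def algebra_simps)
      next
        case False
        have "0 \<le> (x + y) $ i \<and> (x + y) $ i \<le> 1" "0 \<le> z $ i \<and> z $ i \<le> 1" for i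
          using True zA[OF that] by (simp_all only: mem_unit_square)
        then have b: "\<bar>(x + y - z) $ i\<bar> \<le> 1" for i by (smt (verit) vector_minus_component)
        show ?thesis
          using b[of 1] b[of 2] norm_le_abs_sum[of "x + y - z"] False by (simp add: v_def)
      qed
      then show ?thesis using zA[OF that] True by (auto simp: near_def)
    qed
    have inc: "\<bar>increment f y x\<bar> = \<bar>f (x + y) - f x\<bar>"
      using x True by (simp add: increment_def)
    have split: "ennreal (\<bar>f (x + y) - f x\<bar> powr p) \<le>
        ennreal (2 powr p) * (ennreal (\<bar>f (x + y) - f z\<bar> powr p) + ennreal (\<bar>f x - f z\<bar> powr p))" for z
    proof -
      let ?a = "\<bar>f (x + y) - f z\<bar>" and ?b = "\<bar>f x - f z\<bar>"
      have "\<bar>f (x + y) - f x\<bar> powr p \<le> (2 * max ?a ?b) powr p"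
      proof (intro powr_mono2)
        show "\<bar>f (x + y) - f x\<bar> \<le> 2 * max ?a ?b" by (smt (verit) max.cobounded1 max.cobounded2)
      qed (use p in auto)
      also have "\<dots> = 2 powr p * max ?a ?b powr p" by (simp add: powr_mult)
      also have "max ?a ?b powr p \<le> ?a powr p + ?b powr p" by (auto simp: max_def)
      finally show ?thesis
        by (simp add: ennreal_mult[symmetric] ennreal_plus[symmetric] ennreal_leI del: ennreal_plus)
    qed
    have "ennreal (\<bar>increment f y x\<bar> powr p) * ennreal ((v / 2)\<^sup>2) =
        (\<integral>\<^sup>+z. ennreal (\<bar>f (x + y) - f x\<bar> powr p) * indicator A z \<partial>lborel)"
      unfolding A[symmetric] inc by (subst nn_integral_cmult_indicator) (auto simp: A_def)
    also have "\<dots> \<le> (\<integral>\<^sup>+z. ennreal (2 powr p) * (indicator (near v) (x + y, z) * ennreal (\<bar>f (x + y) - f z\<bar> powr p) +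
        indicator (near v) (x, z) * ennreal (\<bar>f x - f z\<bar> powr p)) \<partial>lborel)"
    proof (rule nn_integral_mono)
      fix z
      show "ennreal (\<bar>f (x + y) - f x\<bar> powr p) * indicator A z \<le>
          ennreal (2 powr p) * (indicator (near v) (x + y, z) * ennreal (\<bar>f (x + y) - f z\<bar> powr p) +
          indicator (near v) (x, z) * ennreal (\<bar>f x - f z\<bar> powr p))"
        using split[of z] n1[of z] n2[of z] by (cases "z \<in> A") auto
    qed
    also have "\<dots> = ennreal (2 powr p) * (w (x + y) + w x)"
      unfolding w_def using indm by (subst nn_integral_cmult, measurable, subst nn_integral_add, measurable)
    finally show ?thesis .
  qed
  have "increment_integral p f y * ennreal ((v / 2)\<^sup>2) =
      (\<integral>\<^sup>+x. ennreal (\<bar>increment f y x\<bar> powr p) * indicator unit_square x * ennreal ((v / 2)\<^sup>2) \<partial>lborel)"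
    unfolding increment_integral_def increment_def by (subst nn_integral_multc) auto
  also have "\<dots> \<le> (\<integral>\<^sup>+x. ennreal (2 powr p) * (w (x + y) + w x) \<partial>lborel)"
    using key by (intro nn_integral_mono) (auto split: split_indicator)
  also have "\<dots> = ennreal (2 powr p) * ((\<integral>\<^sup>+x. w (x + y) \<partial>lborel) + (\<integral>\<^sup>+x. w x \<partial>lborel))"
    by (subst nn_integral_cmult, measurable, subst nn_integral_add, measurable)
  also have "(\<integral>\<^sup>+x. w (x + y) \<partial>lborel) = (\<integral>\<^sup>+x. w x \<partial>lborel)"
    by (rule nn_integral_lborel_translate) measurable
  finally have le: "increment_integral p f y * ennreal ((v / 2)\<^sup>2) \<le> ennreal (2 powr p) * (2 * (\<integral>\<^sup>+x. w x \<partial>lborel))"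
    by (simp add: mult_2)
  have "increment_integral p f y = increment_integral p f y * ennreal ((v / 2)\<^sup>2) * ennreal (4 / v\<^sup>2)"
    using v by (simp add: mult.assoc ennreal_mult[symmetric] power_divide)
  also have "\<dots> \<le> ennreal (2 powr p) * (2 * (\<integral>\<^sup>+x. w x \<partial>lborel)) * ennreal (4 / v\<^sup>2)"
    using le by (rule mult_right_mono) simp
  also have "\<dots> = ennreal (8 * 2 powr p / v\<^sup>2) * (\<integral>\<^sup>+x. w x \<partial>lborel)"
  proof -
    have "ennreal (8 * 2 powr p / v\<^sup>2) = ennreal (2 powr p) * 2 * ennreal (4 / v\<^sup>2)"
      by (simp add: ennreal_mult[symmetric] flip: ennreal_numeral)
    then show ?thesis by (simp add: mult_ac)
  qed
  finally show ?thesis by (simp add: w_def v_def)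
qed

lemma nn_integral_powr_near_0:
  fixes e :: real
  assumes "- 1 < e"
  shows "(\<integral>\<^sup>+u. ennreal (u powr e) * indicator {0..1} u \<partial>lborel) = ennreal (1 / (e + 1))"
  using nn_integral_has_integral_lebesgue'[OF _ has_integral_powr_from_0[of e 1]] assms by simp

lemma nn_integral_powr_near_inf:
  fixes e :: real
  assumes "e < - 1"
  shows "(\<integral>\<^sup>+u. ennreal (u powr e) * indicator {1..} u \<partial>lborel) = ennreal (- 1 / (e + 1))"
  using nn_integral_has_integral_lebesgue'[OF _ has_integral_powr_to_inf[of e 1]] assms by simp

lemma nn_integral_inverse_near_0: "(\<integral>\<^sup>+u. ennreal (1 / u) * indicator {0<..1} u \<partial>lborel) = \<infinity>"
proof (rule ccontr)
  let ?I = "\<integral>\<^sup>+u. ennreal (1 / u) * indicator {0<..1} u \<partial>lborel"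
  assume "?I \<noteq> \<infinity>"
  then obtain r where r: "?I = ennreal r" "0 \<le> r" by (cases ?I) auto
  obtain n :: nat where n: "r < real n" using reals_Archimedean2 by blast
  let ?a = "exp (- real n)"
  have "ennreal (ln 1 - ln ?a) = (\<integral>\<^sup>+u. ennreal (1 / u) * indicator {?a..1} u \<partial>lborel)"
  proof (rule nn_integral_FTC_Icc[symmetric])
    fix u assume "u \<in> {?a..1}"
    then have "0 < u" using exp_gt_zero[of "- real n"] unfolding atLeastAtMost_iff by linarith
    then show "DERIV ln u :> 1 / u"
      by (auto intro!: derivative_eq_intros)
    show "0 \<le> 1 / u" using \<open>0 < u\<close> by simp
  qed (auto simp: borel_measurable_divide)
  also have "\<dots> \<le> ?I"
  proof (rule nn_integral_mono)
    fix u :: real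
    have "0 < u" if "?a \<le> u" using that exp_gt_zero[of "- real n"] by linarith
    then show "ennreal (1 / u) * indicator {?a..1} u \<le> ennreal (1 / u) * indicator {0<..1} u"
      by (auto split: split_indicator)
  qed
  finally show False using n r by simp
qed

context
  fixes \<Omega> :: "'w measure" and f :: "'w \<Rightarrow> plane \<Rightarrow> real" and p s \<beta> :: real
  assumes \<Omega>: "prob_space \<Omega>" and joint: "(\<lambda>(\<omega>, x). f \<omega> x) \<in> borel_measurable (\<Omega> \<Otimes>\<^sub>M borel)"
    and p: "1 \<le> p" and s: "0 < s" and \<beta>: "0 < \<beta>"
begin

lemma field_compose [measurable (raw)]:
  assumes "g \<in> measurable N \<Omega>" "h \<in> borel_measurable N"
  shows "(\<lambda>n. f (g n) (h n)) \<in> borel_measurable N"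
  using measurable_compose[OF measurable_Pair[OF assms] joint] by simp

lemma borel_measurable_indicator_near [measurable (raw)]:
  assumes [measurable]: "g \<in> borel_measurable N" "h \<in> borel_measurable N" "v \<in> borel_measurable N"
  shows "(\<lambda>n. indicator (near (v n)) (g n, h n) :: ennreal) \<in> borel_measurable N"
  unfolding indicator_def by measurable

definition near_energy :: "'w \<Rightarrow> real \<Rightarrow> ennreal" where
  "near_energy \<omega> v = (\<integral>\<^sup>+x. \<integral>\<^sup>+z. indicator (near v) (x, z) * ennreal (\<bar>f \<omega> x - f \<omega> z\<bar> powr p) \<partial>lborel \<partial>lborel)"

lemma near_energy_measurable [measurable (raw)]:
  assumes [measurable]: "g \<in> measurable N \<Omega>" "v \<in> borel_measurable N"
  shows "(\<lambda>n. near_energy (g n) (v n)) \<in> borel_measurable N"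
  unfolding near_energy_def by measurable

text \<open>
  The pairs of points of the square at distance at most \<open>2 * v\<close> have measure at most of order \<open>v\<^sup>2\<close>.
\<close>

lemma expectation_near_energy_le:
  assumes K: "0 \<le> K" and v: "0 < v" "v \<le> 1"
    and le: "\<And>x y. x \<in> unit_square \<Longrightarrow> y \<in> unit_square \<Longrightarrow>
      (\<integral>\<^sup>+\<omega>. ennreal (\<bar>f \<omega> x - f \<omega> y\<bar> powr p) \<partial>\<Omega>) \<le> ennreal (K * norm (x - y) powr \<beta>)"
  shows "(\<integral>\<^sup>+\<omega>. near_energy \<omega> v \<partial>\<Omega>) \<le> ennreal (16 * K * 2 powr \<beta> * (v powr \<beta> * v\<^sup>2))"
proof -
  interpret prob_space \<Omega> by (rule \<Omega>)
  interpret pair_sigma_finite \<Omega> "lborel :: plane measure" ..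
  define c :: plane where "c = (\<chi> i. 2 * v)"
  have "(\<integral>\<^sup>+\<omega>. near_energy \<omega> v \<partial>\<Omega>) =
      (\<integral>\<^sup>+x. \<integral>\<^sup>+\<omega>. \<integral>\<^sup>+z. indicator (near v) (x, z) * ennreal (\<bar>f \<omega> x - f \<omega> z\<bar> powr p) \<partial>lborel \<partial>\<Omega> \<partial>lborel)"
    unfolding near_energy_def by (rule Fubini'[symmetric]) measurable
  also have "\<dots> = (\<integral>\<^sup>+x. \<integral>\<^sup>+z. \<integral>\<^sup>+\<omega>. indicator (near v) (x, z) * ennreal (\<bar>f \<omega> x - f \<omega> z\<bar> powr p) \<partial>\<Omega> \<partial>lborel \<partial>lborel)"
    by (intro nn_integral_cong Fubini'[symmetric]) measurable
  also have "\<dots> \<le> (\<integral>\<^sup>+x. \<integral>\<^sup>+z. ennreal (K * (2 * v) powr \<beta>) * indicator unit_square x * indicator (cbox (x - c) (x + c)) z \<partial>lborel \<partial>lborel)"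
  proof (intro nn_integral_mono)
    fix x z :: plane
    show "(\<integral>\<^sup>+\<omega>. indicator (near v) (x, z) * ennreal (\<bar>f \<omega> x - f \<omega> z\<bar> powr p) \<partial>\<Omega>) \<le>
        ennreal (K * (2 * v) powr \<beta>) * indicator unit_square x * indicator (cbox (x - c) (x + c)) z"
    proof (cases "(x, z) \<in> near v")
      case True
      then have xz: "x \<in> unit_square" "z \<in> unit_square" "norm (x - z) \<le> 2 * v" by (auto simp: near_def)
      have "\<bar>(x - z) $ i\<bar> \<le> 2 * v" for i using component_le_norm_cart[of "x - z" i] xz(3) by linarith
      then have "z \<in> cbox (x - c) (x + c)" by (auto simp: mem_box_cart c_def abs_le_iff algebra_simps)
      moreover have "K * norm (x - z) powr \<beta> \<le> K * (2 * v) powr \<beta>"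
        using K xz \<beta> by (intro mult_left_mono powr_mono2) auto
      ultimately show ?thesis using True xz le[OF xz(1,2)] by (auto intro: order_trans ennreal_leI)
    qed simp
  qed
  also have "\<dots> = (\<integral>\<^sup>+x. ennreal (K * (2 * v) powr \<beta>) * indicator unit_square x * ennreal (16 * v\<^sup>2) \<partial>(lborel :: plane measure))"
  proof (rule nn_integral_cong)
    fix x :: plane
    have "emeasure lborel (cbox (x - c) (x + c)) = ennreal (16 * v\<^sup>2)"
      using v by (subst emeasure_plane_box) (auto simp: c_def power2_eq_square)
    then show "(\<integral>\<^sup>+z. ennreal (K * (2 * v) powr \<beta>) * indicator unit_square x * indicator (cbox (x - c) (x + c)) z \<partial>lborel) =
        ennreal (K * (2 * v) powr \<beta>) * indicator unit_square x * ennreal (16 * v\<^sup>2)"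
      by (subst nn_integral_cmult_indicator) auto
  qed
  also have "\<dots> = ennreal (K * (2 * v) powr \<beta>) * ennreal (16 * v\<^sup>2)"
    by (subst nn_integral_multc, measurable, subst nn_integral_cmult_indicator) (auto simp: emeasure_unit_square)
  also have "\<dots> = ennreal (16 * K * 2 powr \<beta> * (v powr \<beta> * v\<^sup>2))"
    using K v by (simp add: ennreal_mult[symmetric] powr_mult mult_ac)
  finally show ?thesis .
qed

lemma epowr_besov_norm_le:
  assumes "\<omega> \<in> space \<Omega>"
  shows "epowr (besov_norm s p p (f \<omega>)) p \<le> ennreal (2 powr p) *
    ((\<integral>\<^sup>+x\<in>unit_square. ennreal (\<bar>f \<omega> x\<bar> powr p) \<partial>lborel) +
     (\<integral>\<^sup>+u\<in>{0<..}. ennreal (8 * 2 powr p / (min u 1)\<^sup>2 * u powr (- (s * p) - 1)) * near_energy \<omega> (min u 1) \<partial>lborel))"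
proof -
  have fm: "f \<omega> \<in> borel_measurable borel"
    using assms by measurable
  have *: "epowr (modulus p (f \<omega>) u * ennreal (u powr (- s))) p * ennreal (1 / u) \<le>
      ennreal (8 * 2 powr p / (min u 1)\<^sup>2 * u powr (- (s * p) - 1)) * near_energy \<omega> (min u 1)" if "0 < u" for u
  proof -
    have m: "epowr (modulus p (f \<omega>) u) p \<le> ennreal (8 * 2 powr p / (min u 1)\<^sup>2) * near_energy \<omega> (min u 1)"
      unfolding near_energy_def using p that by (intro epowr_modulus_le increment_integral_le fm) auto
    have "epowr (modulus p (f \<omega>) u * ennreal (u powr (- s))) p * ennreal (1 / u) =
        epowr (modulus p (f \<omega>) u) p * ennreal ((u powr (- s)) powr p * (1 / u))"
      using p that by (subst epowr_mult) (auto simp: ennreal_mult[symmetric] mult.assoc)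
    also have "(u powr (- s)) powr p * (1 / u) = u powr (- (s * p) - 1)"
      using that by (simp add: powr_powr powr_diff)
    also have "epowr (modulus p (f \<omega>) u) p * ennreal (u powr (- (s * p) - 1)) \<le>
        ennreal (8 * 2 powr p / (min u 1)\<^sup>2) * near_energy \<omega> (min u 1) * ennreal (u powr (- (s * p) - 1))"
      by (intro mult_right_mono m) auto
    also have "\<dots> = ennreal (8 * 2 powr p / (min u 1)\<^sup>2 * u powr (- (s * p) - 1)) * near_energy \<omega> (min u 1)"
      by (subst ennreal_mult) (auto simp: mult_ac)
    finally show ?thesis .
  qed
  let ?B = "\<integral>\<^sup>+u\<in>{0<..}. epowr (modulus p (f \<omega>) u * ennreal (u powr (- s))) p * ennreal (1 / u) \<partial>lborel"
  have "epowr (besov_norm s p p (f \<omega>)) p \<le> ennreal (2 powr p) * (epowr (Lp_norm p (f \<omega>)) p + epowr (epowr ?B (1 / p)) p)"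
    unfolding besov_norm_def using p by (intro epowr_add_le) auto
  also have "epowr (Lp_norm p (f \<omega>)) p = (\<integral>\<^sup>+x\<in>unit_square. ennreal (\<bar>f \<omega> x\<bar> powr p) \<partial>lborel)"
    unfolding Lp_norm_def using p by (simp add: epowr_epowr_inverse)
  also have "epowr (epowr ?B (1 / p)) p = ?B" using p by (simp add: epowr_epowr_inverse)
  also have "?B \<le> (\<integral>\<^sup>+u\<in>{0<..}. ennreal (8 * 2 powr p / (min u 1)\<^sup>2 * u powr (- (s * p) - 1)) * near_energy \<omega> (min u 1) \<partial>lborel)"
    using * by (intro nn_integral_mono) (auto split: split_indicator)
  finally show ?thesis by (simp add: add_left_mono mult_left_mono)
qed

text \<open>
  The increments up to length \<open>u\<close> contribute at most a multiple of \<open>u powr (\<beta> - s * p - 1)\<close> for small \<open>u\<close>, which is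
  integrable at \<open>0\<close>; for large \<open>u\<close> they are bounded.
\<close>

lemma besov_moment_finite:
  assumes range: "\<And>x. AE \<omega> in \<Omega>. \<bar>f \<omega> x\<bar> \<le> 1" and K: "0 \<le> K" and sp: "s * p < \<beta>"
    and le: "\<And>x y. x \<in> unit_square \<Longrightarrow> y \<in> unit_square \<Longrightarrow>
      (\<integral>\<^sup>+\<omega>. ennreal (\<bar>f \<omega> x - f \<omega> y\<bar> powr p) \<partial>\<Omega>) \<le> ennreal (K * norm (x - y) powr \<beta>)"
  shows "(\<integral>\<^sup>+\<omega>. epowr (besov_norm s p p (f \<omega>)) p \<partial>\<Omega>) < \<infinity>"
proof -
  interpret prob_space \<Omega> by (rule \<Omega>)
  interpret PL: pair_sigma_finite \<Omega> "lborel :: plane measure" ..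
  interpret RL: pair_sigma_finite \<Omega> "lborel :: real measure" ..
  define C where "C = 8 * 2 powr p * (16 * K * 2 powr \<beta>)"
  have C: "0 \<le> C" using K by (simp add: C_def)
  let ?N = "\<lambda>\<omega>. \<integral>\<^sup>+x\<in>unit_square. ennreal (\<bar>f \<omega> x\<bar> powr p) \<partial>lborel"
  let ?H = "\<lambda>\<omega>. \<integral>\<^sup>+u\<in>{0<..}. ennreal (8 * 2 powr p / (min u 1)\<^sup>2 * u powr (- (s * p) - 1)) * near_energy \<omega> (min u 1) \<partial>lborel"
  have N: "(\<integral>\<^sup>+\<omega>. ?N \<omega> \<partial>\<Omega>) \<le> 1"
  proof -
    have "(\<integral>\<^sup>+\<omega>. ?N \<omega> \<partial>\<Omega>) = (\<integral>\<^sup>+x. \<integral>\<^sup>+\<omega>. ennreal (\<bar>f \<omega> x\<bar> powr p) * indicator unit_square x \<partial>\<Omega> \<partial>lborel)"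
      by (rule PL.Fubini'[symmetric]) measurable
    also have "\<dots> \<le> (\<integral>\<^sup>+x. indicator unit_square x \<partial>(lborel :: plane measure))"
    proof (rule nn_integral_mono)
      fix x :: plane
      have "(\<integral>\<^sup>+\<omega>. ennreal (\<bar>f \<omega> x\<bar> powr p) * indicator unit_square x \<partial>\<Omega>) \<le> (\<integral>\<^sup>+\<omega>. indicator unit_square x \<partial>\<Omega>)"
      proof (rule nn_integral_mono_AE)
        show "AE \<omega> in \<Omega>. ennreal (\<bar>f \<omega> x\<bar> powr p) * indicator unit_square x \<le> indicator unit_square x"
          using range[of x] by eventually_elim (use p in \<open>auto split: split_indicator intro!: powr_le1\<close>)
      qed
      then show "(\<integral>\<^sup>+\<omega>. ennreal (\<bar>f \<omega> x\<bar> powr p) * indicator unit_square x \<partial>\<Omega>) \<le> indicator unit_square x"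
        by (simp add: emeasure_space_1)
    qed
    also have "\<dots> = 1" by (simp add: emeasure_unit_square)
    finally show ?thesis .
  qed
  have H: "(\<integral>\<^sup>+\<omega>. ?H \<omega> \<partial>\<Omega>) < \<infinity>"
  proof -
    have "(\<integral>\<^sup>+\<omega>. ?H \<omega> \<partial>\<Omega>) = (\<integral>\<^sup>+u. \<integral>\<^sup>+\<omega>. ennreal (8 * 2 powr p / (min u 1)\<^sup>2 * u powr (- (s * p) - 1)) *
        near_energy \<omega> (min u 1) * indicator {0<..} u \<partial>\<Omega> \<partial>lborel)"
      by (rule RL.Fubini'[symmetric]) measurable
    also have "\<dots> \<le> (\<integral>\<^sup>+u. ennreal C * (ennreal (u powr (\<beta> - s * p - 1)) * indicator {0..1} u +
        ennreal (u powr (- (s * p) - 1)) * indicator {1..} u) \<partial>lborel)"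
    proof (rule nn_integral_mono)
      fix u :: real
      show "(\<integral>\<^sup>+\<omega>. ennreal (8 * 2 powr p / (min u 1)\<^sup>2 * u powr (- (s * p) - 1)) *
          near_energy \<omega> (min u 1) * indicator {0<..} u \<partial>\<Omega>) \<le> ennreal C * (ennreal (u powr (\<beta> - s * p - 1)) * indicator {0..1} u +
          ennreal (u powr (- (s * p) - 1)) * indicator {1..} u)"
      proof (cases "0 < u")
        case True
        let ?c = "8 * 2 powr p / (min u 1)\<^sup>2 * u powr (- (s * p) - 1)"
        have "(\<integral>\<^sup>+\<omega>. ennreal ?c * near_energy \<omega> (min u 1) * indicator {0<..} u \<partial>\<Omega>) =
            ennreal ?c * (\<integral>\<^sup>+\<omega>. near_energy \<omega> (min u 1) \<partial>\<Omega>)"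
          using True by (simp add: nn_integral_cmult)
        also have "\<dots> \<le> ennreal ?c * ennreal (16 * K * 2 powr \<beta> * ((min u 1) powr \<beta> * (min u 1)\<^sup>2))"
          using True K by (intro mult_left_mono expectation_near_energy_le le) auto
        also have "\<dots> = ennreal (C * ((min u 1) powr \<beta> * u powr (- (s * p) - 1)))"
          using True K by (subst ennreal_mult[symmetric]) (auto simp: C_def field_simps)
        also have "\<dots> \<le> ennreal C * (ennreal (u powr (\<beta> - s * p - 1)) * indicator {0..1} u +
            ennreal (u powr (- (s * p) - 1)) * indicator {1..} u)"
        proof (cases "u \<le> 1")
          case u1: True
          have "(min u 1) powr \<beta> * u powr (- (s * p) - 1) = u powr (\<beta> - s * p - 1)"
            using u1 by (simp add: min_def powr_add[symmetric] algebra_simps)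
          then show ?thesis
            using u1 True C by (simp add: ennreal_mult distrib_left add_increasing2)
        next
          case False
          then show ?thesis using C by (simp add: ennreal_mult)
        qed
        finally show ?thesis .
      qed simp
    qed
    also have "\<dots> = ennreal C * (\<integral>\<^sup>+u. ennreal (u powr (\<beta> - s * p - 1)) * indicator {0..1} u +
        ennreal (u powr (- (s * p) - 1)) * indicator {1..} u \<partial>lborel)"
      by (rule nn_integral_cmult) measurable
    also have "(\<integral>\<^sup>+u. ennreal (u powr (\<beta> - s * p - 1)) * indicator {0..1} u + ennreal (u powr (- (s * p) - 1)) * indicator {1..} u \<partial>lborel) =
        (\<integral>\<^sup>+u. ennreal (u powr (\<beta> - s * p - 1)) * indicator {0..1} u \<partial>lborel) +
        (\<integral>\<^sup>+u. ennreal (u powr (- (s * p) - 1)) * indicator {1..} u \<partial>lborel)"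
      by (rule nn_integral_add) measurable
    finally have HC: "(\<integral>\<^sup>+\<omega>. ?H \<omega> \<partial>\<Omega>) \<le> ennreal C * ((\<integral>\<^sup>+u. ennreal (u powr (\<beta> - s * p - 1)) * indicator {0..1} u \<partial>lborel) +
        (\<integral>\<^sup>+u. ennreal (u powr (- (s * p) - 1)) * indicator {1..} u \<partial>lborel))" (is "_ \<le> ennreal C * ?R") .
    have "?R < \<infinity>"
    proof -
      have "- 1 < \<beta> - s * p - 1" "- (s * p) - 1 < - 1" using sp s p by simp_all
      then show ?thesis by (simp only: nn_integral_powr_near_0 nn_integral_powr_near_inf) simp
    qed
    then have "ennreal C * ?R < \<infinity>" by (simp add: ennreal_mult_less_top)
    with HC show ?thesis by (rule le_less_trans)
  qed
  have "(\<integral>\<^sup>+\<omega>. epowr (besov_norm s p p (f \<omega>)) p \<partial>\<Omega>) \<le> (\<integral>\<^sup>+\<omega>. ennreal (2 powr p) * (?N \<omega> + ?H \<omega>) \<partial>\<Omega>)"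
    by (intro nn_integral_mono epowr_besov_norm_le)
  also have "\<dots> = ennreal (2 powr p) * ((\<integral>\<^sup>+\<omega>. ?N \<omega> \<partial>\<Omega>) + (\<integral>\<^sup>+\<omega>. ?H \<omega> \<partial>\<Omega>))"
    by (subst nn_integral_cmult, measurable, subst nn_integral_add, measurable)
  also have "\<dots> < \<infinity>"
    using N H by (auto simp: ennreal_mult_less_top intro: le_less_trans)
  finally show ?thesis .
qed

text \<open>
  For the converse the supremum is bounded below by the average of the increments over a square of
  vectors \<open>y\<close> with \<open>u / 4 \<le> norm y < u\<close>. Its side is \<open>u / 3 - u / 4 = u / 12\<close>.
\<close>

lemma epowr_modulus_ge_average:
  assumes \<omega>: "\<omega> \<in> space \<Omega>" and u: "0 < u" "u \<le> 1"
  shows "ennreal (144 / u\<^sup>2) * (\<integral>\<^sup>+y. \<integral>\<^sup>+x. indicator (cbox (\<chi> i. u / 4) (\<chi> i. u / 3)) y *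
      indicator (cbox 0 (\<chi> i. 1 / 2)) x * ennreal (\<bar>f \<omega> (x + y) - f \<omega> x\<bar> powr p) \<partial>lborel \<partial>lborel)
    \<le> epowr (modulus p (f \<omega>) u) p"
proof -
  define S :: "plane set" where "S = cbox (\<chi> i. u / 4) (\<chi> i. u / 3)"
  define m where "m = epowr (modulus p (f \<omega>) u) p"
  have S: "emeasure lborel S = ennreal (u\<^sup>2 / 144)"
    unfolding S_def using u by (subst emeasure_plane_box) (auto simp: power2_eq_square)
  have "(\<integral>\<^sup>+y. \<integral>\<^sup>+x. indicator S y * indicator (cbox 0 (\<chi> i. 1 / 2)) x * ennreal (\<bar>f \<omega> (x + y) - f \<omega> x\<bar> powr p) \<partial>lborel \<partial>lborel)
      \<le> (\<integral>\<^sup>+y. m * indicator S y \<partial>(lborel :: plane measure))"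
  proof (rule nn_integral_mono)
    fix y :: plane
    show "(\<integral>\<^sup>+x. indicator S y * indicator (cbox 0 (\<chi> i. 1 / 2)) x * ennreal (\<bar>f \<omega> (x + y) - f \<omega> x\<bar> powr p) \<partial>lborel) \<le> m * indicator S y"
    proof (cases "y \<in> S")
      case True
      then have y: "u / 4 \<le> y $ i \<and> y $ i \<le> u / 3" for i by (auto simp: S_def mem_box_cart)
      have "norm y < u" using norm_le_abs_sum[of y] y[of 1] y[of 2] u by auto
      then have "increment_integral p (f \<omega>) y \<le> m"
        unfolding m_def using p by (intro epowr_modulus_ge) auto
      moreover have "(\<integral>\<^sup>+x. indicator (cbox 0 (\<chi> i. 1 / 2)) x * ennreal (\<bar>f \<omega> (x + y) - f \<omega> x\<bar> powr p) \<partial>lborel)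
          \<le> increment_integral p (f \<omega>) y"
        unfolding increment_integral_def
      proof (rule nn_integral_mono)
        fix x :: plane
        have "x \<in> unit_square \<and> x + y \<in> unit_square" if "x \<in> cbox 0 (\<chi> i. 1 / 2)"
        proof -
          have x: "0 \<le> x $ i \<and> x $ i \<le> 1 / 2" for i using that by (simp add: mem_box_cart)
          have "0 \<le> x $ i" "x $ i \<le> 1" "0 \<le> x $ i + y $ i" "x $ i + y $ i \<le> 1" for i
            using x[of i] y[of i] u by linarith+
          then show ?thesis by (simp add: mem_unit_square)
        qed
        then show "indicator (cbox 0 (\<chi> i. 1 / 2)) x * ennreal (\<bar>f \<omega> (x + y) - f \<omega> x\<bar> powr p) \<le>
            ennreal (\<bar>increment (f \<omega>) y x\<bar> powr p) * indicator unit_square x"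
          by (auto simp: increment_def split: split_indicator)
      qed
      ultimately show ?thesis using True by simp
    qed simp
  qed
  also have "\<dots> = m * ennreal (u\<^sup>2 / 144)"
    unfolding S[symmetric] by (rule nn_integral_cmult_indicator) (simp add: S_def)
  finally have "ennreal (144 / u\<^sup>2) * (\<integral>\<^sup>+y. \<integral>\<^sup>+x. indicator S y * indicator (cbox 0 (\<chi> i. 1 / 2)) x *
      ennreal (\<bar>f \<omega> (x + y) - f \<omega> x\<bar> powr p) \<partial>lborel \<partial>lborel) \<le> ennreal (144 / u\<^sup>2) * (m * ennreal (u\<^sup>2 / 144))"
    by (rule mult_left_mono) simp
  also have "\<dots> = m * (ennreal (144 / u\<^sup>2) * ennreal (u\<^sup>2 / 144))" by (simp add: mult_ac)
  also have "ennreal (144 / u\<^sup>2) * ennreal (u\<^sup>2 / 144) = 1" using u by (simp add: ennreal_mult[symmetric])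
  finally show ?thesis by (simp add: S_def m_def)
qed

text \<open>
  The increments up to length \<open>u\<close> now contribute at least a multiple of \<open>1 / u\<close> near \<open>0\<close>.
\<close>

lemma besov_moment_infinite:
  assumes k: "0 < k" and sp: "\<beta> \<le> s * p"
    and ge: "\<And>x y. x \<in> unit_square \<Longrightarrow> y \<in> unit_square \<Longrightarrow>
      ennreal (k * norm (x - y) powr \<beta>) \<le> (\<integral>\<^sup>+\<omega>. ennreal (\<bar>f \<omega> x - f \<omega> y\<bar> powr p) \<partial>\<Omega>)"
  shows "(\<integral>\<^sup>+\<omega>. epowr (besov_norm s p p (f \<omega>)) p \<partial>\<Omega>) = \<infinity>"
proof -
  interpret prob_space \<Omega> by (rule \<Omega>)
  interpret PL: pair_sigma_finite \<Omega> "lborel :: plane measure" ..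
  interpret RL: pair_sigma_finite \<Omega> "lborel :: real measure" ..
  define S :: "real \<Rightarrow> plane set" where "S u = cbox (\<chi> i. u / 4) (\<chi> i. u / 3)" for u
  define T :: "plane set" where "T = cbox 0 (\<chi> i. 1 / 2)"
  define A where "A \<omega> u = (\<integral>\<^sup>+y. \<integral>\<^sup>+x. indicator (S u) y * indicator T x * ennreal (\<bar>f \<omega> (x + y) - f \<omega> x\<bar> powr p) \<partial>lborel \<partial>lborel)" for \<omega> u
  have [measurable]: "T \<in> sets borel" by (simp add: T_def)
  have [measurable (raw)]: "(\<lambda>n. indicator (S (g n)) (h n) :: ennreal) \<in> borel_measurable N"
    if [measurable]: "g \<in> borel_measurable N" "h \<in> borel_measurable N" for g h and N :: "'n measure"
  proof -
    have [measurable]: "(\<lambda>n. h n $ i) \<in> borel_measurable N" for i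
      by (rule measurable_compose[OF that(2)]) (intro borel_measurable_continuous_onI continuous_intros)
    show ?thesis unfolding indicator_def S_def mem_box_cart forall_2 vec_lambda_beta by measurable
  qed
  have EA: "ennreal (k * (1 / 4) powr \<beta> / 576 * (u powr \<beta> * u\<^sup>2)) \<le> (\<integral>\<^sup>+\<omega>. A \<omega> u \<partial>\<Omega>)" if u: "0 < u" "u \<le> 1" for u
  proof -
    have S: "emeasure lborel (S u) = ennreal (u\<^sup>2 / 144)"
      unfolding S_def using u by (subst emeasure_plane_box) (auto simp: power2_eq_square)
    have T: "emeasure lborel T = ennreal (1 / 4)"
      unfolding T_def by (subst emeasure_plane_box) auto
    have [measurable]: "S u \<in> sets borel" by (simp add: S_def)
    have "ennreal (k * (1 / 4) powr \<beta> / 576 * (u powr \<beta> * u\<^sup>2)) =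
        ennreal (k * (u / 4) powr \<beta>) * ennreal (1 / 4) * ennreal (u\<^sup>2 / 144)"
      using k u by (simp add: ennreal_mult[symmetric] powr_divide field_simps)
    also have "\<dots> = (\<integral>\<^sup>+y. \<integral>\<^sup>+x. ennreal (k * (u / 4) powr \<beta>) * indicator (S u) y * indicator T x \<partial>(lborel :: plane measure) \<partial>lborel)"
      unfolding S[symmetric] T[symmetric]
      by (subst nn_integral_cmult_indicator, simp, subst nn_integral_multc, measurable,
          subst nn_integral_cmult_indicator) (auto simp: mult_ac)
    also have "\<dots> \<le> (\<integral>\<^sup>+y. \<integral>\<^sup>+x. \<integral>\<^sup>+\<omega>. indicator (S u) y * indicator T x * ennreal (\<bar>f \<omega> (x + y) - f \<omega> x\<bar> powr p) \<partial>\<Omega> \<partial>lborel \<partial>lborel)"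
    proof (intro nn_integral_mono)
      fix x y :: plane
      show "ennreal (k * (u / 4) powr \<beta>) * indicator (S u) y * indicator T x \<le>
          (\<integral>\<^sup>+\<omega>. indicator (S u) y * indicator T x * ennreal (\<bar>f \<omega> (x + y) - f \<omega> x\<bar> powr p) \<partial>\<Omega>)"
      proof (cases "y \<in> S u \<and> x \<in> T")
        case True
        then have y: "u / 4 \<le> y $ i \<and> y $ i \<le> u / 3" and x: "0 \<le> x $ i \<and> x $ i \<le> 1 / 2" for i
          by (auto simp: S_def T_def mem_box_cart)
        have Q: "x \<in> unit_square" "x + y \<in> unit_square"
        proof -
          have "0 \<le> x $ i" "x $ i \<le> 1" "0 \<le> x $ i + y $ i" "x $ i + y $ i \<le> 1" for i
            using x[of i] y[of i] u by linarith+
          then show "x \<in> unit_square" "x + y \<in> unit_square" by (simp_all add: mem_unit_square)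
        qed
        have "u / 4 \<le> norm (x + y - x)" using y[of 1] component_le_norm_cart[of y 1] by simp
        then have "k * (u / 4) powr \<beta> \<le> k * norm (x + y - x) powr \<beta>"
          using k u \<beta> by (intro mult_left_mono powr_mono2) auto
        then show ?thesis using True ge[OF Q(2,1)] by (auto intro: order_trans ennreal_leI)
      qed auto
    qed
    also have "\<dots> = (\<integral>\<^sup>+y. \<integral>\<^sup>+\<omega>. \<integral>\<^sup>+x. indicator (S u) y * indicator T x * ennreal (\<bar>f \<omega> (x + y) - f \<omega> x\<bar> powr p) \<partial>lborel \<partial>\<Omega> \<partial>lborel)"
      by (intro nn_integral_cong PL.Fubini') measurable
    also have "\<dots> = (\<integral>\<^sup>+\<omega>. A \<omega> u \<partial>\<Omega>)"
      unfolding A_def by (rule PL.Fubini') measurable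
    finally show ?thesis .
  qed
  have Am [measurable (raw)]: "(\<lambda>n. A (g n) (h n)) \<in> borel_measurable N"
    if [measurable]: "g \<in> measurable N \<Omega>" "h \<in> borel_measurable N" for g h and N :: "('w \<times> real) measure"
    unfolding A_def by measurable
  define c where "c = 144 * (k * (1 / 4) powr \<beta> / 576)"
  have c: "0 < c" using k by (simp add: c_def)
  have "\<infinity> = ennreal c * (\<integral>\<^sup>+u. ennreal (1 / u) * indicator {0<..1} u \<partial>lborel)"
    using c by (simp add: nn_integral_inverse_near_0 ennreal_mult_top)
  also have "\<dots> = (\<integral>\<^sup>+u. ennreal c * (ennreal (1 / u) * indicator {0<..1} u) \<partial>lborel)"
    by (rule nn_integral_cmult[symmetric]) measurable
  also have "\<dots> \<le> (\<integral>\<^sup>+u. \<integral>\<^sup>+\<omega>. indicator {0<..1} u * ennreal (144 / u\<^sup>2 * u powr (- (s * p) - 1)) * A \<omega> u \<partial>\<Omega> \<partial>lborel)"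
  proof (rule nn_integral_mono)
    fix u :: real
    show "ennreal c * (ennreal (1 / u) * indicator {0<..1} u) \<le>
        (\<integral>\<^sup>+\<omega>. indicator {0<..1} u * ennreal (144 / u\<^sup>2 * u powr (- (s * p) - 1)) * A \<omega> u \<partial>\<Omega>)"
    proof (cases "u \<in> {0<..1}")
      case True
      then have u: "0 < u" "u \<le> 1" by auto
      have [measurable]: "(\<lambda>\<omega>. A \<omega> u) \<in> borel_measurable \<Omega>" unfolding A_def by measurable
      have "1 / u = u powr (- 1)" using u by (simp add: powr_minus_divide)
      also have "\<dots> \<le> u powr (\<beta> - s * p - 1)"
        using u sp by (intro powr_mono') auto
      also have "\<dots> = u powr \<beta> * u powr (- (s * p) - 1)"
        by (simp add: powr_add[symmetric] algebra_simps)
      finally have "c * (1 / u) \<le> c * (u powr \<beta> * u powr (- (s * p) - 1))"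
        using c by (intro mult_left_mono) auto
      also have "\<dots> = 144 / u\<^sup>2 * u powr (- (s * p) - 1) * (k * (1 / 4) powr \<beta> / 576 * (u powr \<beta> * u\<^sup>2))"
        using u by (simp add: c_def)
      finally have le: "c * (1 / u) \<le> 144 / u\<^sup>2 * u powr (- (s * p) - 1) * (k * (1 / 4) powr \<beta> / 576 * (u powr \<beta> * u\<^sup>2))" .
      have "ennreal c * (ennreal (1 / u) * indicator {0<..1} u) = ennreal (c * (1 / u))"
        using True c by (simp only: indicator_simps mult_1_right) (simp add: ennreal_mult[symmetric])
      also have "\<dots> \<le> ennreal (144 / u\<^sup>2 * u powr (- (s * p) - 1)) * ennreal (k * (1 / 4) powr \<beta> / 576 * (u powr \<beta> * u\<^sup>2))"
        using ennreal_leI[OF le] k by (subst ennreal_mult[symmetric]) auto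
      also have "\<dots> \<le> ennreal (144 / u\<^sup>2 * u powr (- (s * p) - 1)) * (\<integral>\<^sup>+\<omega>. A \<omega> u \<partial>\<Omega>)"
        by (rule mult_left_mono[OF EA[OF u]]) simp
      also have "\<dots> = (\<integral>\<^sup>+\<omega>. ennreal (144 / u\<^sup>2 * u powr (- (s * p) - 1)) * A \<omega> u \<partial>\<Omega>)"
        by (rule nn_integral_cmult[symmetric]) measurable
      finally show ?thesis using True by (simp only: indicator_simps mult_1_left)
    qed simp
  qed
  also have "\<dots> = (\<integral>\<^sup>+\<omega>. \<integral>\<^sup>+u. indicator {0<..1} u * ennreal (144 / u\<^sup>2 * u powr (- (s * p) - 1)) * A \<omega> u \<partial>lborel \<partial>\<Omega>)"
    by (rule RL.Fubini') measurable
  also have "\<dots> \<le> (\<integral>\<^sup>+\<omega>. epowr (besov_norm s p p (f \<omega>)) p \<partial>\<Omega>)"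
  proof (rule nn_integral_mono)
    fix \<omega> assume \<omega>: "\<omega> \<in> space \<Omega>"
    let ?B = "\<integral>\<^sup>+u\<in>{0<..}. epowr (modulus p (f \<omega>) u * ennreal (u powr (- s))) p * ennreal (1 / u) \<partial>lborel"
    have "(\<integral>\<^sup>+u. indicator {0<..1} u * ennreal (144 / u\<^sup>2 * u powr (- (s * p) - 1)) * A \<omega> u \<partial>lborel) \<le> ?B"
    proof (rule nn_integral_mono)
      fix u :: real
      show "indicator {0<..1} u * ennreal (144 / u\<^sup>2 * u powr (- (s * p) - 1)) * A \<omega> u \<le>
          epowr (modulus p (f \<omega>) u * ennreal (u powr (- s))) p * ennreal (1 / u) * indicator {0<..} u"
      proof (cases "u \<in> {0<..1}")
        case True
        then have u: "0 < u" "u \<le> 1" by auto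
        have "ennreal (144 / u\<^sup>2 * u powr (- (s * p) - 1)) * A \<omega> u =
            ennreal (144 / u\<^sup>2) * A \<omega> u * ennreal (u powr (- (s * p) - 1))"
          by (subst ennreal_mult) (auto simp: mult_ac)
        also have "\<dots> \<le> epowr (modulus p (f \<omega>) u) p * ennreal (u powr (- (s * p) - 1))"
          using epowr_modulus_ge_average[OF \<omega> u] unfolding A_def S_def T_def by (rule mult_right_mono) simp
        also have "\<dots> = epowr (modulus p (f \<omega>) u * ennreal (u powr (- s))) p * ennreal (1 / u)"
        proof -
          have e: "u powr (- (s * p) - 1) = (u powr (- s)) powr p * (1 / u)"
            using u by (simp add: powr_powr powr_diff)
          show ?thesis
            unfolding e using p u by (subst epowr_mult) (auto simp: ennreal_mult[symmetric] mult.assoc)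
        qed
        finally show ?thesis using True by simp
      qed simp
    qed
    also have "?B = epowr (epowr ?B (1 / p)) p" using p by (simp add: epowr_epowr_inverse)
    also have "\<dots> \<le> epowr (besov_norm s p p (f \<omega>)) p"
      unfolding besov_norm_def using p by (intro epowr_mono) (auto intro: add_increasing)
    finally show "(\<integral>\<^sup>+u. indicator {0<..1} u * ennreal (144 / u\<^sup>2 * u powr (- (s * p) - 1)) * A \<omega> u \<partial>lborel) \<le>
      epowr (besov_norm s p p (f \<omega>)) p" .
  qed
  finally show ?thesis by (simp add: top_unique)
qed

end

declare field_compose [measurable del]
declare borel_measurable_indicator_near [measurable del]
declare near_energy_measurable [measurable del]

section \<open>Scaling and the geometric covariogram\<close>

lemma emeasure_lborel_scale:
  fixes A :: "plane set"
  assumes [measurable]: "A \<in> sets borel" and r: "0 < r"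
  shows "emeasure lborel A = ennreal (r\<^sup>2) * emeasure lborel {v. r *\<^sub>R v \<in> A}"
proof -
  have "emeasure lborel A = emeasure (density (distr lborel borel (\<lambda>v::plane. 0 + r *\<^sub>R v)) (\<lambda>_. ennreal (\<bar>r\<bar> ^ DIM(plane)))) A"
    using lborel_affine[of r "0 :: plane"] r by simp
  also have "\<dots> = ennreal (r\<^sup>2) * emeasure (distr lborel borel (\<lambda>v::plane. 0 + r *\<^sub>R v)) A"
    by (subst emeasure_density) (auto simp: nn_integral_cmult_indicator)
  also have "emeasure (distr lborel borel (\<lambda>v::plane. 0 + r *\<^sub>R v)) A = emeasure lborel {v. r *\<^sub>R v \<in> A}"
    by (subst emeasure_distr) (auto simp: vimage_def)
  finally show ?thesis .
qed

lemma scale_mem: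
  fixes F :: "plane set"
  assumes "0 < r"
  shows "r *\<^sub>R v \<in> (\<lambda>x. r *\<^sub>R x) ` F \<longleftrightarrow> v \<in> F"
  using assms by auto

lemma closed_scale: "closed F \<Longrightarrow> closed ((\<lambda>x. r *\<^sub>R x) ` F)" for F :: "plane set"
  by (rule closed_scaling)

lemma measurable_scale [measurable]:
  "(\<lambda>(r, F). (\<lambda>x. r *\<^sub>R x) ` F) \<in> measurable (borel \<Otimes>\<^sub>M fell_borel) (fell_borel :: plane set measure)"
proof (rule measurable_fell_borelI)
  fix q :: "real \<times> plane set" assume "q \<in> space (borel \<Otimes>\<^sub>M fell_borel)"
  then show "closed (case q of (r, F) \<Rightarrow> (\<lambda>x. r *\<^sub>R x) ` F)"
    by (auto simp: space_pair_measure space_fell_borel closed_scale)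
next
  fix G :: "plane set" assume G: "open G"
  let ?M = "borel \<Otimes>\<^sub>M fell_borel :: (real \<times> plane set) measure"
  let ?G = "(\<lambda>(r, x). r *\<^sub>R x) -` G :: (real \<times> plane) set"
  have "open ?G"
    using G unfolding case_prod_beta by (intro open_vimage continuous_intros)
  then have "Measurable.pred ?M (\<lambda>q. \<exists>x\<in>snd q. (fst q, x) \<in> ?G)"
    by (rule pred_open_hit) measurable
  moreover have "{q \<in> space ?M. (case q of (r, F) \<Rightarrow> (\<lambda>x. r *\<^sub>R x) ` F) \<inter> G \<noteq> {}} = {q \<in> space ?M. \<exists>x\<in>snd q. (fst q, x) \<in> ?G}"
    by (auto simp: disjoint_iff)
  ultimately show "{q \<in> space ?M. (case q of (r, F) \<Rightarrow> (\<lambda>x. r *\<^sub>R x) ` F) \<inter> G \<noteq> {}} \<in> sets ?M"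
    by (simp add: pred_def)
qed

text \<open>Tonelli's theorem makes areas that depend on a closed set measurable.\<close>

lemma measurable_area_of:
  fixes Q :: "plane set \<Rightarrow> plane \<Rightarrow> bool"
  assumes "Measurable.pred (fell_borel \<Otimes>\<^sub>M borel) (\<lambda>q. Q (fst q) (snd q))"
  shows "(\<lambda>F. emeasure lborel {v. Q F v}) \<in> borel_measurable fell_borel"
proof -
  let ?S = "{q \<in> space (fell_borel \<Otimes>\<^sub>M borel). Q (fst q) (snd q)}"
  have "?S \<in> sets (fell_borel \<Otimes>\<^sub>M lborel)"
    using assms by (simp add: pred_def sets_pair_measure_cong[OF refl sets_lborel])
  from lborel.measurable_emeasure_Pair[OF this]
  have "(\<lambda>F. emeasure lborel (Pair F -` ?S)) \<in> borel_measurable fell_borel" .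
  moreover have "emeasure lborel (Pair F -` ?S) = emeasure lborel {v. Q F v}" if "F \<in> space fell_borel" for F
    using that by (simp add: space_pair_measure vimage_def)
  ultimately show ?thesis by (simp cong: measurable_cong)
qed

lemma area_measurable [measurable]: "(emeasure lborel :: plane set \<Rightarrow> ennreal) \<in> borel_measurable fell_borel"
  using measurable_area_of[of "\<lambda>F v. v \<in> F"] by simp

lemma loss_measurable [measurable]: "(\<lambda>F. loss F h) \<in> borel_measurable fell_borel"
  unfolding loss_def by (rule measurable_area_of) measurable

lemma frontier_area_measurable: "(\<lambda>F :: plane set. emeasure lborel (frontier F)) \<in> borel_measurable fell_borel"
proof -
  have "(\<lambda>F :: plane set. emeasure lborel {v. v \<in> F \<and> v \<notin> interior F}) \<in> borel_measurable fell_borel"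
    by (rule measurable_area_of) measurable
  moreover have "{v. v \<in> F \<and> v \<notin> interior F} = frontier F" if "F \<in> space fell_borel" for F :: "plane set"
    using that by (auto simp: space_fell_borel frontier_def)
  ultimately show ?thesis by (simp cong: measurable_cong)
qed

lemma neighbourhood_area_measurable: "(\<lambda>F :: plane set. emeasure lborel {v. F \<inter> ball v 1 \<noteq> {}}) \<in> borel_measurable fell_borel"
proof (rule measurable_area_of)
  let ?M = "fell_borel \<Otimes>\<^sub>M borel :: (plane set \<times> plane) measure"
  let ?G = "{(v, w). dist v w < 1} :: (plane \<times> plane) set"
  have "open ?G" unfolding case_prod_beta by (intro open_Collect_less continuous_intros)
  then have "Measurable.pred ?M (\<lambda>q. \<exists>w\<in>fst q. (snd q, w) \<in> ?G)"
    by (rule pred_open_hit) measurable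
  moreover have "(\<lambda>q. \<exists>w\<in>fst q. (snd q, w) \<in> ?G) = (\<lambda>q. fst q \<inter> ball (snd q) 1 \<noteq> {})"
    by (auto simp: fun_eq_iff disjoint_iff)
  ultimately show "Measurable.pred ?M (\<lambda>q. fst q \<inter> ball (snd q) 1 \<noteq> {})" by simp
qed

lemma loss_le_area: "closed F \<Longrightarrow> loss F h \<le> emeasure lborel F"
  unfolding loss_def by (intro emeasure_mono) auto

text \<open>
  A point lost under the translation by \<open>h + k\<close> is lost under \<open>h\<close> or, shifted back by \<open>h\<close>, it
  is lost under \<open>k\<close>.
\<close>

lemma loss_add_le:
  assumes "closed F"
  shows "loss F (h + k) \<le> loss F h + loss F k"
proof -
  have [measurable]: "F \<in> sets borel" using assms by (rule borel_closed)
  have "loss F (h + k) \<le> emeasure lborel ({v. v \<in> F \<and> v - h \<notin> F} \<union> {v. v - h \<in> F \<and> v - h - k \<notin> F})"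
    unfolding loss_def by (intro emeasure_mono) (auto simp: algebra_simps, measurable)
  also have "\<dots> \<le> loss F h + emeasure lborel {v. v - h \<in> F \<and> v - h - k \<notin> F}"
    unfolding loss_def by (intro emeasure_subadditive) measurable
  also have "emeasure lborel {v. v - h \<in> F \<and> v - h - k \<notin> F} = loss F k"
    using emeasure_lborel_translate[of "{v. v \<in> F \<and> v - k \<notin> F}" "- h"] by (simp add: loss_def)
  finally show ?thesis .
qed

lemma loss_scale:
  assumes "closed F" "0 < r"
  shows "loss ((\<lambda>x. r *\<^sub>R x) ` F) h = ennreal (r\<^sup>2) * loss F (h /\<^sub>R r)"
proof -
  let ?rF = "(\<lambda>x. r *\<^sub>R x) ` F"
  have [measurable]: "?rF \<in> sets borel" by (intro borel_closed closed_scale assms)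
  have "r *\<^sub>R v - h \<in> ?rF \<longleftrightarrow> v - h /\<^sub>R r \<in> F" for v
    using scale_mem[OF assms(2), of "v - h /\<^sub>R r" F] assms(2) by (simp add: scaleR_diff_right)
  then have "{v. r *\<^sub>R v \<in> {v. v \<in> ?rF \<and> v - h \<notin> ?rF}} = {v. v \<in> F \<and> v - h /\<^sub>R r \<notin> F}"
    using scale_mem[OF assms(2)] by auto
  moreover have "{v. v \<in> ?rF \<and> v - h \<notin> ?rF} \<in> sets borel" by measurable
  ultimately show ?thesis
    unfolding loss_def using emeasure_lborel_scale[OF _ assms(2)] by simp
qed

lemma area_scale:
  assumes "closed F" "0 < r"
  shows "emeasure lborel ((\<lambda>x. r *\<^sub>R x) ` F) = ennreal (r\<^sup>2) * emeasure lborel (F :: plane set)"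
  using emeasure_lborel_scale[of "(\<lambda>x. r *\<^sub>R x) ` F" r] scale_mem[OF assms(2), of _ F] assms
  by (simp add: borel_closed closed_scale)

lemma frontier_scale:
  assumes "0 < r"
  shows "frontier ((\<lambda>x. r *\<^sub>R x) ` F) = (\<lambda>x. r *\<^sub>R x) ` frontier (F :: plane set)"
proof -
  have l: "linear (\<lambda>x :: plane. r *\<^sub>R x)" "inj (\<lambda>x :: plane. r *\<^sub>R x)"
    using assms by (auto simp: inj_on_def)
  show ?thesis
    unfolding frontier_def closure_injective_linear_image[OF l, symmetric] interior_injective_linear_image[OF l]
    using l(2) by (simp add: image_set_diff)
qed

locale random_shape = prob_space P for P :: "'y measure" +
  fixes Y :: "'y \<Rightarrow> plane set" and a1 a2 :: real
  assumes compact: "random_compact_set P Y"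
    and a1: "0 < a1" and a2: "a1 < a2"
    and between: "AE \<omega> in P. cball 0 a1 \<subseteq> Y \<omega> \<and> Y \<omega> \<subseteq> cball 0 a2"
    and frontier: "AE \<omega> in P. emeasure lborel (frontier (Y \<omega>)) = 0"
begin

lemma Y_measurable [measurable]: "Y \<in> measurable P fell_borel"
  using compact by (simp add: random_compact_set_def random_closed_set_def)

lemma closed_Y: "\<omega> \<in> space P \<Longrightarrow> closed (Y \<omega>)"
  using measurable_space[OF Y_measurable] by (auto simp: space_fell_borel)

definition area :: ennreal where
  "area = (\<integral>\<^sup>+\<omega>. emeasure lborel (Y \<omega>) \<partial>P)"

definition mean_loss :: "plane \<Rightarrow> ennreal" where
  "mean_loss h = (\<integral>\<^sup>+\<omega>. loss (Y \<omega>) h \<partial>P)"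

lemma AE_area_le: "AE \<omega> in P. emeasure lborel (Y \<omega>) \<le> emeasure lborel (cball 0 a2 :: plane set)"
  using between by eventually_elim (auto intro: emeasure_mono)

lemma area_finite: "area < \<infinity>"
proof -
  have "area \<le> (\<integral>\<^sup>+\<omega>. emeasure lborel (cball 0 a2 :: plane set) \<partial>P)"
    unfolding area_def by (rule nn_integral_mono_AE[OF AE_area_le])
  also have "\<dots> < \<infinity>" using emeasure_lborel_cball_finite[of "0 :: plane" a2] by (simp add: emeasure_space_1)
  finally show ?thesis .
qed

lemma area_pos: "0 < area"
proof -
  have "0 < emeasure lborel (cball 0 a1 :: plane set)"
    using a1 content_cball_pos[of a1 "0 :: plane"] by (simp add: measure_def enn2real_positive_iff)
  also have "\<dots> = (\<integral>\<^sup>+\<omega>. emeasure lborel (cball 0 a1 :: plane set) \<partial>P)" by (simp add: emeasure_space_1)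
  also have "\<dots> \<le> area"
    unfolding area_def
  proof (rule nn_integral_mono_AE)
    show "AE \<omega> in P. emeasure lborel (cball 0 a1 :: plane set) \<le> emeasure lborel (Y \<omega>)"
      using between AE_space by eventually_elim (auto intro!: emeasure_mono borel_closed closed_Y)
  qed
  finally show ?thesis .
qed

lemma mean_loss_le_area: "mean_loss h \<le> area"
  unfolding mean_loss_def area_def by (intro nn_integral_mono loss_le_area closed_Y)

lemma mean_loss_finite: "mean_loss h < \<infinity>"
  using mean_loss_le_area area_finite by (rule le_less_trans)

lemma mean_loss_add_le: "mean_loss (h + k) \<le> mean_loss h + mean_loss k"
proof -
  have "mean_loss (h + k) \<le> (\<integral>\<^sup>+\<omega>. loss (Y \<omega>) h + loss (Y \<omega>) k \<partial>P)"
    unfolding mean_loss_def by (intro nn_integral_mono loss_add_le closed_Y)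
  also have "\<dots> = mean_loss h + mean_loss k"
    unfolding mean_loss_def by (rule nn_integral_add) measurable
  finally show ?thesis .
qed

lemma mean_loss_zero: "mean_loss 0 = 0"
  by (simp add: mean_loss_def loss_def)

lemma mean_loss_multiple_le: "mean_loss (real n *\<^sub>R h) \<le> of_nat n * mean_loss h"
proof (induction n)
  case 0
  then show ?case by (simp add: mean_loss_zero)
next
  case (Suc n)
  have "mean_loss (real (Suc n) *\<^sub>R h) \<le> mean_loss (real n *\<^sub>R h) + mean_loss h"
    using mean_loss_add_le[of "real n *\<^sub>R h" h] by (simp add: scaleR_add_left add.commute)
  also have "\<dots> \<le> of_nat n * mean_loss h + mean_loss h" by (intro add_right_mono Suc)
  finally show ?case by (simp add: distrib_right add.commute)
qed

lemma mean_loss_far: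
  assumes "2 * a2 < norm h"
  shows "mean_loss h = area"
  unfolding mean_loss_def area_def
proof (rule nn_integral_cong_AE)
  show "AE \<omega> in P. loss (Y \<omega>) h = emeasure lborel (Y \<omega>)"
    using between
  proof eventually_elim
    case (elim \<omega>)
    have "v - h \<notin> Y \<omega>" if "v \<in> Y \<omega>" for v
    proof
      assume "v - h \<in> Y \<omega>"
      then have "norm v \<le> a2" "norm (v - h) \<le> a2" using that elim by auto
      then show False using norm_triangle_ineq4[of v "v - h"] assms by simp
    qed
    then show ?case unfolding loss_def by (intro arg_cong[where f = "emeasure lborel"]) auto
  qed
qed

text \<open>
  Enough copies of \<open>h\<close> separate \<open>Y\<close> from its translate, so by subadditivity one step already
  costs at least a proportional part of the area.
\<close>

lemma mean_loss_ge: "area * ennreal (norm h / (2 * a2 + norm h)) \<le> mean_loss h"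
proof (cases "h = 0")
  case False
  then have h: "0 < norm h" by simp
  have a: "0 < a2" using a1 a2 by simp
  \<comment> \<open>the number of steps after which \<open>Y\<close> and its translate are disjoint\<close>
  define n where "n = Suc (nat \<lfloor>2 * a2 / norm h\<rfloor>)"
  have "2 * a2 / norm h < real n" "real n \<le> 2 * a2 / norm h + 1"
    unfolding n_def using a h by (auto, linarith+)
  then have n: "2 * a2 < real n * norm h" "real n \<le> (2 * a2 + norm h) / norm h"
    using h by (auto simp: field_simps)
  have "area \<le> of_nat n * mean_loss h"
    using mean_loss_multiple_le[of n h] mean_loss_far[of "real n *\<^sub>R h"] n(1) by simp
  also have "\<dots> \<le> ennreal ((2 * a2 + norm h) / norm h) * mean_loss h"
    using n(2) by (intro mult_right_mono) (auto simp: ennreal_of_nat_eq_real_of_nat intro: ennreal_leI)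
  finally have "area * ennreal (norm h / (2 * a2 + norm h)) \<le>
      ennreal ((2 * a2 + norm h) / norm h) * mean_loss h * ennreal (norm h / (2 * a2 + norm h))"
    by (rule mult_right_mono) simp
  also have "\<dots> = mean_loss h * (ennreal ((2 * a2 + norm h) / norm h) * ennreal (norm h / (2 * a2 + norm h)))"
    by (simp add: mult_ac)
  also have "ennreal ((2 * a2 + norm h) / norm h) * ennreal (norm h / (2 * a2 + norm h)) = 1"
    using a h by (simp add: ennreal_mult[symmetric] add_pos_pos less_imp_neq[symmetric])
  finally show ?thesis by simp
qed simp

text \<open>
  Boundaries are negligible, so interiors may be replaced by the sets themselves, and what a set does
  not share with its translate is its loss.
\<close>

lemma covariogram_eq: "covariogram P Y h = enn2real area - enn2real (mean_loss h)"
proof -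
  have e: "AE \<omega> in P. measure lborel (interior (Y \<omega>) \<inter> (\<lambda>x. h + x) ` interior (Y \<omega>)) =
      enn2real (emeasure lborel (Y \<omega>)) - enn2real (loss (Y \<omega>) h)"
    using AE_area_le frontier AE_space
  proof eventually_elim
    case (elim \<omega>)
    let ?F = "Y \<omega>"
    have cl: "closed ?F" using elim(3) by (rule closed_Y)
    then have [measurable]: "?F \<in> sets borel" by (rule borel_closed)
    have fin: "emeasure lborel ?F < \<infinity>"
      using elim(1) emeasure_lborel_cball_finite[of "0 :: plane" a2] by (auto intro: le_less_trans)
    let ?I = "{v. v \<in> ?F \<and> v - h \<in> ?F}" and ?L = "{v. v \<in> ?F \<and> v - h \<notin> ?F}"
    let ?N = "frontier ?F \<union> {v. v - h \<in> frontier ?F}"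
    have [measurable]: "frontier ?F \<in> sets borel" by (intro borel_closed frontier_closed)
    have "{v. v - h \<in> frontier ?F} \<in> null_sets lborel"
      using emeasure_lborel_translate[of "frontier ?F" "- h"] elim(2) by (simp add: null_sets_def)
    then have N: "?N \<in> null_sets lborel"
      using elim(2) by (intro null_sets.Un) (auto simp: null_sets_def)
    have "interior ?F \<inter> (\<lambda>x. h + x) ` interior ?F = ?I - ?N"
      using cl interior_subset[of ?F] by (auto simp: mem_translate frontier_def)
    then have m: "measure lborel (interior ?F \<inter> (\<lambda>x. h + x) ` interior ?F) = measure lborel ?I"
      using N by (simp add: measure_Diff_null_set)
    have "emeasure lborel ?F = emeasure lborel (?I \<union> ?L)"
      by (rule arg_cong[where f = "emeasure lborel"]) auto
    also have "\<dots> = emeasure lborel ?I + emeasure lborel ?L"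
      by (rule plus_emeasure[symmetric]) auto
    finally have s: "emeasure lborel ?F = emeasure lborel ?I + emeasure lborel ?L" .
    then have "emeasure lborel ?I < \<infinity>" "emeasure lborel ?L < \<infinity>" using fin by (auto simp: less_top[symmetric])
    then have "enn2real (emeasure lborel ?F) = measure lborel ?I + enn2real (loss ?F h)"
      unfolding s loss_def measure_def by (intro enn2real_plus) auto
    then show ?case by (simp add: m)
  qed
  have [measurable]: "(\<lambda>\<omega>. measure lborel (interior (Y \<omega>) \<inter> (\<lambda>x. h + x) ` interior (Y \<omega>))) \<in> borel_measurable P"
  proof -
    have "(\<lambda>F :: plane set. emeasure lborel {v. v \<in> interior F \<and> v - h \<in> interior F}) \<in> borel_measurable fell_borel"
      by (rule measurable_area_of) measurable
    from measurable_compose[OF Y_measurable this]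
    have "(\<lambda>\<omega>. enn2real (emeasure lborel {v. v \<in> interior (Y \<omega>) \<and> v - h \<in> interior (Y \<omega>)})) \<in> borel_measurable P"
      by measurable
    then show ?thesis
      by (simp add: measure_def Int_def mem_translate)
  qed
  have "covariogram P Y h = (LINT \<omega>|P. enn2real (emeasure lborel (Y \<omega>)) - enn2real (loss (Y \<omega>) h))"
    unfolding covariogram_def by (rule integral_cong_AE[OF _ _ e]) measurable
  also have "\<dots> = (LINT \<omega>|P. enn2real (emeasure lborel (Y \<omega>))) - (LINT \<omega>|P. enn2real (loss (Y \<omega>) h))"
  proof (rule Bochner_Integration.integral_diff)
    let ?B = "measure lborel (cball 0 a2 :: plane set)"
    have b: "AE \<omega> in P. enn2real (emeasure lborel (Y \<omega>)) \<le> ?B \<and> enn2real (loss (Y \<omega>) h) \<le> ?B"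
      using AE_area_le AE_space
    proof eventually_elim
      case (elim \<omega>)
      then show ?case
        using loss_le_area[OF closed_Y[OF elim(2)], of h] emeasure_lborel_cball_finite[of "0 :: plane" a2]
        unfolding measure_def by (auto intro!: enn2real_mono intro: order_trans)
    qed
    show "integrable P (\<lambda>\<omega>. enn2real (emeasure lborel (Y \<omega>)))"
      by (rule integrable_const_bound[where B = ?B]) (use b in auto)
    show "integrable P (\<lambda>\<omega>. enn2real (loss (Y \<omega>) h))"
      by (rule integrable_const_bound[where B = ?B]) (use b in auto)
  qed
  also have "(LINT \<omega>|P. enn2real (emeasure lborel (Y \<omega>))) = enn2real area"
  proof -
    have "(LINT \<omega>|P. enn2real (emeasure lborel (Y \<omega>))) = enn2real (\<integral>\<^sup>+\<omega>. ennreal (enn2real (emeasure lborel (Y \<omega>))) \<partial>P)"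
      by (rule integral_eq_nn_integral) auto
    also have "(\<integral>\<^sup>+\<omega>. ennreal (enn2real (emeasure lborel (Y \<omega>))) \<partial>P) = area"
      unfolding area_def using AE_area_le
      by (intro nn_integral_cong_AE, elim AE_mp)
         (use emeasure_lborel_cball_finite[of "0 :: plane" a2] in \<open>auto intro!: AE_I2 ennreal_enn2real le_less_trans\<close>)
    finally show ?thesis .
  qed
  also have "(LINT \<omega>|P. enn2real (loss (Y \<omega>) h)) = enn2real (mean_loss h)"
  proof -
    have "(LINT \<omega>|P. enn2real (loss (Y \<omega>) h)) = enn2real (\<integral>\<^sup>+\<omega>. ennreal (enn2real (loss (Y \<omega>) h)) \<partial>P)"
      by (rule integral_eq_nn_integral) auto
    also have "(\<integral>\<^sup>+\<omega>. ennreal (enn2real (loss (Y \<omega>) h)) \<partial>P) = mean_loss h"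
      unfolding mean_loss_def
    proof (rule nn_integral_cong_AE)
      show "AE \<omega> in P. ennreal (enn2real (loss (Y \<omega>) h)) = loss (Y \<omega>) h"
        using AE_area_le AE_space
      proof eventually_elim
        case (elim \<omega>)
        have "loss (Y \<omega>) h < top"
          using loss_le_area[OF closed_Y[OF elim(2)], of h] elim(1) emeasure_lborel_cball_finite[of "0 :: plane" a2]
          by (auto intro: le_less_trans)
        then show ?case by simp
      qed
    qed
    finally show ?thesis .
  qed
  finally show ?thesis .
qed

text \<open>The regularity conditions on the covariogram, read as bounds on the expected loss of area.\<close>

lemma mean_loss_eq: "mean_loss h = ennreal (covariogram P Y 0 - covariogram P Y h)"
  using mean_loss_finite[of h] by (simp add: covariogram_eq mean_loss_zero)

text \<open>
  The derivative at \<open>0\<close> in a direction \<open>u\<close> bounds the loss along the whole ray, since \<open>n\<close> steps of length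
  \<open>x / n\<close> cost at least as much as one step of length \<open>x\<close>.
\<close>

lemma cond_A2_mean_loss_le:
  assumes "cond_A2 P Y"
  shows "\<exists>C\<ge>0. \<forall>h. mean_loss h \<le> ennreal (C * norm h)"
proof -
  define \<phi> where "\<phi> h = covariogram P Y 0 - covariogram P Y h" for h
  have \<phi>0: "0 \<le> \<phi> h" for h by (simp add: \<phi>_def covariogram_eq mean_loss_zero)
  have multiple: "\<phi> (real n *\<^sub>R h) \<le> real n * \<phi> h" for n h
    using mean_loss_multiple_le[of n h] \<phi>0
    by (simp add: mean_loss_eq \<phi>_def[symmetric] ennreal_of_nat_eq_real_of_nat ennreal_mult[symmetric])
  obtain C where C: "\<And>u. norm u = 1 \<Longrightarrow> \<exists>D. ((\<lambda>x. covariogram P Y (x *\<^sub>R u)) has_real_derivative D) (at_right 0) \<and> \<bar>D\<bar> \<le> C"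
    using assms unfolding cond_A2_def by blast
  have key: "\<phi> (x *\<^sub>R u) \<le> C * x" if u: "norm u = 1" and x: "0 < x" for u x
  proof -
    obtain D where D: "((\<lambda>x. covariogram P Y (x *\<^sub>R u)) has_real_derivative D) (at_right 0)" "\<bar>D\<bar> \<le> C"
      using C[OF u] by blast
    have "((\<lambda>y. (covariogram P Y (y *\<^sub>R u) - covariogram P Y (0 *\<^sub>R u)) / (y - 0)) \<longlongrightarrow> D) (at_right 0)"
      using D(1) unfolding has_field_derivative_iff .
    moreover have "filterlim (\<lambda>n. x / real (Suc n)) (at_right 0) sequentially"
    proof (rule tendsto_imp_filterlim_at_right)
      show "(\<lambda>n. x / real (Suc n)) \<longlonglongrightarrow> 0"
        using tendsto_mult[OF tendsto_const[of x] LIMSEQ_inverse_real_of_nat] by (simp add: divide_inverse)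
    qed (use x in \<open>auto intro!: always_eventually\<close>)
    ultimately have "(\<lambda>n. (covariogram P Y ((x / real (Suc n)) *\<^sub>R u) - covariogram P Y (0 *\<^sub>R u)) / (x / real (Suc n) - 0)) \<longlonglongrightarrow> D"
      by (rule filterlim_compose)
    then have "(\<lambda>n. - \<phi> ((x / real (Suc n)) *\<^sub>R u) / (x / real (Suc n))) \<longlonglongrightarrow> D"
      by (simp add: \<phi>_def)
    moreover have "- \<phi> ((x / real (Suc n)) *\<^sub>R u) / (x / real (Suc n)) \<le> - \<phi> (x *\<^sub>R u) / x" for n
    proof -
      have "\<phi> (x *\<^sub>R u) \<le> real (Suc n) * \<phi> ((x / real (Suc n)) *\<^sub>R u)"
        using multiple[of "Suc n" "(x / real (Suc n)) *\<^sub>R u"] by simp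
      then have "\<phi> (x *\<^sub>R u) / x \<le> real (Suc n) * \<phi> ((x / real (Suc n)) *\<^sub>R u) / x"
        using x by (intro divide_right_mono) auto
      then show ?thesis by (simp add: mult.commute del: of_nat_Suc)
    qed
    ultimately have "D \<le> - \<phi> (x *\<^sub>R u) / x"
      by (intro LIMSEQ_le_const2) auto
    then have "\<phi> (x *\<^sub>R u) \<le> - D * x" using x by (simp add: field_simps)
    also have "\<dots> \<le> C * x" using D(2) x by (intro mult_right_mono) auto
    finally show ?thesis .
  qed
  have le: "\<phi> h \<le> max C 0 * norm h" for h
  proof (cases "h = 0")
    case False
    then have "\<phi> (norm h *\<^sub>R (h /\<^sub>R norm h)) \<le> C * norm h" by (intro key) auto
    also have "\<dots> \<le> max C 0 * norm h" by (intro mult_right_mono) auto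
    finally show ?thesis using False by simp
  qed (simp add: \<phi>_def)
  show ?thesis
    by (intro exI[of _ "max C 0"]) (auto simp: mean_loss_eq \<phi>_def[symmetric] intro!: ennreal_leI le)
qed

text \<open>
  Away from \<open>0\<close> the loss is at most the area, which is absorbed in the constant.
\<close>

lemma cond_A3_mean_loss_le:
  assumes "cond_A3 P Y" and \<delta>: "0 < \<delta>" "\<delta> < 1"
  shows "\<exists>C\<ge>0. \<forall>h. mean_loss h \<le> ennreal (C * norm h powr (1 - \<delta>))"
proof -
  define \<phi> where "\<phi> h = covariogram P Y 0 - covariogram P Y h" for h
  have \<phi>0: "0 \<le> \<phi> h" for h by (simp add: \<phi>_def covariogram_eq mean_loss_zero)
  have "\<forall>\<^sub>F x in at 0. norm (covariogram P Y x - covariogram P Y 0) \<le> 1 * norm (norm x powr (1 - \<delta>))"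
    using assms(1) \<delta>(1) unfolding cond_A3_def by (intro landau_o.smallD) auto
  then have "\<forall>\<^sub>F x in at 0. \<phi> x \<le> norm x powr (1 - \<delta>)"
    by eventually_elim (simp add: \<phi>_def)
  then obtain \<eta> where \<eta>: "0 < \<eta>" "\<And>x. x \<noteq> 0 \<Longrightarrow> norm x < \<eta> \<Longrightarrow> \<phi> x \<le> norm x powr (1 - \<delta>)"
    unfolding eventually_at by auto
  define C where "C = max 1 (enn2real area / \<eta> powr (1 - \<delta>))"
  have le: "\<phi> h \<le> C * norm h powr (1 - \<delta>)" for h
  proof (cases "h = 0 \<or> norm h < \<eta>")
    case True
    then have "\<phi> h \<le> 1 * norm h powr (1 - \<delta>)" using \<eta> by (cases "h = 0") (auto simp: \<phi>_def)
    also have "\<dots> \<le> C * norm h powr (1 - \<delta>)" by (intro mult_right_mono) (auto simp: C_def)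
    finally show ?thesis .
  next
    case False
    have "\<phi> h \<le> enn2real area"
      using mean_loss_le_area[of h] area_finite by (simp add: \<phi>_def covariogram_eq mean_loss_zero enn2real_mono)
    also have "\<dots> = enn2real area / \<eta> powr (1 - \<delta>) * \<eta> powr (1 - \<delta>)" using \<eta> by simp
    also have "\<dots> \<le> C * norm h powr (1 - \<delta>)"
      using False \<eta> \<delta> by (intro mult_mono powr_mono2) (auto simp: C_def)
    finally show ?thesis .
  qed
  show ?thesis
    by (intro exI[of _ C]) (auto simp: mean_loss_eq \<phi>_def[symmetric] C_def[symmetric] intro!: ennreal_leI le, simp add: C_def)
qed

end

section \<open>The law of the rescaled shape\<close>

lemma radius_weight_measurable [measurable]: "radius_weight \<alpha> r0 r1 \<in> borel_measurable borel"
proof -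
  have "Measurable.pred borel (\<lambda>r::real. r0 \<le> r \<and> ereal r \<le> r1)" by measurable
  then have [measurable]: "{r. r0 \<le> r \<and> ereal r \<le> r1} \<in> sets borel" by (simp add: pred_def)
  show ?thesis unfolding radius_weight_def by measurable
qed

lemma radius_weight_nonneg: "0 \<le> radius_weight \<alpha> r0 r1 r"
  by (simp add: radius_weight_def)

lemma radius_weight_normalizable:
  assumes r0: "0 < r0" and r1: "ereal r0 < r1" and \<alpha>: "1 < \<alpha>"
  shows "integrable lborel (radius_weight \<alpha> r0 r1)" and "0 < (LINT r|lborel. radius_weight \<alpha> r0 r1 r)"
proof -
  have "(\<integral>\<^sup>+r. ennreal (radius_weight \<alpha> r0 r1 r) \<partial>lborel) \<le> (\<integral>\<^sup>+r. ennreal (r powr (- \<alpha>)) * indicator {r0..} r \<partial>lborel)"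
    by (intro nn_integral_mono) (auto simp: radius_weight_def split: split_indicator)
  also have "\<dots> < \<infinity>"
    using nn_integral_has_integral_lebesgue'[OF _ has_integral_powr_to_inf[of "- \<alpha>" r0]] r0 \<alpha> by simp
  finally show i: "integrable lborel (radius_weight \<alpha> r0 r1)"
    by (intro integrableI_nonneg) (auto simp: radius_weight_nonneg)
  obtain r2 where r2: "r0 < r2" "ereal r2 < r1"
    using ereal_dense2[OF r1] by auto
  have "0 < r2 powr (- \<alpha>) * (r2 - r0)" using r0 r2 by simp
  also have "\<dots> = (LINT r|lborel. r2 powr (- \<alpha>) * indicator {r0..r2} r)"
    using r2 by simp
  also have "\<dots> \<le> (LINT r|lborel. radius_weight \<alpha> r0 r1 r)"
  proof (rule integral_mono[OF _ i])
    fix r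
    have "ereal r \<le> r1" if "r \<le> r2" using that r2 by (metis ereal_less_eq(3) le_less_trans less_imp_le)
    then show "r2 powr (- \<alpha>) * indicator {r0..r2} r \<le> radius_weight \<alpha> r0 r1 r"
      using r0 \<alpha> by (auto simp: radius_weight_def split: split_indicator intro!: powr_mono2')
  qed (intro integrable_mult_right integrable_real_indicator, use r2 in \<open>auto simp: emeasure_lborel_Icc_eq\<close>)
  finally show "0 < (LINT r|lborel. radius_weight \<alpha> r0 r1 r)" .
qed

context random_shape begin

definition second_moment :: "real \<Rightarrow> real \<Rightarrow> ereal \<Rightarrow> ennreal" where
  "second_moment \<alpha> r0 r1 = (\<integral>\<^sup>+r. ennreal (radius_weight \<alpha> r0 r1 r * r\<^sup>2) \<partial>lborel)"

definition scaled_loss :: "real \<Rightarrow> real \<Rightarrow> ereal \<Rightarrow> plane \<Rightarrow> ennreal" where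
  "scaled_loss \<alpha> r0 r1 h = (\<integral>\<^sup>+r. ennreal (radius_weight \<alpha> r0 r1 r * r\<^sup>2) * mean_loss (h /\<^sub>R r) \<partial>lborel)"

text \<open>
  The ratio \<open>loss / area\<close> for the rescaled shape. The normalizing constant of the radius law
  cancels in it, which is why it still makes sense in the limit where the smallest radius tends to 0.
\<close>

definition relative_loss :: "real \<Rightarrow> real \<Rightarrow> ereal \<Rightarrow> plane \<Rightarrow> real" where
  "relative_loss \<alpha> r0 r1 h = enn2real (scaled_loss \<alpha> r0 r1 h) / (enn2real (second_moment \<alpha> r0 r1) * enn2real area)"

lemma nn_integral_scaled_law:
  assumes r0: "0 < r0" and r1: "ereal r0 < r1" and \<alpha>: "1 < \<alpha>"
    and [measurable]: "\<phi> \<in> borel_measurable fell_borel"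
  shows "(\<integral>\<^sup>+F. \<phi> F \<partial>scaled_law P Y \<alpha> r0 r1) = ennreal (1 / (LINT r|lborel. radius_weight \<alpha> r0 r1 r)) *
    (\<integral>\<^sup>+r. ennreal (radius_weight \<alpha> r0 r1 r) * (\<integral>\<^sup>+\<omega>. \<phi> ((\<lambda>x. r *\<^sub>R x) ` Y \<omega>) \<partial>P) \<partial>lborel)"
proof -
  define N where "N = (LINT r|lborel. radius_weight \<alpha> r0 r1 r)"
  have N: "0 < N" unfolding N_def by (rule radius_weight_normalizable[OF r0 r1 \<alpha>])
  let ?D = "distr P fell_borel Y"
  interpret D: prob_space ?D by (rule prob_space_distr) simp
  have sets_R: "sets (radius_law \<alpha> r0 r1) = sets borel" by (simp add: radius_law_def)
  have scale [measurable]: "(\<lambda>(r, F). (\<lambda>x. r *\<^sub>R x) ` F) \<in> measurable (radius_law \<alpha> r0 r1 \<Otimes>\<^sub>M ?D) (fell_borel :: plane set measure)"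
    using measurable_scale by (simp add: measurable_cong_sets[OF sets_pair_measure_cong[OF sets_R sets_distr] refl])
  have inner: "(\<lambda>r. \<integral>\<^sup>+\<omega>. \<phi> ((\<lambda>x. r *\<^sub>R x) ` Y \<omega>) \<partial>P) \<in> borel_measurable borel"
  proof -
    have "(\<lambda>(r, \<omega>). \<phi> ((\<lambda>x. r *\<^sub>R x) ` Y \<omega>)) \<in> borel_measurable (borel \<Otimes>\<^sub>M P)"
      using measurable_compose[OF measurable_compose[OF _ measurable_scale] assms(4), of "\<lambda>q. (fst q, Y (snd q))" "borel \<Otimes>\<^sub>M P"]
      by (simp add: case_prod_beta)
    then show ?thesis by (rule borel_measurable_nn_integral)
  qed
  have "(\<integral>\<^sup>+F. \<phi> F \<partial>scaled_law P Y \<alpha> r0 r1) =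
      (\<integral>\<^sup>+q. \<phi> (case q of (r, F) \<Rightarrow> (\<lambda>x. r *\<^sub>R x) ` F) \<partial>(radius_law \<alpha> r0 r1 \<Otimes>\<^sub>M ?D))"
    unfolding scaled_law_def by (rule nn_integral_distr) measurable
  also have "\<dots> = (\<integral>\<^sup>+r. \<integral>\<^sup>+F. \<phi> ((\<lambda>x. r *\<^sub>R x) ` F) \<partial>?D \<partial>radius_law \<alpha> r0 r1)"
  proof -
    have "(\<lambda>q. \<phi> (case q of (r, F) \<Rightarrow> (\<lambda>x. r *\<^sub>R x) ` F)) \<in> borel_measurable (radius_law \<alpha> r0 r1 \<Otimes>\<^sub>M ?D)"
      using scale assms(4) by (rule measurable_compose)
    from D.nn_integral_fst[OF this] show ?thesis by simp
  qed
  also have "\<dots> = (\<integral>\<^sup>+r. \<integral>\<^sup>+\<omega>. \<phi> ((\<lambda>x. r *\<^sub>R x) ` Y \<omega>) \<partial>P \<partial>radius_law \<alpha> r0 r1)"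
  proof (intro nn_integral_cong nn_integral_distr Y_measurable)
    fix r :: real
    have "(\<lambda>F. (r, F)) \<in> measurable fell_borel (borel \<Otimes>\<^sub>M fell_borel)" by measurable
    from measurable_compose[OF measurable_compose[OF this measurable_scale] assms(4)]
    show "(\<lambda>F. \<phi> ((\<lambda>x. r *\<^sub>R x) ` F)) \<in> borel_measurable ?D" by simp
  qed
  also have "\<dots> = (\<integral>\<^sup>+r. ennreal (radius_weight \<alpha> r0 r1 r / N) * (\<integral>\<^sup>+\<omega>. \<phi> ((\<lambda>x. r *\<^sub>R x) ` Y \<omega>) \<partial>P) \<partial>lborel)"
    unfolding radius_law_def N_def[symmetric] using inner by (intro nn_integral_density) auto
  also have "\<dots> = (\<integral>\<^sup>+r. ennreal (1 / N) * (ennreal (radius_weight \<alpha> r0 r1 r) * (\<integral>\<^sup>+\<omega>. \<phi> ((\<lambda>x. r *\<^sub>R x) ` Y \<omega>) \<partial>P)) \<partial>lborel)"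
    using N by (intro nn_integral_cong) (simp add: mult.assoc[symmetric] ennreal_mult[symmetric] radius_weight_nonneg)
  also have "\<dots> = ennreal (1 / N) * (\<integral>\<^sup>+r. ennreal (radius_weight \<alpha> r0 r1 r) * (\<integral>\<^sup>+\<omega>. \<phi> ((\<lambda>x. r *\<^sub>R x) ` Y \<omega>) \<partial>P) \<partial>lborel)"
    using inner by (intro nn_integral_cmult) measurable
  finally show ?thesis by (simp add: N_def)
qed

text \<open>
  Areas of the dilated shape carry the factor \<open>r\<^sup>2\<close>, but only for positive \<open>r\<close>; the weight vanishes
  elsewhere.
\<close>

lemma radius_weight_cong:
  assumes r0: "0 < r0" and eq: "\<And>r. 0 < r \<Longrightarrow> f r = ennreal (r\<^sup>2) * g r"
  shows "(\<integral>\<^sup>+r. ennreal (radius_weight \<alpha> r0 r1 r) * f r \<partial>lborel) = (\<integral>\<^sup>+r. ennreal (radius_weight \<alpha> r0 r1 r * r\<^sup>2) * g r \<partial>lborel)"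
proof (rule nn_integral_cong)
  fix r
  show "ennreal (radius_weight \<alpha> r0 r1 r) * f r = ennreal (radius_weight \<alpha> r0 r1 r * r\<^sup>2) * g r"
  proof (cases "0 < r")
    case True
    then show ?thesis by (simp add: eq ennreal_mult radius_weight_nonneg mult.assoc)
  next
    case False
    then have "radius_weight \<alpha> r0 r1 r = 0" using r0 by (auto simp: radius_weight_def)
    then show ?thesis by simp
  qed
qed

context
  fixes \<alpha> r0 :: real and r1 :: ereal
  assumes r0: "0 < r0" and r1: "ereal r0 < r1" and \<alpha>: "1 < \<alpha>" and M2: "second_moment \<alpha> r0 r1 < \<infinity>"
begin

definition mass :: real where
  "mass = (LINT r|lborel. radius_weight \<alpha> r0 r1 r)"

lemma mass_pos: "0 < mass"
  unfolding mass_def by (rule radius_weight_normalizable[OF r0 r1 \<alpha>])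

lemma nn_integral_radius_weight: "(\<integral>\<^sup>+r. ennreal (radius_weight \<alpha> r0 r1 r) \<partial>lborel) = ennreal mass"
  unfolding mass_def
  by (rule nn_integral_eq_integral) (auto simp: radius_weight_normalizable[OF r0 r1 \<alpha>] radius_weight_nonneg)

lemma second_moment_pos: "0 < second_moment \<alpha> r0 r1"
proof -
  have "0 < ennreal (r0\<^sup>2) * ennreal mass" using mass_pos r0 by (simp add: ennreal_mult[symmetric])
  also have "\<dots> = (\<integral>\<^sup>+r. ennreal (r0\<^sup>2) * ennreal (radius_weight \<alpha> r0 r1 r) \<partial>lborel)"
    unfolding nn_integral_radius_weight[symmetric] by (rule nn_integral_cmult[symmetric]) measurable
  also have "\<dots> \<le> second_moment \<alpha> r0 r1"
    unfolding second_moment_def using r0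
    by (intro nn_integral_mono) (auto simp: radius_weight_def ennreal_mult[symmetric] mult.commute split: split_indicator
        intro!: ennreal_leI mult_left_mono power_mono)
  finally show ?thesis .
qed

lemma scaled_law_area:
  "(\<integral>\<^sup>+F. emeasure lborel F \<partial>scaled_law P Y \<alpha> r0 r1) = ennreal (1 / mass) * (second_moment \<alpha> r0 r1 * area)"
proof -
  have "(\<integral>\<^sup>+r. ennreal (radius_weight \<alpha> r0 r1 r) * (\<integral>\<^sup>+\<omega>. emeasure lborel ((\<lambda>x. r *\<^sub>R x) ` Y \<omega>) \<partial>P) \<partial>lborel) =
      (\<integral>\<^sup>+r. ennreal (radius_weight \<alpha> r0 r1 r * r\<^sup>2) * area \<partial>lborel)"
  proof (rule radius_weight_cong[OF r0])
    fix r :: real assume r: "0 < r"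
    have "(\<integral>\<^sup>+\<omega>. emeasure lborel ((\<lambda>x. r *\<^sub>R x) ` Y \<omega>) \<partial>P) = (\<integral>\<^sup>+\<omega>. ennreal (r\<^sup>2) * emeasure lborel (Y \<omega>) \<partial>P)"
      by (intro nn_integral_cong area_scale closed_Y r)
    also have "\<dots> = ennreal (r\<^sup>2) * area" unfolding area_def by (rule nn_integral_cmult) measurable
    finally show "(\<integral>\<^sup>+\<omega>. emeasure lborel ((\<lambda>x. r *\<^sub>R x) ` Y \<omega>) \<partial>P) = ennreal (r\<^sup>2) * area" .
  qed
  also have "\<dots> = second_moment \<alpha> r0 r1 * area" unfolding second_moment_def by (rule nn_integral_multc) measurable
  finally show ?thesis by (simp add: nn_integral_scaled_law[OF r0 r1 \<alpha>] mass_def)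
qed

lemma scaled_law_loss:
  "(\<integral>\<^sup>+F. loss F h \<partial>scaled_law P Y \<alpha> r0 r1) = ennreal (1 / mass) * scaled_loss \<alpha> r0 r1 h"
proof -
  have "(\<integral>\<^sup>+r. ennreal (radius_weight \<alpha> r0 r1 r) * (\<integral>\<^sup>+\<omega>. loss ((\<lambda>x. r *\<^sub>R x) ` Y \<omega>) h \<partial>P) \<partial>lborel) = scaled_loss \<alpha> r0 r1 h"
    unfolding scaled_loss_def
  proof (rule radius_weight_cong[OF r0])
    fix r :: real assume r: "0 < r"
    have "(\<integral>\<^sup>+\<omega>. loss ((\<lambda>x. r *\<^sub>R x) ` Y \<omega>) h \<partial>P) = (\<integral>\<^sup>+\<omega>. ennreal (r\<^sup>2) * loss (Y \<omega>) (h /\<^sub>R r) \<partial>P)"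
      by (intro nn_integral_cong loss_scale closed_Y r)
    also have "\<dots> = ennreal (r\<^sup>2) * mean_loss (h /\<^sub>R r)" unfolding mean_loss_def by (rule nn_integral_cmult) measurable
    finally show "(\<integral>\<^sup>+\<omega>. loss ((\<lambda>x. r *\<^sub>R x) ` Y \<omega>) h \<partial>P) = ennreal (r\<^sup>2) * mean_loss (h /\<^sub>R r)" .
  qed
  then show ?thesis by (simp add: nn_integral_scaled_law[OF r0 r1 \<alpha>] mass_def)
qed

lemma scaled_law_frontier: "(\<integral>\<^sup>+F. emeasure lborel (frontier F) \<partial>scaled_law P Y \<alpha> r0 r1) = 0"
proof -
  have "(\<integral>\<^sup>+r. ennreal (radius_weight \<alpha> r0 r1 r) * (\<integral>\<^sup>+\<omega>. emeasure lborel (frontier ((\<lambda>x. r *\<^sub>R x) ` Y \<omega>)) \<partial>P) \<partial>lborel) =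
      (\<integral>\<^sup>+r. ennreal (radius_weight \<alpha> r0 r1 r * r\<^sup>2) * 0 \<partial>lborel)"
  proof (rule radius_weight_cong[OF r0])
    fix r :: real assume r: "0 < r"
    have "(\<integral>\<^sup>+\<omega>. emeasure lborel (frontier ((\<lambda>x. r *\<^sub>R x) ` Y \<omega>)) \<partial>P) = (\<integral>\<^sup>+\<omega>. 0 \<partial>P)"
      using frontier
      by (intro nn_integral_cong_AE, elim AE_mp) (simp add: frontier_scale[OF r] area_scale[OF frontier_closed r])
    then show "(\<integral>\<^sup>+\<omega>. emeasure lborel (frontier ((\<lambda>x. r *\<^sub>R x) ` Y \<omega>)) \<partial>P) = ennreal (r\<^sup>2) * 0" by simp
  qed
  then show ?thesis by (simp add: nn_integral_scaled_law[OF r0 r1 \<alpha> frontier_area_measurable])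
qed

text \<open>
  The neighbourhood of a leaf lies in a disk of radius \<open>r * a2 + 1 \<le> r * (a2 + 1 / r0)\<close>, so its area
  is integrable together with \<open>r\<^sup>2\<close>.
\<close>

lemma scaled_law_neighbourhood: "(\<integral>\<^sup>+F. emeasure lborel {v. F \<inter> ball v 1 \<noteq> {}} \<partial>scaled_law P Y \<alpha> r0 r1) < \<infinity>"
proof -
  define c where "c = pi * (a2 + 1 / r0)\<^sup>2"
  have a: "0 < a2" using a1 a2 by simp
  have "(\<integral>\<^sup>+r. ennreal (radius_weight \<alpha> r0 r1 r) * (\<integral>\<^sup>+\<omega>. emeasure lborel {v. (\<lambda>x. r *\<^sub>R x) ` Y \<omega> \<inter> ball v 1 \<noteq> {}} \<partial>P) \<partial>lborel) \<le>
      (\<integral>\<^sup>+r. ennreal (radius_weight \<alpha> r0 r1 r * r\<^sup>2) * ennreal c \<partial>lborel)"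
  proof (rule nn_integral_mono)
    fix r
    show "ennreal (radius_weight \<alpha> r0 r1 r) * (\<integral>\<^sup>+\<omega>. emeasure lborel {v. (\<lambda>x. r *\<^sub>R x) ` Y \<omega> \<inter> ball v 1 \<noteq> {}} \<partial>P) \<le>
        ennreal (radius_weight \<alpha> r0 r1 r * r\<^sup>2) * ennreal c"
    proof (cases "r0 \<le> r")
      case True
      then have r: "0 < r" using r0 by simp
      have "(\<integral>\<^sup>+\<omega>. emeasure lborel {v. (\<lambda>x. r *\<^sub>R x) ` Y \<omega> \<inter> ball v 1 \<noteq> {}} \<partial>P) \<le>
          (\<integral>\<^sup>+\<omega>. emeasure lborel (cball 0 (r * a2 + 1) :: plane set) \<partial>P)"
      proof (rule nn_integral_mono_AE)
        show "AE \<omega> in P. emeasure lborel {v. (\<lambda>x. r *\<^sub>R x) ` Y \<omega> \<inter> ball v 1 \<noteq> {}} \<le> emeasure lborel (cball 0 (r * a2 + 1) :: plane set)"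
          using between
        proof eventually_elim
          case (elim \<omega>)
          have "v \<in> cball 0 (r * a2 + 1)" if "x \<in> Y \<omega>" "dist v (r *\<^sub>R x) < 1" for v x
          proof -
            have "norm (r *\<^sub>R x) \<le> r * a2" using elim that(1) r by (auto intro!: mult_left_mono)
            then show ?thesis using that(2) norm_triangle_ineq2[of v "r *\<^sub>R x"] by (simp add: dist_norm)
          qed
          then show ?case by (intro emeasure_mono) auto
        qed
      qed
      also have "\<dots> = ennreal (pi * (r * a2 + 1)\<^sup>2)"
        using r a by (simp add: emeasure_space_1 emeasure_cball unit_ball_vol_2)
      also have "\<dots> \<le> ennreal (r\<^sup>2 * c)"
      proof (rule ennreal_leI)
        have "r * a2 + 1 \<le> r * (a2 + 1 / r0)" using True r0 by (simp add: field_simps)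
        then have "(r * a2 + 1)\<^sup>2 \<le> (r * (a2 + 1 / r0))\<^sup>2" using r a by (intro power_mono) auto
        then show "pi * (r * a2 + 1)\<^sup>2 \<le> r\<^sup>2 * c" by (simp add: c_def power_mult_distrib)
      qed
      finally have "ennreal (radius_weight \<alpha> r0 r1 r) * (\<integral>\<^sup>+\<omega>. emeasure lborel {v. (\<lambda>x. r *\<^sub>R x) ` Y \<omega> \<inter> ball v 1 \<noteq> {}} \<partial>P) \<le>
          ennreal (radius_weight \<alpha> r0 r1 r) * ennreal (r\<^sup>2 * c)" by (rule mult_left_mono) simp
      then show ?thesis by (simp add: ennreal_mult radius_weight_nonneg c_def mult.assoc)
    next
      case False
      then have "radius_weight \<alpha> r0 r1 r = 0" by (auto simp: radius_weight_def)
      then show ?thesis by simp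
    qed
  qed
  also have "\<dots> = second_moment \<alpha> r0 r1 * ennreal c"
    unfolding second_moment_def by (rule nn_integral_multc) measurable
  also have "\<dots> < \<infinity>" using M2 by (simp add: ennreal_mult_less_top)
  finally show ?thesis
    by (simp add: nn_integral_scaled_law[OF r0 r1 \<alpha> neighbourhood_area_measurable] ennreal_mult_less_top)
qed

lemma scaled_loss_finite: "scaled_loss \<alpha> r0 r1 h < \<infinity>"
proof -
  have "scaled_loss \<alpha> r0 r1 h \<le> (\<integral>\<^sup>+r. ennreal (radius_weight \<alpha> r0 r1 r * r\<^sup>2) * area \<partial>lborel)"
    unfolding scaled_loss_def by (intro nn_integral_mono mult_left_mono mean_loss_le_area) auto
  also have "\<dots> = second_moment \<alpha> r0 r1 * area" unfolding second_moment_def by (rule nn_integral_multc) measurable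
  also have "\<dots> < \<infinity>" using M2 area_finite by (simp add: ennreal_mult_less_top)
  finally show ?thesis .
qed

lemma two_point_moments:
  assumes cdl: "colored_dead_leaves \<Omega> (scaled_law P Y \<alpha> r0 r1) Z X U I" and p: "1 \<le> p"
  shows "AE \<omega> in \<Omega>. I \<omega> x \<in> {0<..<1}"
    and "(\<integral>\<^sup>+\<omega>. ennreal (\<bar>I \<omega> x - I \<omega> y\<bar> powr p) \<partial>\<Omega>) \<le> ennreal (2 / (1 - exp (- 1)) * relative_loss \<alpha> r0 r1 (x - y))"
    and "ennreal (exp (- 1) / (9 * 3 powr p) * relative_loss \<alpha> r0 r1 (x - y)) \<le> (\<integral>\<^sup>+\<omega>. ennreal (\<bar>I \<omega> x - I \<omega> y\<bar> powr p) \<partial>\<Omega>)"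
proof -
  define m2 where "m2 = enn2real (second_moment \<alpha> r0 r1)"
  define g where "g = enn2real area"
  define D where "D = 1 / mass * enn2real (scaled_loss \<alpha> r0 r1 (x - y))"
  define M where "M = 1 / mass * (m2 * g)"
  have m2: "second_moment \<alpha> r0 r1 = ennreal m2" "0 < m2"
    using M2 second_moment_pos by (auto simp: m2_def enn2real_positive_iff)
  have g: "area = ennreal g" "0 < g"
    using area_finite area_pos by (auto simp: g_def enn2real_positive_iff)
  have M_pos: "0 < M" using mass_pos m2 g by (simp add: M_def)
  interpret cdl: colored_dead_leaves \<Omega> "scaled_law P Y \<alpha> r0 r1" Z X U I by (rule cdl)
  interpret tame_colored_dead_leaves \<Omega> "scaled_law P Y \<alpha> r0 r1" Z X M U I
  proof unfold_locales
    show "(\<integral>\<^sup>+F. emeasure lborel F \<partial>scaled_law P Y \<alpha> r0 r1) = ennreal M"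
      using mass_pos m2 g by (simp add: scaled_law_area M_def ennreal_mult[symmetric])
  qed (fact M_pos scaled_law_frontier scaled_law_neighbourhood)+
  have D: "(\<integral>\<^sup>+F. loss F (x - y) \<partial>scaled_law P Y \<alpha> r0 r1) = ennreal D" "0 \<le> D"
  proof -
    obtain l where "scaled_loss \<alpha> r0 r1 (x - y) = ennreal l" "0 \<le> l"
      using scaled_loss_finite[of "x - y"] by (cases "scaled_loss \<alpha> r0 r1 (x - y)") auto
    then show "(\<integral>\<^sup>+F. loss F (x - y) \<partial>scaled_law P Y \<alpha> r0 r1) = ennreal D" "0 \<le> D"
      using mass_pos by (simp_all add: scaled_law_loss D_def ennreal_mult[symmetric])
  qed
  have DM: "D / M = relative_loss \<alpha> r0 r1 (x - y)"
    using mass_pos by (simp add: D_def M_def relative_loss_def m2_def g_def)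
  show "AE \<omega> in \<Omega>. I \<omega> x \<in> {0<..<1}" by (rule AE_field_range)
  show "(\<integral>\<^sup>+\<omega>. ennreal (\<bar>I \<omega> x - I \<omega> y\<bar> powr p) \<partial>\<Omega>) \<le> ennreal (2 / (1 - exp (- 1)) * relative_loss \<alpha> r0 r1 (x - y))"
    using increment_moment_le[OF D p] by (simp add: DM)
  show "ennreal (exp (- 1) / (9 * 3 powr p) * relative_loss \<alpha> r0 r1 (x - y)) \<le> (\<integral>\<^sup>+\<omega>. ennreal (\<bar>I \<omega> x - I \<omega> y\<bar> powr p) \<partial>\<Omega>)"
    using increment_moment_ge[OF D p] by (simp add: DM)
qed

end

end

section \<open>Size of the relative loss\<close>

context random_shape begin

lemma area_real: "area = ennreal (enn2real area)" "0 < enn2real area"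
  using area_finite area_pos by (auto simp: enn2real_positive_iff)

lemma mean_loss_ge_scaled:
  assumes "0 < r" "0 \<le> t" "t \<le> norm h / (r * (2 * a2) + norm h)"
  shows "area * ennreal t \<le> mean_loss (h /\<^sub>R r)"
proof -
  have "norm (h /\<^sub>R r) / (2 * a2 + norm (h /\<^sub>R r)) = norm h / (r * (2 * a2) + norm h)"
    using assms(1) by (simp add: field_simps)
  then have "area * ennreal (norm h / (r * (2 * a2) + norm h)) \<le> mean_loss (h /\<^sub>R r)"
    using mean_loss_ge[of "h /\<^sub>R r"] by (simp only:)
  moreover have "area * ennreal t \<le> area * ennreal (norm h / (r * (2 * a2) + norm h))"
    by (intro mult_left_mono ennreal_leI assms) simp
  ultimately show ?thesis by (rule order_trans[rotated])
qed

lemma relative_loss_leI: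
  assumes "0 < m" "ennreal m \<le> second_moment \<alpha> r0 r1" "second_moment \<alpha> r0 r1 < \<infinity>" "0 \<le> B"
    and "scaled_loss \<alpha> r0 r1 h \<le> ennreal B"
  shows "relative_loss \<alpha> r0 r1 h \<le> B / (m * enn2real area)"
proof -
  have "m \<le> enn2real (second_moment \<alpha> r0 r1)"
    using assms(1-3) enn2real_mono[of "ennreal m" "second_moment \<alpha> r0 r1"] by simp
  moreover have "enn2real (scaled_loss \<alpha> r0 r1 h) \<le> B"
    using assms(4,5) by (intro enn2real_leI)
  ultimately show ?thesis
    unfolding relative_loss_def using assms(1,4) area_real(2)
    by (intro frac_le mult_right_mono mult_pos_pos) auto
qed

lemma relative_loss_geI:
  assumes "0 < m" "second_moment \<alpha> r0 r1 \<le> ennreal m" "0 < second_moment \<alpha> r0 r1" "0 \<le> B"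
    and "area * ennreal B \<le> scaled_loss \<alpha> r0 r1 h" "scaled_loss \<alpha> r0 r1 h < \<infinity>"
  shows "B / m \<le> relative_loss \<alpha> r0 r1 h"
proof -
  have m: "enn2real (second_moment \<alpha> r0 r1) \<le> m" "0 < enn2real (second_moment \<alpha> r0 r1)"
    using assms(1-3) by (auto intro: enn2real_leI simp: enn2real_positive_iff intro: le_less_trans)
  have "enn2real (area * ennreal B) \<le> enn2real (scaled_loss \<alpha> r0 r1 h)"
    using assms(5,6) by (intro enn2real_mono) auto
  then have "enn2real area * B \<le> enn2real (scaled_loss \<alpha> r0 r1 h)"
    using assms(4) by (simp add: enn2real_mult)
  then have "enn2real area * B / (m * enn2real area) \<le> enn2real (scaled_loss \<alpha> r0 r1 h) / (enn2real (second_moment \<alpha> r0 r1) * enn2real area)"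
    using m assms(1,4) area_real(2) by (intro frac_le mult_right_mono) auto
  then show ?thesis unfolding relative_loss_def using area_real(2) by simp
qed

lemma second_moment_finite:
  assumes r0: "0 < r0" and r1: "ereal r0 < r1" and \<alpha>: "1 < \<alpha>" and ar: "r1 < \<infinity> \<or> 3 < \<alpha>"
  shows "second_moment \<alpha> r0 r1 < \<infinity>"
  using ar
proof
  assume "3 < \<alpha>"
  have "second_moment \<alpha> r0 r1 \<le> (\<integral>\<^sup>+r. ennreal (r powr (2 - \<alpha>)) * indicator {r0..} r \<partial>lborel)"
    unfolding second_moment_def
  proof (rule nn_integral_mono)
    fix r
    show "ennreal (radius_weight \<alpha> r0 r1 r * r\<^sup>2) \<le> ennreal (r powr (2 - \<alpha>)) * indicator {r0..} r"
    proof (cases "r0 \<le> r")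
      case True
      then have "r powr (- \<alpha>) * r\<^sup>2 = r powr (2 - \<alpha>)"
        using r0 powr_add[of r "- \<alpha>" 2] by simp
      then show ?thesis using True by (auto simp: radius_weight_def split: split_indicator)
    qed (simp add: radius_weight_def)
  qed
  also have "\<dots> < \<infinity>"
    using nn_integral_has_integral_lebesgue'[OF _ has_integral_powr_to_inf[of "2 - \<alpha>" r0]] r0 \<open>3 < \<alpha>\<close> by simp
  finally show ?thesis .
next
  assume "r1 < \<infinity>"
  then obtain b where b: "r1 = ereal b" using r1 by (cases r1) auto
  have "second_moment \<alpha> r0 r1 \<le> (\<integral>\<^sup>+r. ennreal (b\<^sup>2) * ennreal (radius_weight \<alpha> r0 r1 r) \<partial>lborel)"
    unfolding second_moment_def
    using r0 by (intro nn_integral_mono) (auto simp: radius_weight_def b ennreal_mult[symmetric] mult.commute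
        split: split_indicator intro!: ennreal_leI mult_left_mono power_mono)
  also have "\<dots> = ennreal (b\<^sup>2) * (\<integral>\<^sup>+r. ennreal (radius_weight \<alpha> r0 r1 r) \<partial>lborel)"
    by (rule nn_integral_cmult) measurable
  also have "(\<integral>\<^sup>+r. ennreal (radius_weight \<alpha> r0 r1 r) \<partial>lborel) = ennreal (LINT r|lborel. radius_weight \<alpha> r0 r1 r)"
    by (rule nn_integral_eq_integral) (auto simp: radius_weight_normalizable[OF r0 r1 \<alpha>] radius_weight_nonneg)
  also have "ennreal (b\<^sup>2) * \<dots> < \<infinity>" by (simp add: ennreal_mult_less_top)
  finally show ?thesis .
qed

text \<open>
  A dilated leaf loses at most \<open>C * r * norm h\<close> and at least a multiple of \<open>r * norm h\<close> of its area;
  compared with \<open>r\<^sup>2\<close> the factor \<open>r\<close> is controlled by the smallest radius.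
\<close>

lemma relative_loss_large_radii:
  assumes r0: "0 < r0" and r1: "ereal r0 < r1" and \<alpha>: "1 < \<alpha>" and ar: "r1 < \<infinity> \<or> 3 < \<alpha>" and A2: "cond_A2 P Y"
  shows "\<exists>k>0. \<exists>K\<ge>0. \<forall>h. norm h \<le> 2 \<longrightarrow>
    k * norm h \<le> relative_loss \<alpha> r0 r1 h \<and> relative_loss \<alpha> r0 r1 h \<le> K * norm h"
proof -
  note M2 = second_moment_finite[OF r0 r1 \<alpha> ar]
  define m2 where "m2 = enn2real (second_moment \<alpha> r0 r1)"
  have m2: "second_moment \<alpha> r0 r1 = ennreal m2" "0 < m2"
    using M2 second_moment_pos[OF r0 r1 \<alpha> M2] by (auto simp: m2_def enn2real_positive_iff)
  define N where "N = mass \<alpha> r0 r1"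
  have N: "0 < N" "(\<integral>\<^sup>+r. ennreal (radius_weight \<alpha> r0 r1 r) \<partial>lborel) = ennreal N"
    unfolding N_def by (rule mass_pos[OF r0 r1 \<alpha> M2], rule nn_integral_radius_weight[OF r0 r1 \<alpha> M2])
  have a: "0 < a2" using a1 a2 by simp
  obtain C where C: "0 \<le> C" "\<And>h. mean_loss h \<le> ennreal (C * norm h)"
    using cond_A2_mean_loss_le[OF A2] by blast
  define b where "b = 2 * a2 + 2 / r0"
  have b: "0 < b" using a r0 by (simp add: b_def add_pos_pos)
  have upper: "relative_loss \<alpha> r0 r1 h \<le> C / (r0 * enn2real area) * norm h" for h
  proof -
    have "scaled_loss \<alpha> r0 r1 h \<le> (\<integral>\<^sup>+r. ennreal (radius_weight \<alpha> r0 r1 r * r\<^sup>2) * ennreal (C * norm h / r0) \<partial>lborel)"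
      unfolding scaled_loss_def
    proof (rule nn_integral_mono)
      fix r
      show "ennreal (radius_weight \<alpha> r0 r1 r * r\<^sup>2) * mean_loss (h /\<^sub>R r) \<le>
          ennreal (radius_weight \<alpha> r0 r1 r * r\<^sup>2) * ennreal (C * norm h / r0)"
      proof (cases "r0 \<le> r")
        case True
        have "mean_loss (h /\<^sub>R r) \<le> ennreal (C * norm (h /\<^sub>R r))" by (rule C)
        also have "\<dots> \<le> ennreal (C * norm h / r0)"
          using True r0 C(1) by (intro ennreal_leI) (simp add: field_simps mult_left_mono mult_right_mono)
        finally show ?thesis by (rule mult_left_mono) simp
      qed (simp add: radius_weight_def)
    qed
    also have "\<dots> = second_moment \<alpha> r0 r1 * ennreal (C * norm h / r0)"
      unfolding second_moment_def by (rule nn_integral_multc) measurable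
    also have "\<dots> = ennreal (m2 * (C * norm h / r0))" using m2 C(1) r0 by (simp add: ennreal_mult[symmetric])
    finally have "relative_loss \<alpha> r0 r1 h \<le> m2 * (C * norm h / r0) / (m2 * enn2real area)"
      using m2 C(1) r0 by (intro relative_loss_leI M2) auto
    then show ?thesis using m2 by (simp add: field_simps)
  qed
  have lower: "r0 * N / (b * m2) * norm h \<le> relative_loss \<alpha> r0 r1 h" if h: "norm h \<le> 2" for h
  proof -
    have "area * ennreal (r0 * norm h / b * N) = (\<integral>\<^sup>+r. area * ennreal (r0 * norm h / b) * ennreal (radius_weight \<alpha> r0 r1 r) \<partial>lborel)"
    proof -
      have "(\<integral>\<^sup>+r. area * ennreal (r0 * norm h / b) * ennreal (radius_weight \<alpha> r0 r1 r) \<partial>lborel) =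
          area * ennreal (r0 * norm h / b) * (\<integral>\<^sup>+r. ennreal (radius_weight \<alpha> r0 r1 r) \<partial>lborel)"
        by (rule nn_integral_cmult) measurable
      then show ?thesis using N r0 b by (simp add: mult.assoc ennreal_mult[symmetric])
    qed
    also have "\<dots> \<le> scaled_loss \<alpha> r0 r1 h"
      unfolding scaled_loss_def
    proof (rule nn_integral_mono)
      fix r
      show "area * ennreal (r0 * norm h / b) * ennreal (radius_weight \<alpha> r0 r1 r) \<le>
          ennreal (radius_weight \<alpha> r0 r1 r * r\<^sup>2) * mean_loss (h /\<^sub>R r)"
      proof (cases "r0 \<le> r")
        case True
        then have r: "0 < r" using r0 by simp
        have "r * (2 * a2) + norm h \<le> r * b"
        proof -
          have "r0 * norm h \<le> r * 2" using h True r0 by (intro mult_mono) auto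
          then have "norm h \<le> r * (2 / r0)" using r0 by (simp add: field_simps)
          then show ?thesis by (simp add: b_def distrib_left)
        qed
        then have "area * ennreal (norm h / (r * b)) \<le> mean_loss (h /\<^sub>R r)"
          using r a b by (intro mean_loss_ge_scaled) (auto intro!: divide_left_mono mult_pos_pos add_pos_nonneg)
        then have "ennreal (radius_weight \<alpha> r0 r1 r * r\<^sup>2) * (area * ennreal (norm h / (r * b))) \<le>
            ennreal (radius_weight \<alpha> r0 r1 r * r\<^sup>2) * mean_loss (h /\<^sub>R r)" by (rule mult_left_mono) simp
        moreover have "ennreal (radius_weight \<alpha> r0 r1 r) * ennreal (r0 * norm h / b) \<le>
            ennreal (radius_weight \<alpha> r0 r1 r * r\<^sup>2) * ennreal (norm h / (r * b))"
        proof -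
          have "r0 * norm h / b \<le> r\<^sup>2 * (norm h / (r * b))"
            using True r b by (simp add: power2_eq_square field_simps mult_right_mono)
          then have "radius_weight \<alpha> r0 r1 r * (r0 * norm h / b) \<le> radius_weight \<alpha> r0 r1 r * (r\<^sup>2 * (norm h / (r * b)))"
            by (intro mult_left_mono radius_weight_nonneg)
          then show ?thesis
            using r r0 b by (simp add: ennreal_mult[symmetric] radius_weight_nonneg mult.assoc ennreal_leI)
        qed
        then have "area * (ennreal (radius_weight \<alpha> r0 r1 r) * ennreal (r0 * norm h / b)) \<le>
            area * (ennreal (radius_weight \<alpha> r0 r1 r * r\<^sup>2) * ennreal (norm h / (r * b)))"
          by (rule mult_left_mono) simp
        ultimately show ?thesis by (auto simp: mult_ac intro: order_trans)
      qed (simp add: radius_weight_def)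
    qed
    finally have "r0 * norm h / b * N / m2 \<le> relative_loss \<alpha> r0 r1 h"
      using m2 b N r0 scaled_loss_finite[OF r0 r1 \<alpha> M2] by (intro relative_loss_geI) auto
    then show ?thesis by (simp add: field_simps)
  qed
  have "0 < r0 * N / (b * m2)" "0 \<le> C / (r0 * enn2real area)" using r0 N b m2 C(1) area_real(2) by auto
  then show ?thesis using upper lower by blast
qed

text \<open>
  As the smallest radius tends to 0, the loss is carried by the leaves smaller than \<open>norm h\<close>: they
  lose a fixed part of their area, and \<open>\<integral> r powr (2 - \<alpha>)\<close> over \<open>r \<le> norm h\<close> has order
  \<open>norm h powr (3 - \<alpha>)\<close>. On larger leaves the regularity condition, for an exponent larger than \<open>3 - \<alpha>\<close>,
  gives a contribution of the same order.
\<close>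

lemma relative_loss_small_radii:
  fixes \<alpha> r1 :: real
  assumes \<alpha>: "2 < \<alpha>" "\<alpha> < 3" and r1: "0 < r1" and A3: "cond_A3 P Y"
  shows "\<exists>k>0. \<exists>K\<ge>0. \<forall>h. h \<noteq> 0 \<and> norm h \<le> 2 \<longrightarrow> (\<forall>\<^sub>F r in at_right 0.
    k * norm h powr (3 - \<alpha>) \<le> relative_loss \<alpha> r (ereal r1) h \<and> relative_loss \<alpha> r (ereal r1) h \<le> K * norm h powr (3 - \<alpha>))"
proof -
  \<comment> \<open>\<open>\<delta> < \<alpha> - 2\<close> makes \<open>\<rho> powr (1 - \<alpha> + \<delta>)\<close> integrable at infinity.\<close>
  define \<delta> where "\<delta> = (\<alpha> - 2) / 2"
  have \<delta>: "0 < \<delta>" "\<delta> < 1" "\<delta> < \<alpha> - 2" using \<alpha> by (auto simp: \<delta>_def)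
  have a: "0 < a2" using a1 a2 by simp
  obtain C where C: "0 \<le> C" "\<And>h. mean_loss h \<le> ennreal (C * norm h powr (1 - \<delta>))"
    using cond_A3_mean_loss_le[OF A3 \<delta>(1,2)] by blast
  define g where "g = enn2real area"
  have g: "area = ennreal g" "0 < g" using area_real by (simp_all add: g_def)
  have w: "radius_weight \<alpha> r (ereal r1) \<rho> * \<rho>\<^sup>2 = \<rho> powr (2 - \<alpha>) * indicator {r..r1} \<rho>" if "0 < r" for r \<rho>
  proof (cases "r \<le> \<rho>")
    case True
    then have "\<rho> powr (- \<alpha>) * \<rho>\<^sup>2 = \<rho> powr (2 - \<alpha>)" using that powr_add[of \<rho> "- \<alpha>" 2] by simp
    then show ?thesis by (auto simp: radius_weight_def split: split_indicator)
  qed (simp add: radius_weight_def)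
  have from0: "(\<integral>\<^sup>+\<rho>. ennreal (\<rho> powr (2 - \<alpha>)) * indicator {0..t} \<rho> \<partial>lborel) = ennreal (t powr (3 - \<alpha>) / (3 - \<alpha>))" if "0 \<le> t" for t
    using nn_integral_has_integral_lebesgue'[OF _ has_integral_powr_from_0[of "2 - \<alpha>" t]] \<alpha> that by (simp add: algebra_simps)
  define m where "m = r1 powr (2 - \<alpha>) * (r1 / 2)"
  have m: "0 < m" using r1 by (simp add: m_def)
  have M_ge: "ennreal m \<le> second_moment \<alpha> r (ereal r1)" if r: "0 < r" "r \<le> r1 / 2" for r
  proof -
    have "ennreal m = (\<integral>\<^sup>+\<rho>. ennreal (r1 powr (2 - \<alpha>)) * indicator {r1 / 2..r1} \<rho> \<partial>lborel)"
      using r1 by (simp add: m_def nn_integral_cmult_indicator ennreal_mult[symmetric])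
    also have "\<dots> \<le> second_moment \<alpha> r (ereal r1)"
      unfolding second_moment_def w[OF r(1)] using r r1 \<alpha>
      by (intro nn_integral_mono) (auto split: split_indicator intro!: ennreal_leI powr_mono2')
    finally show ?thesis .
  qed
  define M where "M = r1 powr (3 - \<alpha>) / (3 - \<alpha>)"
  have M: "0 < M" using r1 \<alpha> by (simp add: M_def)
  have M_le: "second_moment \<alpha> r (ereal r1) \<le> ennreal M" if r: "0 < r" for r
  proof -
    have "second_moment \<alpha> r (ereal r1) \<le> (\<integral>\<^sup>+\<rho>. ennreal (\<rho> powr (2 - \<alpha>)) * indicator {0..r1} \<rho> \<partial>lborel)"
      unfolding second_moment_def w[OF r] using r by (intro nn_integral_mono) (auto split: split_indicator)
    also have "\<dots> = ennreal M" using r1 by (simp add: from0 M_def)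
    finally show ?thesis .
  qed
  define K where "K = g / (3 - \<alpha>) + C / (\<alpha> - 2 - \<delta>)"
  have K: "0 \<le> K" using g C \<alpha> \<delta> by (simp add: K_def)
  have upper: "relative_loss \<alpha> r (ereal r1) h \<le> K / (m * g) * norm h powr (3 - \<alpha>)" if r: "0 < r" "r \<le> r1 / 2" and h: "h \<noteq> 0" for r h
  proof -
    define t where "t = norm h"
    have t: "0 < t" using h by (simp add: t_def)
    have "scaled_loss \<alpha> r (ereal r1) h \<le> (\<integral>\<^sup>+\<rho>. area * (ennreal (\<rho> powr (2 - \<alpha>)) * indicator {0..t} \<rho>) +
        ennreal (C * t powr (1 - \<delta>)) * (ennreal (\<rho> powr (1 - \<alpha> + \<delta>)) * indicator {t..} \<rho>) \<partial>lborel)"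
      unfolding scaled_loss_def w[OF r(1)]
    proof (rule nn_integral_mono)
      fix \<rho> :: real
      show "ennreal (\<rho> powr (2 - \<alpha>) * indicator {r..r1} \<rho>) * mean_loss (h /\<^sub>R \<rho>) \<le>
          area * (ennreal (\<rho> powr (2 - \<alpha>)) * indicator {0..t} \<rho>) +
          ennreal (C * t powr (1 - \<delta>)) * (ennreal (\<rho> powr (1 - \<alpha> + \<delta>)) * indicator {t..} \<rho>)"
      proof (cases "\<rho> \<in> {r..r1}")
        case True
        then have \<rho>: "0 < \<rho>" using r by simp
        show ?thesis
        proof (cases "\<rho> \<le> t")
          case le: True
          have "ennreal (\<rho> powr (2 - \<alpha>)) * mean_loss (h /\<^sub>R \<rho>) \<le> ennreal (\<rho> powr (2 - \<alpha>)) * area"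
            by (rule mult_left_mono[OF mean_loss_le_area]) simp
          then show ?thesis using True le \<rho> by (simp add: mult.commute add_increasing2)
        next
          case False
          have "ennreal (\<rho> powr (2 - \<alpha>)) * mean_loss (h /\<^sub>R \<rho>) \<le> ennreal (\<rho> powr (2 - \<alpha>)) * ennreal (C * norm (h /\<^sub>R \<rho>) powr (1 - \<delta>))"
            by (rule mult_left_mono[OF C(2)]) simp
          also have "\<dots> = ennreal (C * t powr (1 - \<delta>) * \<rho> powr (1 - \<alpha> + \<delta>))"
          proof -
            have "norm (h /\<^sub>R \<rho>) powr (1 - \<delta>) = t powr (1 - \<delta>) * \<rho> powr (\<delta> - 1)"
              using \<rho> t by (simp add: t_def powr_mult powr_minus inverse_powr)
                 (metis minus_diff_eq powr_minus)
            moreover have "\<rho> powr (2 - \<alpha>) * \<rho> powr (\<delta> - 1) = \<rho> powr (1 - \<alpha> + \<delta>)"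
              by (simp add: powr_add[symmetric] algebra_simps)
            ultimately have "\<rho> powr (2 - \<alpha>) * (C * norm (h /\<^sub>R \<rho>) powr (1 - \<delta>)) = C * t powr (1 - \<delta>) * \<rho> powr (1 - \<alpha> + \<delta>)"
              by (metis mult.assoc mult.left_commute)
            then show ?thesis using C(1) by (simp add: ennreal_mult[symmetric])
          qed
          finally show ?thesis using True False C(1) by (simp add: ennreal_mult)
        qed
      qed simp
    qed
    also have "\<dots> = area * (\<integral>\<^sup>+\<rho>. ennreal (\<rho> powr (2 - \<alpha>)) * indicator {0..t} \<rho> \<partial>lborel) +
        ennreal (C * t powr (1 - \<delta>)) * (\<integral>\<^sup>+\<rho>. ennreal (\<rho> powr (1 - \<alpha> + \<delta>)) * indicator {t..} \<rho> \<partial>lborel)"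
      by (simp add: nn_integral_add nn_integral_cmult)
    also have "(\<integral>\<^sup>+\<rho>. ennreal (\<rho> powr (1 - \<alpha> + \<delta>)) * indicator {t..} \<rho> \<partial>lborel) = ennreal (t powr (2 - \<alpha> + \<delta>) / (\<alpha> - 2 - \<delta>))"
    proof -
      have e: "1 - \<alpha> + \<delta> < - 1" using \<delta> by simp
      have "- (t powr (1 - \<alpha> + \<delta> + 1)) / (1 - \<alpha> + \<delta> + 1) = t powr (2 - \<alpha> + \<delta>) / (\<alpha> - 2 - \<delta>)"
      proof -
        have "1 - \<alpha> + \<delta> + 1 = 2 - \<alpha> + \<delta>" "\<alpha> - 2 - \<delta> = - (2 - \<alpha> + \<delta>)" by simp_all
        then show ?thesis by (simp only: minus_divide_left[symmetric] divide_minus_right)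
      qed
      then show ?thesis
        using nn_integral_has_integral_lebesgue'[OF _ has_integral_powr_to_inf[OF e t]] by simp
    qed
    also have "area * (\<integral>\<^sup>+\<rho>. ennreal (\<rho> powr (2 - \<alpha>)) * indicator {0..t} \<rho> \<partial>lborel) +
        ennreal (C * t powr (1 - \<delta>)) * ennreal (t powr (2 - \<alpha> + \<delta>) / (\<alpha> - 2 - \<delta>)) = ennreal (K * t powr (3 - \<alpha>))"
    proof -
      have "t powr (1 - \<delta>) * t powr (2 - \<alpha> + \<delta>) = t powr (3 - \<alpha>)" by (simp add: powr_add[symmetric])
      then have "C * t powr (1 - \<delta>) * (t powr (2 - \<alpha> + \<delta>) / (\<alpha> - 2 - \<delta>)) = C / (\<alpha> - 2 - \<delta>) * t powr (3 - \<alpha>)"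
        by (simp add: mult.assoc)
      moreover have "0 \<le> t powr (2 - \<alpha> + \<delta>) / (\<alpha> - 2 - \<delta>)" "0 \<le> C / (\<alpha> - 2 - \<delta>) * t powr (3 - \<alpha>)"
        "0 \<le> g * (t powr (3 - \<alpha>) / (3 - \<alpha>))" using \<delta> C(1) g \<alpha> by auto
      ultimately have "ennreal g * ennreal (t powr (3 - \<alpha>) / (3 - \<alpha>)) + ennreal (C * t powr (1 - \<delta>)) * ennreal (t powr (2 - \<alpha> + \<delta>) / (\<alpha> - 2 - \<delta>))
          = ennreal (g * (t powr (3 - \<alpha>) / (3 - \<alpha>)) + C / (\<alpha> - 2 - \<delta>) * t powr (3 - \<alpha>))"
        using g(2) C(1) \<alpha> by (simp only: ennreal_mult[symmetric] ennreal_plus mult_nonneg_nonneg powr_ge_zero less_imp_le divide_nonneg_pos diff_gt_0_iff_gt)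
      then show ?thesis using t by (simp add: from0 g(1) K_def distrib_right)
    qed
    finally have "relative_loss \<alpha> r (ereal r1) h \<le> K * t powr (3 - \<alpha>) / (m * enn2real area)"
      using r m K M_ge[OF r] M_le[OF r(1)] by (intro relative_loss_leI) (auto intro: le_less_trans)
    then show ?thesis by (simp add: t_def g_def)
  qed
  define c where "c = min 1 (r1 / 2)"
  have c: "0 < c" using r1 by (simp add: c_def)
  have lower: "c powr (3 - \<alpha>) / (2 * (2 * a2 + 1)) / M * norm h powr (3 - \<alpha>) \<le> relative_loss \<alpha> r (ereal r1) h"
    if h: "h \<noteq> 0" "norm h \<le> 2" and r: "0 < r" "r \<le> min (norm h) r1 / 2" for r h
  proof -
    \<comment> \<open>Radii between \<open>b / 2\<close> and \<open>b\<close> already give the order \<open>b powr (3 - \<alpha>)\<close>.\<close>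
    define b where "b = min (norm h) r1"
    have b: "0 < b" "b \<le> norm h" "b \<le> r1" "c * norm h \<le> b"
      using h r1 by (auto simp: b_def c_def min_def mult_le_cancel_right2 field_simps)
    have "c powr (3 - \<alpha>) * norm h powr (3 - \<alpha>) \<le> b powr (3 - \<alpha>)"
      using b c \<alpha> by (subst powr_mult[symmetric]) (auto intro!: powr_mono2)
    then have cb: "c powr (3 - \<alpha>) / (2 * (2 * a2 + 1)) * norm h powr (3 - \<alpha>) \<le> b powr (2 - \<alpha>) * (b / 2) * (1 / (2 * a2 + 1))"
    proof -
      have "b powr (2 - \<alpha>) * (b / 2) * (1 / (2 * a2 + 1)) = b powr (3 - \<alpha>) / (2 * (2 * a2 + 1))"
        using b powr_add[of b "2 - \<alpha>" 1] by simp
      moreover have "c powr (3 - \<alpha>) / (2 * (2 * a2 + 1)) * norm h powr (3 - \<alpha>) = c powr (3 - \<alpha>) * norm h powr (3 - \<alpha>) / (2 * (2 * a2 + 1))"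
        by simp
      moreover have "c powr (3 - \<alpha>) * norm h powr (3 - \<alpha>) / (2 * (2 * a2 + 1)) \<le> b powr (3 - \<alpha>) / (2 * (2 * a2 + 1))"
        using \<open>c powr (3 - \<alpha>) * norm h powr (3 - \<alpha>) \<le> b powr (3 - \<alpha>)\<close> a by (intro divide_right_mono) auto
      ultimately show ?thesis by (simp only:)
    qed
    have "area * ennreal (c powr (3 - \<alpha>) / (2 * (2 * a2 + 1)) * norm h powr (3 - \<alpha>)) \<le>
        area * ennreal (b powr (2 - \<alpha>) * (b / 2) * (1 / (2 * a2 + 1)))"
      by (intro mult_left_mono ennreal_leI cb) simp
    also have "\<dots> = (\<integral>\<^sup>+\<rho>. ennreal (b powr (2 - \<alpha>)) * (area * ennreal (1 / (2 * a2 + 1))) * indicator {b / 2..b} \<rho> \<partial>lborel)"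
    proof -
      have "emeasure lborel {b / 2..b} = ennreal (b / 2)" using b by simp
      moreover have "ennreal (b powr (2 - \<alpha>) * (b / 2) * (1 / (2 * a2 + 1))) =
          ennreal (b powr (2 - \<alpha>)) * ennreal (b / 2) * ennreal (1 / (2 * a2 + 1))"
        using a b by (simp add: ennreal_mult[symmetric])
      ultimately show ?thesis by (subst nn_integral_cmult_indicator) (simp_all only: mult_ac atLeastAtMost_borel sets_lborel)
    qed
    also have "\<dots> \<le> scaled_loss \<alpha> r (ereal r1) h"
      unfolding scaled_loss_def w[OF r(1)]
    proof (rule nn_integral_mono)
      fix \<rho> :: real
      show "ennreal (b powr (2 - \<alpha>)) * (area * ennreal (1 / (2 * a2 + 1))) * indicator {b / 2..b} \<rho> \<le>
          ennreal (\<rho> powr (2 - \<alpha>) * indicator {r..r1} \<rho>) * mean_loss (h /\<^sub>R \<rho>)"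
      proof (cases "\<rho> \<in> {b / 2..b}")
        case True
        then have \<rho>: "0 < \<rho>" "\<rho> \<le> norm h" "\<rho> \<in> {r..r1}" using b r by (auto simp: b_def)
        have "\<rho> * (2 * a2) + norm h \<le> norm h * (2 * a2 + 1)"
          using \<rho> a by (simp add: distrib_left mult_right_mono)
        then have "1 / (2 * a2 + 1) \<le> norm h / (\<rho> * (2 * a2) + norm h)"
          using \<rho> a h by (simp add: pos_le_divide_eq pos_divide_le_eq add_pos_pos mult.commute)
        then have "area * ennreal (1 / (2 * a2 + 1)) \<le> mean_loss (h /\<^sub>R \<rho>)"
          using \<rho> a by (intro mean_loss_ge_scaled) auto
        moreover have "b powr (2 - \<alpha>) \<le> \<rho> powr (2 - \<alpha>)" using True \<rho> \<alpha> by (intro powr_mono2') auto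
        ultimately show ?thesis using True \<rho>(3) by (auto intro!: mult_mono ennreal_leI)
      qed simp
    qed
    finally have "c powr (3 - \<alpha>) / (2 * (2 * a2 + 1)) * norm h powr (3 - \<alpha>) / M \<le> relative_loss \<alpha> r (ereal r1) h"
    proof (rule relative_loss_geI[OF M M_le[OF r(1)], rotated 2])
      have lt: "ereal r < ereal r1" using r r1 by simp
      have fin: "second_moment \<alpha> r (ereal r1) < \<infinity>" using M_le[OF r(1)] by (auto intro: le_less_trans)
      show "0 < second_moment \<alpha> r (ereal r1)" using \<alpha> by (intro second_moment_pos r lt fin) simp
      show "scaled_loss \<alpha> r (ereal r1) h < \<infinity>" using \<alpha> by (intro scaled_loss_finite r lt fin) simp
      show "0 \<le> c powr (3 - \<alpha>) / (2 * (2 * a2 + 1)) * norm h powr (3 - \<alpha>)" using a by simp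
    qed
    then show ?thesis by (simp add: field_simps)
  qed
  have "\<forall>\<^sub>F r in at_right 0. c powr (3 - \<alpha>) / (2 * (2 * a2 + 1)) / M * norm h powr (3 - \<alpha>) \<le> relative_loss \<alpha> r (ereal r1) h \<and>
      relative_loss \<alpha> r (ereal r1) h \<le> K / (m * g) * norm h powr (3 - \<alpha>)" if h: "h \<noteq> 0" "norm h \<le> 2" for h
  proof -
    have "\<forall>\<^sub>F r in at_right (0::real). r \<in> {0<..<min (norm h) r1 / 2}"
      using h r1 by (intro eventually_at_right_real) auto
    then show ?thesis
      by eventually_elim (use h lower[of h] upper[of _ h] in auto)
  qed
  moreover have "0 < c powr (3 - \<alpha>) / (2 * (2 * a2 + 1)) / M" "0 \<le> K / (m * g)" using c a M K m g by auto
  ultimately show ?thesis by blast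
qed

end

section \<open>The limit of vanishing radii and the main theorem\<close>

lemma fdd_limit_integral:
  fixes I :: "'w \<Rightarrow> plane \<Rightarrow> real" and J :: "real \<Rightarrow> 'v \<Rightarrow> plane \<Rightarrow> real" and \<phi> :: "real \<Rightarrow> real"
  assumes lim: "fdd_limit \<Omega>' J G \<Omega> I"
    and \<phi>: "continuous_on UNIV \<phi>" "\<And>t. 0 \<le> \<phi> t" "\<And>t. \<phi> t \<le> 1"
  shows "((\<lambda>r. LINT \<omega>|\<Omega>' r. \<phi> (J r \<omega> x - J r \<omega> y)) \<longlongrightarrow> (LINT \<omega>|\<Omega>. \<phi> (I \<omega> x - I \<omega> y))) G"
    and "((\<lambda>r. LINT \<omega>|\<Omega>' r. \<phi> (J r \<omega> x)) \<longlongrightarrow> (LINT \<omega>|\<Omega>. \<phi> (I \<omega> x))) G"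
proof -
  have \<phi>c: "continuous_map euclideanreal euclideanreal \<phi>" using \<phi>(1) by simp
  have b: "bounded ((\<lambda>f. \<phi> (h f)) ` A)" for h :: "(plane \<Rightarrow> real) \<Rightarrow> real" and A
    using \<phi>(2,3) by (intro boundedI[where B = 1]) auto
  have "continuous_map (product_topology (\<lambda>_. euclideanreal) {x, y}) euclideanreal (\<lambda>f. f x - f y)"
    by (intro continuous_map_diff continuous_map_product_projection) auto
  from continuous_map_compose[OF this \<phi>c]
  have c: "continuous_map (product_topology (\<lambda>_. euclideanreal) {x, y}) euclideanreal (\<lambda>f. \<phi> (f x - f y))"
    by (simp add: comp_def)
  show "((\<lambda>r. LINT \<omega>|\<Omega>' r. \<phi> (J r \<omega> x - J r \<omega> y)) \<longlongrightarrow> (LINT \<omega>|\<Omega>. \<phi> (I \<omega> x - I \<omega> y))) G"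
    using lim[unfolded fdd_limit_def, rule_format, of "{x, y}" "\<lambda>f. \<phi> (f x - f y)"] b c by simp
  have "continuous_map (product_topology (\<lambda>_. euclideanreal) {x}) euclideanreal (\<lambda>f. f x)"
    by (intro continuous_map_product_projection) auto
  from continuous_map_compose[OF this \<phi>c]
  have c: "continuous_map (product_topology (\<lambda>_. euclideanreal) {x}) euclideanreal (\<lambda>f. \<phi> (f x))"
    by (simp add: comp_def)
  show "((\<lambda>r. LINT \<omega>|\<Omega>' r. \<phi> (J r \<omega> x)) \<longlongrightarrow> (LINT \<omega>|\<Omega>. \<phi> (I \<omega> x))) G"
    using lim[unfolded fdd_limit_def, rule_format, of "{x}" "\<lambda>f. \<phi> (f x)"] b c by simp
qed

lemma besov_moment_finite_iff:
  assumes \<Omega>: "prob_space \<Omega>" and mm: "measurable_modification \<Omega> I I'"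
    and p: "1 \<le> p" and s: "0 < s" and \<beta>: "0 < \<beta>" and k: "0 < k" and K: "0 \<le> K"
    and range: "\<And>x. AE \<omega> in \<Omega>. \<bar>I \<omega> x\<bar> \<le> 1"
    and ge: "\<And>x y. norm (x - y) \<le> 2 \<Longrightarrow> ennreal (k * norm (x - y) powr \<beta>) \<le> (\<integral>\<^sup>+\<omega>. ennreal (\<bar>I \<omega> x - I \<omega> y\<bar> powr p) \<partial>\<Omega>)"
    and le: "\<And>x y. norm (x - y) \<le> 2 \<Longrightarrow> (\<integral>\<^sup>+\<omega>. ennreal (\<bar>I \<omega> x - I \<omega> y\<bar> powr p) \<partial>\<Omega>) \<le> ennreal (K * norm (x - y) powr \<beta>)"
  shows "(\<integral>\<^sup>+\<omega>. epowr (besov_norm s p p (I' \<omega>)) p \<partial>\<Omega>) < \<infinity> \<longleftrightarrow> s < \<beta> / p"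
proof -
  have joint: "(\<lambda>(\<omega>, x). I' \<omega> x) \<in> borel_measurable (\<Omega> \<Otimes>\<^sub>M borel)"
    and eq: "\<And>x. AE \<omega> in \<Omega>. I' \<omega> x = I \<omega> x"
    using mm by (auto simp: measurable_modification_def)
  have moment: "(\<integral>\<^sup>+\<omega>. ennreal (\<bar>I' \<omega> x - I' \<omega> y\<bar> powr p) \<partial>\<Omega>) = (\<integral>\<^sup>+\<omega>. ennreal (\<bar>I \<omega> x - I \<omega> y\<bar> powr p) \<partial>\<Omega>)" for x y
  proof (rule nn_integral_cong_AE)
    show "AE \<omega> in \<Omega>. ennreal (\<bar>I' \<omega> x - I' \<omega> y\<bar> powr p) = ennreal (\<bar>I \<omega> x - I \<omega> y\<bar> powr p)"
      using eq[of x] eq[of y] by eventually_elim simp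
  qed
  have range': "AE \<omega> in \<Omega>. \<bar>I' \<omega> x\<bar> \<le> 1" for x
    using eq[of x] range[of x] by eventually_elim simp
  have close: "norm (x - y) \<le> 2" if "x \<in> unit_square" "y \<in> unit_square" for x y :: plane
  proof -
    have "\<bar>(x - y) $ i\<bar> \<le> 1" for i
      using that unfolding mem_unit_square vector_minus_component by (smt (verit))
    from this[of 1] this[of 2] norm_le_abs_sum[of "x - y"] show ?thesis by linarith
  qed
  have iff: "s < \<beta> / p \<longleftrightarrow> s * p < \<beta>" using p by (simp add: field_simps)
  show ?thesis
  proof (cases "s * p < \<beta>")
    case True
    have "(\<integral>\<^sup>+\<omega>. epowr (besov_norm s p p (I' \<omega>)) p \<partial>\<Omega>) < \<infinity>"
      by (rule besov_moment_finite[OF \<Omega> joint p s \<beta> range' K True]) (simp add: moment le close)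
    then show ?thesis using True iff by simp
  next
    case False
    have "(\<integral>\<^sup>+\<omega>. epowr (besov_norm s p p (I' \<omega>)) p \<partial>\<Omega>) = \<infinity>"
      by (rule besov_moment_infinite[OF \<Omega> joint p s \<beta> k]) (use False in \<open>auto simp: moment intro: ge close\<close>)
    then show ?thesis using False iff by simp
  qed
qed

context random_shape begin

lemma besov_large_radii:
  assumes r0: "0 < r0" and r1: "ereal r0 < r1" and \<alpha>: "1 < \<alpha>" and ar: "r1 < \<infinity> \<or> 3 < \<alpha>" and A2: "cond_A2 P Y"
    and cdl: "colored_dead_leaves \<Omega> (scaled_law P Y \<alpha> r0 r1) Z X U I" and mm: "measurable_modification \<Omega> I I'"
    and p: "1 \<le> p" and s: "0 < s"
  shows "(\<integral>\<^sup>+\<omega>. epowr (besov_norm s p p (I' \<omega>)) p \<partial>\<Omega>) < \<infinity> \<longleftrightarrow> s < 1 / p"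
proof -
  note moments = two_point_moments[OF r0 r1 \<alpha> second_moment_finite[OF r0 r1 \<alpha> ar] cdl p]
  obtain k K where k: "0 < k" "0 \<le> K" "\<And>h. norm h \<le> 2 \<Longrightarrow> k * norm h \<le> relative_loss \<alpha> r0 r1 h"
    "\<And>h. norm h \<le> 2 \<Longrightarrow> relative_loss \<alpha> r0 r1 h \<le> K * norm h"
    using relative_loss_large_radii[OF r0 r1 \<alpha> ar A2] by blast
  interpret cdl: colored_dead_leaves \<Omega> "scaled_law P Y \<alpha> r0 r1" Z X U I by (rule cdl)
  define cu where "cu = 2 / (1 - exp (- 1 :: real))"
  define cl where "cl = exp (- 1 :: real) / (9 * 3 powr p)"
  have c: "0 \<le> cu" "0 < cl" by (auto simp: cu_def cl_def)
  show ?thesis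
  proof (rule besov_moment_finite_iff[where k = "cl * k" and K = "cu * K"])
    show "prob_space \<Omega>" by (rule cdl.prob_space_axioms)
    show "AE \<omega> in \<Omega>. \<bar>I \<omega> x\<bar> \<le> 1" for x using moments(1)[of x] by eventually_elim auto
    show "0 < cl * k" "0 \<le> cu * K" using c k by auto
    fix x y :: plane assume xy: "norm (x - y) \<le> 2"
    have "ennreal (cl * k * norm (x - y) powr 1) \<le> ennreal (cl * relative_loss \<alpha> r0 r1 (x - y))"
      using c k(3)[OF xy] by (intro ennreal_leI) (simp add: mult.assoc)
    also have "\<dots> \<le> (\<integral>\<^sup>+\<omega>. ennreal (\<bar>I \<omega> x - I \<omega> y\<bar> powr p) \<partial>\<Omega>)" unfolding cl_def by (rule moments(3))
    finally show "ennreal (cl * k * norm (x - y) powr 1) \<le> (\<integral>\<^sup>+\<omega>. ennreal (\<bar>I \<omega> x - I \<omega> y\<bar> powr p) \<partial>\<Omega>)" .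
    have "(\<integral>\<^sup>+\<omega>. ennreal (\<bar>I \<omega> x - I \<omega> y\<bar> powr p) \<partial>\<Omega>) \<le> ennreal (cu * relative_loss \<alpha> r0 r1 (x - y))"
      unfolding cu_def by (rule moments(2))
    also have "\<dots> \<le> ennreal (cu * K * norm (x - y) powr 1)"
      using c k(4)[OF xy] by (intro ennreal_leI) (simp add: mult.assoc mult_left_mono)
    finally show "(\<integral>\<^sup>+\<omega>. ennreal (\<bar>I \<omega> x - I \<omega> y\<bar> powr p) \<partial>\<Omega>) \<le> ennreal (cu * K * norm (x - y) powr 1)" .
  qed (use mm p s in auto)
qed

text \<open>
  The bounds on the increments of the approximating fields have constants that do not depend on the
  smallest radius. A power of an increment is a continuous function of two values of the field,
  bounded once it is truncated at 1, so the bounds hold for the limit.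
\<close>

lemma besov_small_radii:
  fixes \<alpha> r1 :: real
  assumes \<alpha>: "2 < \<alpha>" "\<alpha> < 3" and r1: "0 < r1" and A3: "cond_A3 P Y"
    and cdl: "\<forall>r\<in>{0<..<r1}. colored_dead_leaves (\<Omega>' r) (scaled_law P Y \<alpha> r (ereal r1)) (Z r) (X r) (U r) (J r)"
    and \<Omega>: "prob_space \<Omega>" and field: "random_field \<Omega> I" and lim: "fdd_limit \<Omega>' J (at_right 0) \<Omega> I"
    and mm: "measurable_modification \<Omega> I I'" and p: "1 \<le> p" and s: "0 < s"
  shows "(\<integral>\<^sup>+\<omega>. epowr (besov_norm s p p (I' \<omega>)) p \<partial>\<Omega>) < \<infinity> \<longleftrightarrow> s < (3 - \<alpha>) / p"
proof -
  interpret \<Omega>: prob_space \<Omega> by (rule \<Omega>)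
  have Im [measurable]: "(\<lambda>\<omega>. I \<omega> x) \<in> borel_measurable \<Omega>" for x using field by (simp add: random_field_def)
  obtain k K where k: "0 < k" "0 \<le> K" and kK: "\<And>h. h \<noteq> 0 \<Longrightarrow> norm h \<le> 2 \<Longrightarrow> \<forall>\<^sub>F r in at_right 0.
      k * norm h powr (3 - \<alpha>) \<le> relative_loss \<alpha> r (ereal r1) h \<and> relative_loss \<alpha> r (ereal r1) h \<le> K * norm h powr (3 - \<alpha>)"
    using relative_loss_small_radii[OF \<alpha> r1 A3] by blast
  define cu where "cu = 2 / (1 - exp (- 1 :: real))"
  define cl where "cl = exp (- 1 :: real) / (9 * 3 powr p)"
  have c: "0 \<le> cu" "0 < cl" by (auto simp: cu_def cl_def)
  have small: "\<forall>\<^sub>F r in at_right (0::real). r \<in> {0<..<r1}" using r1 by (rule eventually_at_right_real)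
  have moments: "AE \<omega> in \<Omega>' r. J r \<omega> x \<in> {0<..<1}"
    "(\<integral>\<^sup>+\<omega>. ennreal (\<bar>J r \<omega> x - J r \<omega> y\<bar> powr p) \<partial>\<Omega>' r) \<le> ennreal (cu * relative_loss \<alpha> r (ereal r1) (x - y))"
    "ennreal (cl * relative_loss \<alpha> r (ereal r1) (x - y)) \<le> (\<integral>\<^sup>+\<omega>. ennreal (\<bar>J r \<omega> x - J r \<omega> y\<bar> powr p) \<partial>\<Omega>' r)"
    if r: "r \<in> {0<..<r1}" for r x y
  proof -
    have "0 < r" "ereal r < ereal r1" "1 < \<alpha>" using r \<alpha> by auto
    note two_point_moments[OF this second_moment_finite[OF this] bspec[OF cdl r] p]
    then show "AE \<omega> in \<Omega>' r. J r \<omega> x \<in> {0<..<1}"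
      "(\<integral>\<^sup>+\<omega>. ennreal (\<bar>J r \<omega> x - J r \<omega> y\<bar> powr p) \<partial>\<Omega>' r) \<le> ennreal (cu * relative_loss \<alpha> r (ereal r1) (x - y))"
      "ennreal (cl * relative_loss \<alpha> r (ereal r1) (x - y)) \<le> (\<integral>\<^sup>+\<omega>. ennreal (\<bar>J r \<omega> x - J r \<omega> y\<bar> powr p) \<partial>\<Omega>' r)"
      unfolding cu_def cl_def by simp_all
  qed
  \<comment> \<open>The distance to \<open>[0, 1]\<close> is a continuous test function, so the limit field has values there as well.\<close>
  have range: "AE \<omega> in \<Omega>. I \<omega> x \<in> {0..1}" for x
  proof -
    define \<phi> :: "real \<Rightarrow> real" where "\<phi> t = min 1 (max 0 (t - 1) + max 0 (- t))" for t
    have \<phi>: "continuous_on UNIV \<phi>" "\<And>t. 0 \<le> \<phi> t" "\<And>t. \<phi> t \<le> 1"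
      unfolding \<phi>_def by (auto intro!: continuous_on_min continuous_on_add continuous_on_max continuous_on_diff continuous_on_minus continuous_on_const continuous_on_id)
    have [measurable]: "\<phi> \<in> borel_measurable borel" by (rule borel_measurable_continuous_onI[OF \<phi>(1)])
    have "\<forall>\<^sub>F r in at_right 0. (LINT \<omega>|\<Omega>' r. \<phi> (J r \<omega> x)) = 0"
      using small
    proof eventually_elim
      case (elim r)
      have "AE \<omega> in \<Omega>' r. \<phi> (J r \<omega> x) = 0" using moments(1)[OF elim, of x] by eventually_elim (simp add: \<phi>_def)
      then show ?case by (rule integral_eq_zero_AE)
    qed
    then have "((\<lambda>r. LINT \<omega>|\<Omega>' r. \<phi> (J r \<omega> x)) \<longlongrightarrow> 0) (at_right 0)" by (rule tendsto_eventually)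
    then have "(LINT \<omega>|\<Omega>. \<phi> (I \<omega> x)) = 0"
      using fdd_limit_integral(2)[OF lim \<phi>] by (intro tendsto_unique[OF trivial_limit_at_right_real])
    moreover have "integrable \<Omega> (\<lambda>\<omega>. \<phi> (I \<omega> x))"
      by (rule \<Omega>.integrable_const_bound[where B = 1]) (use \<phi> in auto)
    ultimately have "AE \<omega> in \<Omega>. \<phi> (I \<omega> x) = 0"
      using \<phi>(2) by (subst (asm) integral_nonneg_eq_0_iff_AE) auto
    then show ?thesis by eventually_elim (auto simp: \<phi>_def min_def max_def split: if_splits)
  qed
  define \<psi> :: "real \<Rightarrow> real" where "\<psi> t = min 1 (\<bar>t\<bar> powr p)" for t
  have \<psi>: "continuous_on UNIV \<psi>" "\<And>t. 0 \<le> \<psi> t" "\<And>t. \<psi> t \<le> 1"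
    unfolding \<psi>_def using p by (auto intro!: continuous_on_min continuous_on_rabs continuous_on_const continuous_on_id continuous_on_powr')
  have [measurable]: "\<psi> \<in> borel_measurable borel" by (rule borel_measurable_continuous_onI[OF \<psi>(1)])
  have \<psi>_eq: "\<psi> (a - b) = \<bar>a - b\<bar> powr p" if "a \<in> {0..1}" "b \<in> {0..1}" for a b
  proof -
    have "\<bar>a - b\<bar> \<le> 1" using that by auto
    then have "\<bar>a - b\<bar> powr p \<le> 1" using p by (intro powr_le1) auto
    then show ?thesis by (simp add: \<psi>_def)
  qed
  have nn: "(\<integral>\<^sup>+\<omega>. ennreal (\<bar>F \<omega> x - F \<omega> y\<bar> powr p) \<partial>N) = ennreal (LINT \<omega>|N. \<psi> (F \<omega> x - F \<omega> y))"
    if N: "prob_space N" "\<And>x. (\<lambda>\<omega>. F \<omega> x) \<in> borel_measurable N" and F: "\<And>x. AE \<omega> in N. F \<omega> x \<in> {0..1}"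
    for N :: "'c measure" and F :: "'c \<Rightarrow> plane \<Rightarrow> real" and x y
  proof -
    interpret N: prob_space N by (rule N)
    have [measurable]: "(\<lambda>\<omega>. F \<omega> x) \<in> borel_measurable N" for x by (rule N)
    have "(\<integral>\<^sup>+\<omega>. ennreal (\<bar>F \<omega> x - F \<omega> y\<bar> powr p) \<partial>N) = (\<integral>\<^sup>+\<omega>. ennreal (\<psi> (F \<omega> x - F \<omega> y)) \<partial>N)"
    proof (rule nn_integral_cong_AE)
      show "AE \<omega> in N. ennreal (\<bar>F \<omega> x - F \<omega> y\<bar> powr p) = ennreal (\<psi> (F \<omega> x - F \<omega> y))"
        using F[of x] F[of y] by eventually_elim (simp only: \<psi>_eq)
    qed
    also have "\<dots> = ennreal (LINT \<omega>|N. \<psi> (F \<omega> x - F \<omega> y))"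
    proof (rule nn_integral_eq_integral)
      show "integrable N (\<lambda>\<omega>. \<psi> (F \<omega> x - F \<omega> y))"
        by (rule N.integrable_const_bound[where B = 1]) (use \<psi> in auto)
    qed (use \<psi> in auto)
    finally show ?thesis .
  qed
  have bounds: "cl * k * norm (x - y) powr (3 - \<alpha>) \<le> (LINT \<omega>|\<Omega>. \<psi> (I \<omega> x - I \<omega> y)) \<and>
      (LINT \<omega>|\<Omega>. \<psi> (I \<omega> x - I \<omega> y)) \<le> cu * K * norm (x - y) powr (3 - \<alpha>)"
    if xy: "x \<noteq> y" "norm (x - y) \<le> 2" for x y
  proof -
    have "\<forall>\<^sub>F r in at_right 0. cl * k * norm (x - y) powr (3 - \<alpha>) \<le> (LINT \<omega>|\<Omega>' r. \<psi> (J r \<omega> x - J r \<omega> y)) \<and>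
        (LINT \<omega>|\<Omega>' r. \<psi> (J r \<omega> x - J r \<omega> y)) \<le> cu * K * norm (x - y) powr (3 - \<alpha>)"
      using small kK[of "x - y", simplified right_minus_eq, OF xy]
    proof eventually_elim
      case (elim r)
      interpret J: colored_dead_leaves "\<Omega>' r" "scaled_law P Y \<alpha> r (ereal r1)" "Z r" "X r" "U r" "J r"
        using cdl elim(1) by blast
      have l0: "0 \<le> (LINT \<omega>|\<Omega>' r. \<psi> (J r \<omega> x - J r \<omega> y))" using \<psi>(2) by (intro Bochner_Integration.integral_nonneg) auto
      have "AE \<omega> in \<Omega>' r. J r \<omega> v \<in> {0..1}" for v using moments(1)[OF elim(1), of v] by eventually_elim auto
      then have e: "(\<integral>\<^sup>+\<omega>. ennreal (\<bar>J r \<omega> x - J r \<omega> y\<bar> powr p) \<partial>\<Omega>' r) = ennreal (LINT \<omega>|\<Omega>' r. \<psi> (J r \<omega> x - J r \<omega> y))"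
        using J.field by (intro nn J.prob_space_axioms) (auto simp: random_field_def)
      have rl: "0 \<le> relative_loss \<alpha> r (ereal r1) (x - y)" by (simp add: relative_loss_def)
      have "cl * relative_loss \<alpha> r (ereal r1) (x - y) \<le> (LINT \<omega>|\<Omega>' r. \<psi> (J r \<omega> x - J r \<omega> y))"
        using moments(3)[OF elim(1), of x y] l0 by (simp add: e)
      moreover have "(LINT \<omega>|\<Omega>' r. \<psi> (J r \<omega> x - J r \<omega> y)) \<le> cu * relative_loss \<alpha> r (ereal r1) (x - y)"
        using moments(2)[OF elim(1), of x y] c rl by (simp add: e)
      moreover have "cl * (k * norm (x - y) powr (3 - \<alpha>)) \<le> cl * relative_loss \<alpha> r (ereal r1) (x - y)"
        "cu * relative_loss \<alpha> r (ereal r1) (x - y) \<le> cu * (K * norm (x - y) powr (3 - \<alpha>))"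
        using elim(2) c by (auto intro!: mult_left_mono)
      ultimately show ?case by (simp add: mult.assoc)
    qed
    then have ev: "\<forall>\<^sub>F r in at_right 0. cl * k * norm (x - y) powr (3 - \<alpha>) \<le> (LINT \<omega>|\<Omega>' r. \<psi> (J r \<omega> x - J r \<omega> y))"
      "\<forall>\<^sub>F r in at_right 0. (LINT \<omega>|\<Omega>' r. \<psi> (J r \<omega> x - J r \<omega> y)) \<le> cu * K * norm (x - y) powr (3 - \<alpha>)"
      by (auto elim: eventually_mono)
    show ?thesis
      using tendsto_lowerbound[OF fdd_limit_integral(1)[OF lim \<psi>] ev(1)]
        tendsto_upperbound[OF fdd_limit_integral(1)[OF lim \<psi>] ev(2)] by simp
  qed
  show ?thesis
  proof (rule besov_moment_finite_iff[where k = "cl * k" and K = "cu * K"])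
    show "AE \<omega> in \<Omega>. \<bar>I \<omega> x\<bar> \<le> 1" for x using range[of x] by eventually_elim auto
    show "0 < cl * k" "0 \<le> cu * K" using c k by auto
    fix x y :: plane assume xy: "norm (x - y) \<le> 2"
    show "ennreal (cl * k * norm (x - y) powr (3 - \<alpha>)) \<le> (\<integral>\<^sup>+\<omega>. ennreal (\<bar>I \<omega> x - I \<omega> y\<bar> powr p) \<partial>\<Omega>)"
    proof (cases "x = y")
      case False
      then show ?thesis using bounds[OF False xy] by (simp add: nn[of \<Omega> I, OF \<Omega> Im range] ennreal_leI)
    qed simp
    show "(\<integral>\<^sup>+\<omega>. ennreal (\<bar>I \<omega> x - I \<omega> y\<bar> powr p) \<partial>\<Omega>) \<le> ennreal (cu * K * norm (x - y) powr (3 - \<alpha>))"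
    proof (cases "x = y")
      case True
      then show ?thesis using p by simp
    next
      case False
      then show ?thesis using bounds[OF False xy] by (simp add: nn[of \<Omega> I, OF \<Omega> Im range] ennreal_leI)
    qed
  qed (use \<Omega> mm p s \<alpha> in auto)
qed

end

theorem proposition13:
  fixes P :: "'y measure" and Y :: "'y \<Rightarrow> plane set" and a1 a2 p s :: real
  assumes "prob_space P" and "random_compact_set P Y"
    and "0 < a1" and "a1 < a2"
    and "AE \<omega> in P. cball 0 a1 \<subseteq> Y \<omega> \<and> Y \<omega> \<subseteq> cball 0 a2"
    and "AE \<omega> in P. emeasure lborel (frontier (Y \<omega>)) = 0"
    and "1 \<le> p" and "0 < s" and "s < 1"
  shows
    "(\<forall>\<alpha> r0 (r1 :: ereal) (\<Omega> :: 'w measure) Z X U I I'.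
        ((1 < \<alpha> \<and> \<alpha> \<le> 3 \<and> 0 < r0 \<and> ereal r0 < r1 \<and> r1 < \<infinity>) \<or>
         (3 < \<alpha> \<and> 0 < r0 \<and> ereal r0 < r1 \<and> r1 \<le> \<infinity>)) \<longrightarrow>
        cond_A2 P Y \<longrightarrow>
        colored_dead_leaves \<Omega> (scaled_law P Y \<alpha> r0 r1) Z X U I \<longrightarrow>
        measurable_modification \<Omega> I I' \<longrightarrow>
        ((\<integral>\<^sup>+\<omega>. epowr (besov_norm s p p (I' \<omega>)) p \<partial>\<Omega>) < \<infinity> \<longleftrightarrow> s < 1 / p))
     \<and>
     (\<forall>\<alpha> (r1 :: real) (\<Omega>' :: real \<Rightarrow> 'v measure) Z X U J (\<Omega> :: 'w measure) I I'.
        2 < \<alpha> \<and> \<alpha> < 3 \<and> 0 < r1 \<longrightarrow>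
        cond_A3 P Y \<longrightarrow>
        (\<forall>r\<in>{0<..<r1}.
           colored_dead_leaves (\<Omega>' r) (scaled_law P Y \<alpha> r (ereal r1)) (Z r) (X r) (U r) (J r)) \<longrightarrow>
        prob_space \<Omega> \<and> random_field \<Omega> I \<and> fdd_limit \<Omega>' J (at_right 0) \<Omega> I \<longrightarrow>
        measurable_modification \<Omega> I I' \<longrightarrow>
        ((\<integral>\<^sup>+\<omega>. epowr (besov_norm s p p (I' \<omega>)) p \<partial>\<Omega>) < \<infinity> \<longleftrightarrow> s < (3 - \<alpha>) / p))"
proof -
  interpret random_shape P Y a1 a2
    by (rule random_shape.intro) (use assms in \<open>auto simp: random_shape_axioms_def\<close>)
  show ?thesis
  proof (intro conjI allI impI, goal_cases)
    case (1 \<alpha> r0 r1 \<Omega> Z X U I I')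
    then show ?case
      using assms(7,8) by (intro besov_large_radii) auto
  next
    case (2 \<alpha> r1 \<Omega>' Z X U J \<Omega> I I')
    then show ?case
      using assms(7,8) by (intro besov_small_radii[of \<alpha> r1 \<Omega>' Z X U J]) auto
  qed
qed

end
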